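(* Let $G$ be a second-countable, locally compact, Hausdorff, étale and principal groupoid, and $\sigma:G^{(2)}\to\mathbb{T}$ a continuous normalised $2$-cocycle. The homomorphism $\rho$ of $C_c(G^\sigma;G)$ onto $C_c(G,\overline{\sigma})$ given by $\rho(f)(\alpha)=f(1,\alpha)$ extends to an isomorphism of $C^*(G^\sigma;G)^{\mathrm{Kum}}$ onto the reduced twisted groupoid $C^*$-algebra $C^*_{\mathrm r}(G,\overline{\sigma})$.
   Context: A groupoid is principal if there is at most one morphism between each pair of units; a topological groupoid is étale if $r$ is a local homeomorphism, and then its Haar system consists of counting measures. A continuous normalised $2$-cocycle is a continuous $\sigma:G^{(2)}\to\mathbb{T}$ with $\sigma(\alpha,\beta)\sigma(\alpha\beta,\gamma)=\sigma(\beta,\gamma)\sigma(\alpha,\beta\gamma)$ and $\sigma(r(\gamma),\gamma)=1=\sigma(\gamma,s(\gamma))$. For a continuous normalised $2$-cocycle $\tau$ on $G$, $C_c(G,\tau)$ is $C_c(G)$ with $(f*g)(\alpha)=\sum_{r(\beta)=r(\alpha)}f(\beta)g(\beta^{-1}\alpha)\tau(\beta,\beta^{-1}\alpha)$ and $f^*(\alpha)=\overline{f(\alpha^{-1})\tau(\alpha,\alpha^{-1})}$. For $u\in G^{(0)}$, $\operatorname{Ind}_u^\tau$ acts on $\ell^2(s^{-1}(u))$ by $(\operatorname{Ind}_u^\tau(f)\xi)(\alpha)=\sum_{r(\beta)=r(\alpha)}f(\beta)\xi(\beta^{-1}\alpha)\tau(\beta,\beta^{-1}\alpha)$, and $C^*_{\mathrm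 r}(G,\tau)$ is the completion of $C_c(G,\tau)$ in the norm $\sup_u\|\operatorname{Ind}_u^\tau(f)\|$. $G^\sigma$ is the groupoid $\mathbb{T}\times G$ with the product topology, $r(z,\alpha)=(1,r(\alpha))$, $s(z,\alpha)=(1,s(\alpha))$, $(w,\alpha)(z,\beta)=(wz\sigma(\alpha,\beta),\alpha\beta)$, $(z,\alpha)^{-1}=(z^{-1}\sigma(\alpha,\alpha^{-1})^{-1},\alpha^{-1})$, with Haar system the product of normalised Haar measure on $\mathbb{T}$ and the Haar system of $G$, and $\mathbb{T}$-action $z\cdot(w,\alpha)=(zw,\alpha)$; its unit space is identified with $G^{(0)}$. $C_c(G^\sigma;G)=\{f\in C_c(G^\sigma):f(z\cdot\gamma)=zf(\gamma)\text{ for }z\in\mathbb{T},\gamma\in G^\sigma\}$, a $*$-subalgebra of the (untwisted) convolution algebra $C_c(G^\sigma)$. The map $\rho$ is a $*$-isomorphism of $C_c(G^\sigma;G)$ onto $C_c(G,\overline\sigma)$. $C_c(G^\sigma;G)$ carries the $C_0(G^{(0)})$-valued inner product $\langle f,g\rangle(u)=(f^**g)(1,u)$; let $H(G^\sigma)$ be the Hilbert-module completion. Left multiplication extends to an action by adjointable operators, and $C^*(G^\sigma;G)^{\mathrm{Kum}}$ is the completion of $C_c(G^\sigma;G)$ in the operator norm of $\mathcal{L}(H(G^\sigma))$. *)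

theory Defs
  imports "HOL-Analysis.Analysis"
begin

section \<open>Topological groupoids\<close>

text \<open>The arrows are the points of the topology; all operations are only meaningful on arrows, and
  the product \<open>gmul G \<alpha> \<beta>\<close> only for composable \<open>\<alpha>, \<beta>\<close>.\<close>

record 'g tgroupoid =
  gtop :: "'g topology"
  rng :: "'g \<Rightarrow> 'g"
  src :: "'g \<Rightarrow> 'g"
  gmul :: "'g \<Rightarrow> 'g \<Rightarrow> 'g"
  ginv :: "'g \<Rightarrow> 'g"

definition arrows :: "'g tgroupoid \<Rightarrow> 'g set" where
  "arrows G = topspace (gtop G)"

definition units :: "'g tgroupoid \<Rightarrow> 'g set" where
  "units G = rng G ` arrows G"

definition unit_top :: "'g tgroupoid \<Rightarrow> 'g topology" where
  "unit_top G = subtopology (gtop G) (units G)"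

definition composable :: "'g tgroupoid \<Rightarrow> ('g \<times> 'g) set" where
  "composable G = {(\<alpha>, \<beta>). \<alpha> \<in> arrows G \<and> \<beta> \<in> arrows G \<and> src G \<alpha> = rng G \<beta>}"

definition composable_top :: "'g tgroupoid \<Rightarrow> ('g \<times> 'g) topology" where
  "composable_top G = subtopology (prod_topology (gtop G) (gtop G)) (composable G)"

definition rfibre :: "'g tgroupoid \<Rightarrow> 'g \<Rightarrow> 'g set" where
  "rfibre G u = {\<beta> \<in> arrows G. rng G \<beta> = u}"

definition sfibre :: "'g tgroupoid \<Rightarrow> 'g \<Rightarrow> 'g set" where
  "sfibre G u = {\<beta> \<in> arrows G. src G \<beta> = u}"

locale groupoid =
  fixes G :: "'g tgroupoid"
  assumes rng_closed: "\<alpha> \<in> arrows G \<Longrightarrow> rng G \<alpha> \<in> arrows G"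
    and src_closed: "\<alpha> \<in> arrows G \<Longrightarrow> src G \<alpha> \<in> arrows G"
    and rng_rng: "\<alpha> \<in> arrows G \<Longrightarrow> rng G (rng G \<alpha>) = rng G \<alpha>"
    and src_rng: "\<alpha> \<in> arrows G \<Longrightarrow> src G (rng G \<alpha>) = rng G \<alpha>"
    and rng_src: "\<alpha> \<in> arrows G \<Longrightarrow> rng G (src G \<alpha>) = src G \<alpha>"
    and src_src: "\<alpha> \<in> arrows G \<Longrightarrow> src G (src G \<alpha>) = src G \<alpha>"
    and gmul_closed: "(\<alpha>, \<beta>) \<in> composable G \<Longrightarrow> gmul G \<alpha> \<beta> \<in> arrows G"
    and rng_gmul: "(\<alpha>, \<beta>) \<in> composable G \<Longrightarrow> rng G (gmul G \<alpha> \<beta>) = rng G \<alpha>"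
    and src_gmul: "(\<alpha>, \<beta>) \<in> composable G \<Longrightarrow> src G (gmul G \<alpha> \<beta>) = src G \<beta>"
    and gmul_assoc: "(\<alpha>, \<beta>) \<in> composable G \<Longrightarrow> (\<beta>, \<gamma>) \<in> composable G \<Longrightarrow>
          gmul G (gmul G \<alpha> \<beta>) \<gamma> = gmul G \<alpha> (gmul G \<beta> \<gamma>)"
    and rng_gmul_id: "\<alpha> \<in> arrows G \<Longrightarrow> gmul G (rng G \<alpha>) \<alpha> = \<alpha>"
    and gmul_src_id: "\<alpha> \<in> arrows G \<Longrightarrow> gmul G \<alpha> (src G \<alpha>) = \<alpha>"
    and ginv_closed: "\<alpha> \<in> arrows G \<Longrightarrow> ginv G \<alpha> \<in> arrows G"
    and rng_ginv: "\<alpha> \<in> arrows G \<Longrightarrow> rng G (ginv G \<alpha>) = src G \<alpha>"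
    and src_ginv: "\<alpha> \<in> arrows G \<Longrightarrow> src G (ginv G \<alpha>) = rng G \<alpha>"
    and gmul_ginv: "\<alpha> \<in> arrows G \<Longrightarrow> gmul G \<alpha> (ginv G \<alpha>) = rng G \<alpha>"
    and ginv_gmul: "\<alpha> \<in> arrows G \<Longrightarrow> gmul G (ginv G \<alpha>) \<alpha> = src G \<alpha>"

locale topological_groupoid = groupoid +
  assumes continuous_gmul: "continuous_map (composable_top G) (gtop G) (\<lambda>(\<alpha>, \<beta>). gmul G \<alpha> \<beta>)"
    and continuous_ginv: "continuous_map (gtop G) (gtop G) (ginv G)"

definition local_homeomorphism :: "'a topology \<Rightarrow> 'b topology \<Rightarrow> ('a \<Rightarrow> 'b) \<Rightarrow> bool" where
  "local_homeomorphism X Y f \<longleftrightarrow> f \<in> topspace X \<rightarrow> topspace Y \<and>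
     (\<forall>x\<in>topspace X. \<exists>U. openin X U \<and> x \<in> U \<and> openin Y (f ` U) \<and>
        homeomorphic_map (subtopology X U) (subtopology Y (f ` U)) f)"

locale etale_groupoid = topological_groupoid +
  assumes rng_local_homeomorphism: "local_homeomorphism (gtop G) (unit_top G) (rng G)"

definition principal_groupoid :: "'g tgroupoid \<Rightarrow> bool" where
  "principal_groupoid G \<longleftrightarrow> (\<forall>\<alpha>\<in>arrows G. \<forall>\<beta>\<in>arrows G.
     rng G \<alpha> = rng G \<beta> \<and> src G \<alpha> = src G \<beta> \<longrightarrow> \<alpha> = \<beta>)"

abbreviation circle :: "complex set" where
  "circle \<equiv> sphere 0 1"

definition continuous_normalised_cocycle ::
    "'g tgroupoid \<Rightarrow> ('g \<Rightarrow> 'g \<Rightarrow> complex) \<Rightarrow> bool" where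
  "continuous_normalised_cocycle G \<sigma> \<longleftrightarrow>
     continuous_map (composable_top G) (top_of_set circle) (\<lambda>(\<alpha>, \<beta>). \<sigma> \<alpha> \<beta>) \<and>
     (\<forall>\<alpha> \<beta> \<gamma>. (\<alpha>, \<beta>) \<in> composable G \<and> (\<beta>, \<gamma>) \<in> composable G \<longrightarrow>
        \<sigma> \<alpha> \<beta> * \<sigma> (gmul G \<alpha> \<beta>) \<gamma> = \<sigma> \<beta> \<gamma> * \<sigma> \<alpha> (gmul G \<beta> \<gamma>)) \<and>
     (\<forall>\<gamma>\<in>arrows G. \<sigma> (rng G \<gamma>) \<gamma> = 1 \<and> \<sigma> \<gamma> (src G \<gamma>) = 1)"

abbreviation conj_cocycle :: "('g \<Rightarrow> 'g \<Rightarrow> complex) \<Rightarrow> 'g \<Rightarrow> 'g \<Rightarrow> complex" where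
  "conj_cocycle \<sigma> \<equiv> \<lambda>\<alpha> \<beta>. cnj (\<sigma> \<alpha> \<beta>)"


section \<open>Seminormed spaces, *-algebras, inner-product modules and their completions\<close>

record 'a seminormed =
  carr :: "'a set"
  add :: "'a \<Rightarrow> 'a \<Rightarrow> 'a"
  zero :: 'a
  scal :: "complex \<Rightarrow> 'a \<Rightarrow> 'a"
  nrm :: "'a \<Rightarrow> real"

record 'a star_algebra = "'a seminormed" +
  mul :: "'a \<Rightarrow> 'a \<Rightarrow> 'a"
  star :: "'a \<Rightarrow> 'a"

text \<open>A right inner-product module over \<open>C\<^sub>0(base)\<close>. The inner product is conjugate-linear
  in the first variable; its values are functions on the points of \<open>base\<close>, extended by \<open>0\<close>.\<close>

record ('a, 'x) inner_module = "'a seminormed" +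
  base :: "'x topology"
  inn :: "'a \<Rightarrow> 'a \<Rightarrow> 'x \<Rightarrow> complex"
  ract :: "'a \<Rightarrow> ('x \<Rightarrow> complex) \<Rightarrow> 'a"

text \<open>Suprema of sets of nonnegative reals; the supremum of the empty set is \<open>0\<close>.\<close>

definition sup0 :: "real set \<Rightarrow> real" where
  "sup0 A = Sup (insert 0 A)"

definition operator_norm :: "'a set \<Rightarrow> ('a \<Rightarrow> real) \<Rightarrow> ('a \<Rightarrow> 'a) \<Rightarrow> real" where
  "operator_norm V N T = sup0 {N (T x) | x. x \<in> V \<and> N x \<le> 1}"

definition inn_norm :: "'x topology \<Rightarrow> ('a \<Rightarrow> 'a \<Rightarrow> 'x \<Rightarrow> complex) \<Rightarrow> 'a \<Rightarrow> real" where
  "inn_norm Y ip x = sqrt (sup0 {cmod (ip x x u) | u. u \<in> topspace Y})"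

text \<open>The (Hausdorff) completion consists of the Cauchy sequences modulo null sequences.\<close>

definition sub :: "('a, 'b) seminormed_scheme \<Rightarrow> 'a \<Rightarrow> 'a \<Rightarrow> 'a" where
  "sub V x y = add V x (scal V (- 1) y)"

definition cauchy_seqs :: "('a, 'b) seminormed_scheme \<Rightarrow> (nat \<Rightarrow> 'a) set" where
  "cauchy_seqs V = {x. range x \<subseteq> carr V \<and>
     (\<forall>e>0. \<exists>M. \<forall>m\<ge>M. \<forall>n\<ge>M. nrm V (sub V (x m) (x n)) < e)}"

definition null_rel :: "('a, 'b) seminormed_scheme \<Rightarrow> ((nat \<Rightarrow> 'a) \<times> (nat \<Rightarrow> 'a)) set" where
  "null_rel V = {(x, y). x \<in> cauchy_seqs V \<and> y \<in> cauchy_seqs V \<and>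
     (\<lambda>n. nrm V (sub V (x n) (y n))) \<longlonglongrightarrow> 0}"

definition cls :: "('a, 'b) seminormed_scheme \<Rightarrow> (nat \<Rightarrow> 'a) \<Rightarrow> (nat \<Rightarrow> 'a) set" where
  "cls V x = null_rel V `` {x}"

definition to_completion :: "('a, 'b) seminormed_scheme \<Rightarrow> 'a \<Rightarrow> (nat \<Rightarrow> 'a) set" where
  "to_completion V x = cls V (\<lambda>_. x)"

text \<open>Extensions by continuity of maps on \<open>V\<close> to the completion of \<open>V\<close>.\<close>

definition lift1 :: "('a, 'b) seminormed_scheme \<Rightarrow> ('a \<Rightarrow> 'a) \<Rightarrow>
    (nat \<Rightarrow> 'a) set \<Rightarrow> (nat \<Rightarrow> 'a) set" where
  "lift1 V h X = (\<Union>x\<in>X. cls V (\<lambda>n. h (x n)))"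

definition lift2 :: "('a, 'b) seminormed_scheme \<Rightarrow> ('a \<Rightarrow> 'a \<Rightarrow> 'a) \<Rightarrow>
    (nat \<Rightarrow> 'a) set \<Rightarrow> (nat \<Rightarrow> 'a) set \<Rightarrow> (nat \<Rightarrow> 'a) set" where
  "lift2 V h X Y = (\<Union>x\<in>X. \<Union>y\<in>Y. cls V (\<lambda>n. h (x n) (y n)))"

definition lift_norm :: "('a, 'b) seminormed_scheme \<Rightarrow> (nat \<Rightarrow> 'a) set \<Rightarrow> real" where
  "lift_norm V X = (THE l. \<forall>x\<in>X. (\<lambda>n. nrm V (x n)) \<longlonglongrightarrow> l)"

definition lift_inn :: "('a, 'x, 'b) inner_module_scheme \<Rightarrow>
    (nat \<Rightarrow> 'a) set \<Rightarrow> (nat \<Rightarrow> 'a) set \<Rightarrow> 'x \<Rightarrow> complex" where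
  "lift_inn V X Y u = (THE l. \<forall>x\<in>X. \<forall>y\<in>Y. (\<lambda>n. inn V (x n) (y n) u) \<longlonglongrightarrow> l)"

definition star_completion :: "'a star_algebra \<Rightarrow> (nat \<Rightarrow> 'a) set star_algebra" where
  "star_completion A = \<lparr>
     carr = cauchy_seqs A // null_rel A,
     add = lift2 A (add A),
     zero = to_completion A (zero A),
     scal = (\<lambda>c. lift1 A (scal A c)),
     nrm = lift_norm A,
     mul = lift2 A (mul A),
     star = lift1 A (star A) \<rparr>"

definition module_completion ::
    "('a, 'x) inner_module \<Rightarrow> ((nat \<Rightarrow> 'a) set, 'x) inner_module" where
  "module_completion V = \<lparr>
     carr = cauchy_seqs V // null_rel V,
     add = lift2 V (add V),
     zero = to_completion V (zero V),
     scal = (\<lambda>c. lift1 V (scal V c)),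
     nrm = inn_norm (base V) (lift_inn V),
     base = base V,
     inn = lift_inn V,
     ract = (\<lambda>X a. lift1 V (\<lambda>x. ract V x a) X) \<rparr>"

definition is_adjoint :: "('a, 'x) inner_module \<Rightarrow> ('a \<Rightarrow> 'a) \<Rightarrow> ('a \<Rightarrow> 'a) \<Rightarrow> bool" where
  "is_adjoint H T S \<longleftrightarrow> (\<forall>x\<in>carr H. \<forall>y\<in>carr H. \<forall>u\<in>topspace (base H).
     inn H (T x) y u = inn H x (S y) u)"

text \<open>The C*-algebra \<open>\<L>(H)\<close> of adjointable operators on a Hilbert module.\<close>

definition adjointable_operators :: "('a, 'x) inner_module \<Rightarrow> ('a \<Rightarrow> 'a) star_algebra" where
  "adjointable_operators H = \<lparr>
     carr = {T \<in> carr H \<rightarrow>\<^sub>E carr H. \<exists>S \<in> carr H \<rightarrow>\<^sub>E carr H. is_adjoint H T S},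
     add = (\<lambda>S T. \<lambda>x\<in>carr H. add H (S x) (T x)),
     zero = (\<lambda>x\<in>carr H. zero H),
     scal = (\<lambda>c T. \<lambda>x\<in>carr H. scal H c (T x)),
     nrm = operator_norm (carr H) (nrm H),
     mul = (\<lambda>S T. \<lambda>x\<in>carr H. S (T x)),
     star = (\<lambda>T. THE S. S \<in> carr H \<rightarrow>\<^sub>E carr H \<and> is_adjoint H T S) \<rparr>"

definition star_homomorphism ::
    "'a star_algebra \<Rightarrow> 'b star_algebra \<Rightarrow> ('a \<Rightarrow> 'b) \<Rightarrow> bool" where
  "star_homomorphism A B \<phi> \<longleftrightarrow> \<phi> \<in> carr A \<rightarrow> carr B \<and>
     (\<forall>x\<in>carr A. \<forall>y\<in>carr A. \<phi> (add A x y) = add B (\<phi> x) (\<phi> y)) \<and>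
     (\<forall>c. \<forall>x\<in>carr A. \<phi> (scal A c x) = scal B c (\<phi> x)) \<and>
     (\<forall>x\<in>carr A. \<forall>y\<in>carr A. \<phi> (mul A x y) = mul B (\<phi> x) (\<phi> y)) \<and>
     (\<forall>x\<in>carr A. \<phi> (star A x) = star B (\<phi> x))"

text \<open>Between C*-algebras the isometry condition is automatic.\<close>

definition cstar_isomorphism ::
    "'a star_algebra \<Rightarrow> 'b star_algebra \<Rightarrow> ('a \<Rightarrow> 'b) \<Rightarrow> bool" where
  "cstar_isomorphism A B \<phi> \<longleftrightarrow> star_homomorphism A B \<phi> \<and>
     bij_betw \<phi> (carr A) (carr B) \<and> (\<forall>x\<in>carr A. nrm B (\<phi> x) = nrm A x)"


section \<open>The reduced twisted C*-algebra of an etale groupoid\<close>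

definition Cc :: "'a topology \<Rightarrow> ('a \<Rightarrow> complex) set" where
  "Cc X = {f. continuous_map X euclidean f \<and> {x. f x \<noteq> 0} \<subseteq> topspace X \<and>
     compactin X (X closure_of {x. f x \<noteq> 0})}"

definition twisted_conv :: "'g tgroupoid \<Rightarrow> ('g \<Rightarrow> 'g \<Rightarrow> complex) \<Rightarrow>
    ('g \<Rightarrow> complex) \<Rightarrow> ('g \<Rightarrow> complex) \<Rightarrow> 'g \<Rightarrow> complex" where
  "twisted_conv G \<tau> f g \<alpha> = (if \<alpha> \<in> arrows G
     then \<Sum>\<^sub>\<infinity>\<beta>\<in>rfibre G (rng G \<alpha>). f \<beta> * g (gmul G (ginv G \<beta>) \<alpha>) * \<tau> \<beta> (gmul G (ginv G \<beta>) \<alpha>)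
     else 0)"

definition twisted_star :: "'g tgroupoid \<Rightarrow> ('g \<Rightarrow> 'g \<Rightarrow> complex) \<Rightarrow>
    ('g \<Rightarrow> complex) \<Rightarrow> 'g \<Rightarrow> complex" where
  "twisted_star G \<tau> f \<alpha> = (if \<alpha> \<in> arrows G then cnj (f (ginv G \<alpha>) * \<tau> \<alpha> (ginv G \<alpha>)) else 0)"

text \<open>\<open>\<ell>\<^sup>2(F)\<close>, as functions vanishing off \<open>F\<close>.\<close>

definition l2 :: "'g set \<Rightarrow> ('g \<Rightarrow> complex) set" where
  "l2 F = {\<xi>. (\<forall>\<alpha>. \<alpha> \<notin> F \<longrightarrow> \<xi> \<alpha> = 0) \<and> (\<lambda>\<alpha>. (cmod (\<xi> \<alpha>))\<^sup>2) summable_on F}"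

definition l2_norm :: "'g set \<Rightarrow> ('g \<Rightarrow> complex) \<Rightarrow> real" where
  "l2_norm F \<xi> = sqrt (\<Sum>\<^sub>\<infinity>\<alpha>\<in>F. (cmod (\<xi> \<alpha>))\<^sup>2)"

definition Ind :: "'g tgroupoid \<Rightarrow> ('g \<Rightarrow> 'g \<Rightarrow> complex) \<Rightarrow> 'g \<Rightarrow>
    ('g \<Rightarrow> complex) \<Rightarrow> ('g \<Rightarrow> complex) \<Rightarrow> 'g \<Rightarrow> complex" where
  "Ind G \<tau> u f \<xi> \<alpha> = (if \<alpha> \<in> sfibre G u
     then \<Sum>\<^sub>\<infinity>\<beta>\<in>rfibre G (rng G \<alpha>). f \<beta> * \<xi> (gmul G (ginv G \<beta>) \<alpha>) * \<tau> \<beta> (gmul G (ginv G \<beta>) \<alpha>)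
     else 0)"

definition reduced_norm :: "'g tgroupoid \<Rightarrow> ('g \<Rightarrow> 'g \<Rightarrow> complex) \<Rightarrow> ('g \<Rightarrow> complex) \<Rightarrow> real" where
  "reduced_norm G \<tau> f =
     sup0 {operator_norm (l2 (sfibre G u)) (l2_norm (sfibre G u)) (Ind G \<tau> u f) | u. u \<in> units G}"

definition Cc_twisted ::
    "'g tgroupoid \<Rightarrow> ('g \<Rightarrow> 'g \<Rightarrow> complex) \<Rightarrow> ('g \<Rightarrow> complex) star_algebra" where
  "Cc_twisted G \<tau> = \<lparr>
     carr = Cc (gtop G),
     add = (\<lambda>f g \<alpha>. f \<alpha> + g \<alpha>),
     zero = (\<lambda>\<alpha>. 0),
     scal = (\<lambda>c f \<alpha>. c * f \<alpha>),
     nrm = reduced_norm G \<tau>,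
     mul = twisted_conv G \<tau>,
     star = twisted_star G \<tau> \<rparr>"

definition Cstar_reduced :: "'g tgroupoid \<Rightarrow> ('g \<Rightarrow> 'g \<Rightarrow> complex) \<Rightarrow>
    (nat \<Rightarrow> 'g \<Rightarrow> complex) set star_algebra" where
  "Cstar_reduced G \<tau> = star_completion (Cc_twisted G \<tau>)"


section \<open>The circle extension of a groupoid by a cocycle\<close>

definition extension ::
    "'g tgroupoid \<Rightarrow> ('g \<Rightarrow> 'g \<Rightarrow> complex) \<Rightarrow> (complex \<times> 'g) tgroupoid" where
  "extension G \<sigma> = \<lparr>
     gtop = prod_topology (top_of_set circle) (gtop G),
     rng = (\<lambda>(z, \<alpha>). (1, rng G \<alpha>)),
     src = (\<lambda>(z, \<alpha>). (1, src G \<alpha>)),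
     gmul = (\<lambda>(w, \<alpha>) (z, \<beta>). (w * z * \<sigma> \<alpha> \<beta>, gmul G \<alpha> \<beta>)),
     ginv = (\<lambda>(z, \<alpha>). (inverse z * inverse (\<sigma> \<alpha> (ginv G \<alpha>)), ginv G \<alpha>)) \<rparr>"

definition circle_act :: "complex \<Rightarrow> complex \<times> 'g \<Rightarrow> complex \<times> 'g" where
  "circle_act z = (\<lambda>(w, \<alpha>). (z * w, \<alpha>))"

definition circle_haar :: "complex measure" where
  "circle_haar = distr (uniform_measure lborel {0..1}) (restrict_space borel circle)
     (\<lambda>t. cis (2 * pi * t))"

text \<open>The measure \<open>\<lambda>\<^sup>u\<close> of the Haar system at the unit \<open>(1, u)\<close>, for \<open>G\<close> etale.\<close>

definition extension_haar ::
    "'g tgroupoid \<Rightarrow> complex \<times> 'g \<Rightarrow> (complex \<times> 'g) measure" where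
  "extension_haar G = (\<lambda>(_, u). circle_haar \<Otimes>\<^sub>M count_space (rfibre G u))"

definition conv :: "'h tgroupoid \<Rightarrow> ('h \<Rightarrow> 'h measure) \<Rightarrow>
    ('h \<Rightarrow> complex) \<Rightarrow> ('h \<Rightarrow> complex) \<Rightarrow> 'h \<Rightarrow> complex" where
  "conv E \<mu> f g \<gamma> = (if \<gamma> \<in> arrows E
     then LINT \<eta>|\<mu> (rng E \<gamma>). f \<eta> * g (gmul E (ginv E \<eta>) \<gamma>) else 0)"

definition involution :: "'h tgroupoid \<Rightarrow> ('h \<Rightarrow> complex) \<Rightarrow> 'h \<Rightarrow> complex" where
  "involution E f \<gamma> = (if \<gamma> \<in> arrows E then cnj (f (ginv E \<gamma>)) else 0)"

abbreviation ext_conv :: "'g tgroupoid \<Rightarrow> ('g \<Rightarrow> 'g \<Rightarrow> complex) \<Rightarrow>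
    (complex \<times> 'g \<Rightarrow> complex) \<Rightarrow> (complex \<times> 'g \<Rightarrow> complex) \<Rightarrow> complex \<times> 'g \<Rightarrow> complex" where
  "ext_conv G \<sigma> \<equiv> conv (extension G \<sigma>) (extension_haar G)"

definition Cc_equivariant ::
    "'g tgroupoid \<Rightarrow> ('g \<Rightarrow> 'g \<Rightarrow> complex) \<Rightarrow> (complex \<times> 'g \<Rightarrow> complex) set" where
  "Cc_equivariant G \<sigma> = {f \<in> Cc (gtop (extension G \<sigma>)).
     \<forall>z\<in>circle. \<forall>\<gamma>\<in>arrows (extension G \<sigma>). f (circle_act z \<gamma>) = z * f \<gamma>}"

definition equivariant_inn :: "'g tgroupoid \<Rightarrow> ('g \<Rightarrow> 'g \<Rightarrow> complex) \<Rightarrow>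
    (complex \<times> 'g \<Rightarrow> complex) \<Rightarrow> (complex \<times> 'g \<Rightarrow> complex) \<Rightarrow> 'g \<Rightarrow> complex" where
  "equivariant_inn G \<sigma> f g u = (if u \<in> units G
     then ext_conv G \<sigma> (involution (extension G \<sigma>) f) g (1, u) else 0)"

definition equivariant_module :: "'g tgroupoid \<Rightarrow> ('g \<Rightarrow> 'g \<Rightarrow> complex) \<Rightarrow>
    (complex \<times> 'g \<Rightarrow> complex, 'g) inner_module" where
  "equivariant_module G \<sigma> = \<lparr>
     carr = Cc_equivariant G \<sigma>,
     add = (\<lambda>f g \<gamma>. f \<gamma> + g \<gamma>),
     zero = (\<lambda>\<gamma>. 0),
     scal = (\<lambda>c f \<gamma>. c * f \<gamma>),
     nrm = inn_norm (unit_top G) (equivariant_inn G \<sigma>),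
     base = unit_top G,
     inn = equivariant_inn G \<sigma>,
     ract = (\<lambda>f a (w, \<alpha>). f (w, \<alpha>) * a (src G \<alpha>)) \<rparr>"

definition Hmod :: "'g tgroupoid \<Rightarrow> ('g \<Rightarrow> 'g \<Rightarrow> complex) \<Rightarrow>
    ((nat \<Rightarrow> complex \<times> 'g \<Rightarrow> complex) set, 'g) inner_module" where
  "Hmod G \<sigma> = module_completion (equivariant_module G \<sigma>)"

definition left_mult :: "'g tgroupoid \<Rightarrow> ('g \<Rightarrow> 'g \<Rightarrow> complex) \<Rightarrow> (complex \<times> 'g \<Rightarrow> complex) \<Rightarrow>
    (nat \<Rightarrow> complex \<times> 'g \<Rightarrow> complex) set \<Rightarrow> (nat \<Rightarrow> complex \<times> 'g \<Rightarrow> complex) set" where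
  "left_mult G \<sigma> f = (\<lambda>X\<in>carr (Hmod G \<sigma>). lift1 (equivariant_module G \<sigma>) (ext_conv G \<sigma> f) X)"

definition Cc_equivariant_algebra :: "'g tgroupoid \<Rightarrow> ('g \<Rightarrow> 'g \<Rightarrow> complex) \<Rightarrow>
    (complex \<times> 'g \<Rightarrow> complex) star_algebra" where
  "Cc_equivariant_algebra G \<sigma> = \<lparr>
     carr = Cc_equivariant G \<sigma>,
     add = (\<lambda>f g \<gamma>. f \<gamma> + g \<gamma>),
     zero = (\<lambda>\<gamma>. 0),
     scal = (\<lambda>c f \<gamma>. c * f \<gamma>),
     nrm = (\<lambda>f. nrm (adjointable_operators (Hmod G \<sigma>)) (left_mult G \<sigma> f)),
     mul = ext_conv G \<sigma>,
     star = involution (extension G \<sigma>) \<rparr>"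

definition Cstar_Kumjian :: "'g tgroupoid \<Rightarrow> ('g \<Rightarrow> 'g \<Rightarrow> complex) \<Rightarrow>
    (nat \<Rightarrow> complex \<times> 'g \<Rightarrow> complex) set star_algebra" where
  "Cstar_Kumjian G \<sigma> = star_completion (Cc_equivariant_algebra G \<sigma>)"

definition rho :: "(complex \<times> 'g \<Rightarrow> complex) \<Rightarrow> 'g \<Rightarrow> complex" where
  "rho f \<alpha> = f (1, \<alpha>)"

end

theory Submission
  imports Defs
begin

text \<open>
  The point is that both completions are taken in the same norm. Write \<open>f\<^sub>0 = rho f\<close> and let \<open>\<tau>\<close> be the
  conjugate of \<open>\<sigma>\<close>. An equivariant function is determined by \<open>f\<^sub>0\<close>, since \<open>f (z, \<alpha>) = z f\<^sub>0(\<alpha>)\<close>, and every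
  \<open>f\<^sub>0\<close> in \<open>C\<^sub>c(G)\<close> arises. In the convolution integral on the extension the circle coordinate drops
  out and the cocycle identity leaves exactly the twist by \<open>\<tau>\<close> (\<open>ext_conv_eq\<close>, \<open>involution_eq\<close>), so
  \<open>rho\<close> is a *-isomorphism of the dense subalgebras.

  The module inner product at a unit \<open>u\<close> is the inner product of the restrictions of \<open>f\<^sub>0\<close> and \<open>g\<^sub>0\<close> to
  the source fibre of \<open>u\<close> in \<open>\<ell>\<^sup>2(s\<^sup>-\<^sup>1(u))\<close> (\<open>equivariant_inn_eq\<close>). Thus the Hilbert module is a completion of
  \<open>C\<^sub>c(G)\<close> in the supremum over \<open>u\<close> of these \<open>\<ell>\<^sup>2\<close>-norms, and left multiplication by \<open>f\<close> acts on each
  fibre as \<open>Ind\<^sub>u(f\<^sub>0)\<close>. A fibrewise estimate, passed to limits of Cauchy sequences, bounds the norm of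
  left multiplication by the supremum of the norms of \<open>Ind\<^sub>u(f\<^sub>0)\<close>, the reduced norm. For the reverse
  inequality, finitely supported vectors compute the norm of \<open>Ind\<^sub>u(f\<^sub>0)\<close> (\<open>reduced_norm_leI\<close>), and each
  such vector extends to a function in \<open>C\<^sub>c(G)\<close> of no larger module norm, by bump functions on
  disjoint bisections (\<open>extend_finite_support\<close>). Together these give \<open>nrm_left_mult\<close>: \<open>rho\<close> is isometric.
  An isometric *-isomorphism of the dense subalgebras then induces one of the completions
  (\<open>cstar_isomorphism_map_completion\<close>).

  Two facts about \<open>C\<^sub>c(G)\<close> are needed on the way: it is closed under the twisted convolution
  (\<open>twisted_conv_Cc\<close>), and its elements act boundedly in the regular representations, by the Schur test
  (\<open>Ind_finite_bound\<close>). Both rest on writing a function as a finite sum of functions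
  supported in open bisections (\<open>Cc_induct\<close>).
\<close>


section \<open>Isometric isomorphisms pass to completions\<close>

text \<open>The carrier, the norm and the operations of a completion are determined by those of the given
  algebra, so a bijection \<open>h\<close> that preserves the latter induces one that preserves the former.\<close>

locale isometric_star_isomorphism =
  fixes A :: "'a star_algebra" and B :: "'b star_algebra" and h :: "'a \<Rightarrow> 'b"
  assumes hom: "star_homomorphism A B h"
    and bij: "bij_betw h (carr A) (carr B)"
    and isometric: "x \<in> carr A \<Longrightarrow> nrm B (h x) = nrm A x"
    and add_closed: "x \<in> carr A \<Longrightarrow> y \<in> carr A \<Longrightarrow> add A x y \<in> carr A"
    and scal_closed: "x \<in> carr A \<Longrightarrow> scal A c x \<in> carr A"
    and mul_closed: "x \<in> carr A \<Longrightarrow> y \<in> carr A \<Longrightarrow> mul A x y \<in> carr A"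
    and star_closed: "x \<in> carr A \<Longrightarrow> star A x \<in> carr A"
begin

definition map_completion :: "(nat \<Rightarrow> 'a) set \<Rightarrow> (nat \<Rightarrow> 'b) set" where
  "map_completion X = (\<lambda>x n. h (x n)) ` X"

lemma h_carr: "x \<in> carr A \<Longrightarrow> h x \<in> carr B"
  using bij by (auto simp: bij_betw_def)

lemma h_ops:
  assumes "x \<in> carr A" "y \<in> carr A"
  shows "h (add A x y) = add B (h x) (h y)" "h (scal A c x) = scal B c (h x)"
    "h (mul A x y) = mul B (h x) (h y)" "h (star A x) = star B (h x)"
  using hom assms by (auto simp: star_homomorphism_def)

lemma nrm_sub:
  assumes "x \<in> carr A" "y \<in> carr A"
  shows "nrm B (sub B (h x) (h y)) = nrm A (sub A x y)"
proof -
  have "sub A x y \<in> carr A" "h (sub A x y) = sub B (h x) (h y)"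
    using assms by (simp_all add: sub_def h_ops scal_closed add_closed)
  then show ?thesis using isometric by metis
qed

lemma map_cauchy_seqs:
  assumes "range x \<subseteq> carr A"
  shows "(\<lambda>n. h (x n)) \<in> cauchy_seqs B \<longleftrightarrow> x \<in> cauchy_seqs A"
proof -
  have "x n \<in> carr A" for n using assms by auto
  then show ?thesis by (auto simp: cauchy_seqs_def nrm_sub h_carr)
qed

lemma cauchy_seqs_range: "x \<in> cauchy_seqs A \<Longrightarrow> range x \<subseteq> carr A"
  by (simp add: cauchy_seqs_def)

lemma cauchy_seqs_carr: "x \<in> cauchy_seqs A \<Longrightarrow> x n \<in> carr A"
  by (auto simp: cauchy_seqs_def)

lemma cauchy_seqs_lift:
  assumes "y \<in> cauchy_seqs B"
  obtains x where "x \<in> cauchy_seqs A" "y = (\<lambda>n. h (x n))"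
proof
  let ?x = "\<lambda>n. inv_into (carr A) h (y n)"
  have y: "y n \<in> h ` carr A" for n
    using assms bij by (auto simp: cauchy_seqs_def bij_betw_def)
  show eq: "y = (\<lambda>n. h (?x n))" using y by (simp add: f_inv_into_f)
  have "range ?x \<subseteq> carr A" using y by (auto intro: inv_into_into)
  then show "?x \<in> cauchy_seqs A" using map_cauchy_seqs eq assms by metis
qed

lemma map_completion_cls:
  assumes x: "range x \<subseteq> carr A"
  shows "map_completion (cls A x) = cls B (\<lambda>n. h (x n))"
proof
  have xn: "x n \<in> carr A" for n using x by auto
  show "map_completion (cls A x) \<subseteq> cls B (\<lambda>n. h (x n))"
    using x by (auto simp: map_completion_def cls_def null_rel_def map_cauchy_seqs
        cauchy_seqs_range nrm_sub xn cauchy_seqs_carr)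
  show "cls B (\<lambda>n. h (x n)) \<subseteq> map_completion (cls A x)"
  proof
    fix y assume y: "y \<in> cls B (\<lambda>n. h (x n))"
    then have "y \<in> cauchy_seqs B" by (auto simp: cls_def null_rel_def)
    then obtain y' where y': "y' \<in> cauchy_seqs A" "y = (\<lambda>n. h (y' n))"
      by (rule cauchy_seqs_lift)
    have "y' \<in> cls A x"
      using y y' x by (auto simp: cls_def null_rel_def map_cauchy_seqs nrm_sub xn cauchy_seqs_carr)
    then show "y \<in> map_completion (cls A x)" using y' by (auto simp: map_completion_def)
  qed
qed

lemma completion_elem:
  assumes "X \<in> carr (star_completion A)"
  shows "X \<subseteq> cauchy_seqs A"
  using assms by (auto simp: star_completion_def quotient_def null_rel_def)

lemma map_completion_UN: "map_completion (\<Union>i\<in>I. F i) = (\<Union>i\<in>I. map_completion (F i))"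
  by (auto simp: map_completion_def)

lemma map_completion_lift1:
  assumes X: "X \<subseteq> cauchy_seqs A"
    and f: "\<And>x. x \<in> carr A \<Longrightarrow> f x \<in> carr A" "\<And>x. x \<in> carr A \<Longrightarrow> h (f x) = g (h x)"
  shows "map_completion (lift1 A f X) = lift1 B g (map_completion X)"
proof -
  have "map_completion (cls A (\<lambda>n. f (x n))) = cls B (\<lambda>n. g (h (x n)))" if "x \<in> X" for x
  proof -
    have "x n \<in> carr A" for n using that X cauchy_seqs_carr by blast
    then show ?thesis using map_completion_cls[of "\<lambda>n. f (x n)"] f by (simp add: image_subset_iff)
  qed
  then show ?thesis
    by (simp add: lift1_def map_completion_UN) (simp add: map_completion_def)
qed

lemma map_completion_lift2:
  assumes X: "X \<subseteq> cauchy_seqs A" and Y: "Y \<subseteq> cauchy_seqs A"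
    and f: "\<And>x y. x \<in> carr A \<Longrightarrow> y \<in> carr A \<Longrightarrow> f x y \<in> carr A"
      "\<And>x y. x \<in> carr A \<Longrightarrow> y \<in> carr A \<Longrightarrow> h (f x y) = g (h x) (h y)"
  shows "map_completion (lift2 A f X Y) = lift2 B g (map_completion X) (map_completion Y)"
proof -
  have "map_completion (cls A (\<lambda>n. f (x n) (y n))) = cls B (\<lambda>n. g (h (x n)) (h (y n)))"
    if "x \<in> X" "y \<in> Y" for x y
  proof -
    have "x n \<in> carr A" "y n \<in> carr A" for n using that X Y cauchy_seqs_carr by blast+
    then show ?thesis using map_completion_cls[of "\<lambda>n. f (x n) (y n)"] f
      by (simp add: image_subset_iff)
  qed
  then show ?thesis
    by (simp add: lift2_def map_completion_UN) (simp add: map_completion_def)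
qed

text \<open>An element of a completion is a set of Cauchy sequences, so applying \<open>h\<close> termwise to all
  representatives carries one completion onto the other; it is injective since \<open>h\<close> is.\<close>

proposition cstar_isomorphism_map_completion:
  "cstar_isomorphism (star_completion A) (star_completion B) map_completion"
  unfolding cstar_isomorphism_def star_homomorphism_def
proof (intro conjI ballI allI)
  show bij': "bij_betw map_completion (carr (star_completion A)) (carr (star_completion B))"
    unfolding bij_betw_def
  proof
    have "X = Y"
      if X: "X \<subseteq> cauchy_seqs A" and Y: "Y \<subseteq> cauchy_seqs A" and XY: "map_completion X = map_completion Y" for X Y
    proof -
      have "inj_on (\<lambda>x n. h (x n)) (cauchy_seqs A)"
      proof (rule inj_onI)
        fix x y assume "x \<in> cauchy_seqs A" "y \<in> cauchy_seqs A" "(\<lambda>n. h (x n)) = (\<lambda>n. h (y n))"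
        then have "x n = y n" for n
          using bij cauchy_seqs_carr by (metis bij_betw_def inj_onD)
        then show "x = y" by auto
      qed
      then show ?thesis using X Y XY unfolding map_completion_def by (meson inj_on_image_eq_iff)
    qed
    then show "inj_on map_completion (carr (star_completion A))"
      by (meson completion_elem inj_onI)
    have "map_completion ` carr (star_completion A)
        = (\<lambda>x. map_completion (cls A x)) ` cauchy_seqs A"
      by (auto simp: star_completion_def quotient_def cls_def)
    also have "\<dots> = (\<lambda>x. cls B (\<lambda>n. h (x n))) ` cauchy_seqs A"
      using map_completion_cls cauchy_seqs_range by (intro image_cong) auto
    also have "\<dots> = cls B ` cauchy_seqs B"
    proof -
      have "(\<lambda>x n. h (x n)) ` cauchy_seqs A = cauchy_seqs B"
        using map_cauchy_seqs cauchy_seqs_range by (auto elim: cauchy_seqs_lift)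
      then show ?thesis by (simp add: image_image flip: \<open>_ = cauchy_seqs B\<close>)
    qed
    finally show "map_completion ` carr (star_completion A) = carr (star_completion B)"
      by (auto simp: star_completion_def quotient_def cls_def)
  qed
  then show "map_completion \<in> carr (star_completion A) \<rightarrow> carr (star_completion B)"
    by (auto simp: bij_betw_def)
  fix X assume X: "X \<in> carr (star_completion A)"
  note X' = completion_elem[OF X]
  show "map_completion (scal (star_completion A) c X) = scal (star_completion B) c (map_completion X)" for c
    using map_completion_lift1[OF X', of "scal A c" "scal B c"]
    by (simp add: star_completion_def scal_closed h_ops)
  show "map_completion (star (star_completion A) X) = star (star_completion B) (map_completion X)"
    using map_completion_lift1[OF X', of "star A" "star B"]
    by (simp add: star_completion_def star_closed h_ops)
  have "nrm A (x n) = nrm B (h (x n))" if "x \<in> X" for x n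
    using isometric cauchy_seqs_carr X' that by (metis subsetD)
  then show "nrm (star_completion B) (map_completion X) = nrm (star_completion A) X"
    by (simp add: star_completion_def lift_norm_def map_completion_def cong: ball_cong)
  fix Y assume Y: "Y \<in> carr (star_completion A)"
  note Y' = completion_elem[OF Y]
  show "map_completion (add (star_completion A) X Y)
      = add (star_completion B) (map_completion X) (map_completion Y)"
    using map_completion_lift2[OF X' Y', of "add A" "add B"]
    by (simp add: star_completion_def add_closed h_ops)
  show "map_completion (mul (star_completion A) X Y)
      = mul (star_completion B) (map_completion X) (map_completion Y)"
    using map_completion_lift2[OF X' Y', of "mul A" "mul B"]
    by (simp add: star_completion_def mul_closed h_ops)
qed

lemma map_completion_to_completion:
  "x \<in> carr A \<Longrightarrow> map_completion (to_completion A x) = to_completion B (h x)"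
  unfolding to_completion_def by (rule map_completion_cls) auto

end


section \<open>Compactly supported functions on locally compact Hausdorff spaces\<close>

lemma Cc_continuous: "f \<in> Cc X \<Longrightarrow> continuous_map X euclidean f"
  by (simp add: Cc_def)

lemma Cc_outside: "f \<in> Cc X \<Longrightarrow> x \<notin> topspace X \<Longrightarrow> f x = 0"
  by (auto simp: Cc_def)

lemma Cc_support:
  assumes "f \<in> Cc X"
  obtains K where "compactin X K" "{x. f x \<noteq> 0} \<subseteq> K"
  using assms closure_of_subset[of "{x. f x \<noteq> 0}" X] by (auto simp: Cc_def)

text \<open>In a Hausdorff space any compact set containing the nonzero points can stand in for the
  closed support.\<close>

lemma CcI:
  assumes "Hausdorff_space X" "continuous_map X euclidean f" "compactin X K" "{x. f x \<noteq> 0} \<subseteq> K"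
  shows "f \<in> Cc X"
proof -
  have "X closure_of {x. f x \<noteq> 0} \<subseteq> K"
    using assms by (simp add: closure_of_minimal compactin_imp_closedin)
  then have "compactin X (X closure_of {x. f x \<noteq> 0})"
    using assms(3) closed_compactin closedin_closure_of by metis
  then show ?thesis using assms compactin_subset_topspace by (fastforce simp: Cc_def)
qed

lemma continuous_map_cmult:
  fixes f g :: "'a \<Rightarrow> complex"
  assumes "continuous_map X euclidean f" "continuous_map X euclidean g"
  shows "continuous_map X euclidean (\<lambda>x. f x * g x)"
  using assms by (auto simp: continuous_map_atin intro: tendsto_mult)

lemma continuous_map_cnj:
  assumes "continuous_map X euclidean f"
  shows "continuous_map X euclidean (\<lambda>x. cnj (f x))"
  using assms by (auto simp: continuous_map_atin intro: tendsto_cnj)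

lemma continuous_map_complex_of_real:
  assumes "continuous_map X euclidean f"
  shows "continuous_map X euclidean (\<lambda>x. complex_of_real (f x))"
  using assms by (auto simp: continuous_map_atin intro: tendsto_of_real)

lemma Cc_zero: "(\<lambda>x. 0) \<in> Cc X"
  by (auto simp: Cc_def)

lemma Cc_add:
  assumes "Hausdorff_space X" "f \<in> Cc X" "g \<in> Cc X"
  shows "(\<lambda>x. f x + g x) \<in> Cc X"
proof -
  obtain K L where "compactin X K" "{x. f x \<noteq> 0} \<subseteq> K" "compactin X L" "{x. g x \<noteq> 0} \<subseteq> L"
    using assms Cc_support by metis
  moreover from this have "{x. f x + g x \<noteq> 0} \<subseteq> K \<union> L"
    using add.right_neutral by fastforce
  ultimately show ?thesis
    using assms by (intro CcI[where K="K \<union> L"] compactin_Un continuous_map_add) (auto simp: Cc_def)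
qed

lemma Cc_mult:
  assumes "Hausdorff_space X" "f \<in> Cc X" "continuous_map X euclidean g"
  shows "(\<lambda>x. g x * f x) \<in> Cc X"
proof -
  obtain K where "compactin X K" "{x. f x \<noteq> 0} \<subseteq> K" using assms Cc_support by metis
  then show ?thesis
    using assms by (intro CcI[of _ _ K] continuous_map_cmult) (auto simp: Cc_def)
qed

lemma Cc_scale: "Hausdorff_space X \<Longrightarrow> f \<in> Cc X \<Longrightarrow> (\<lambda>x. c * f x) \<in> Cc X"
  by (rule Cc_mult) auto

lemma Cc_sum:
  assumes "Hausdorff_space X" "\<And>i. i \<in> I \<Longrightarrow> f i \<in> Cc X"
  shows "(\<lambda>x. \<Sum>i\<in>I. f i x) \<in> Cc X"
  using assms(2)
proof (induction I rule: infinite_finite_induct)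
  case (insert i I)
  then show ?case using Cc_add[OF assms(1), of "f i" "\<lambda>x. \<Sum>i\<in>I. f i x"] by simp
qed (auto simp: Cc_zero)

lemma Cc_bounded:
  assumes "f \<in> Cc X"
  obtains C where "\<And>x. cmod (f x) \<le> C"
proof -
  obtain K where K: "compactin X K" "{x. f x \<noteq> 0} \<subseteq> K" using assms Cc_support by metis
  have "compact (f ` K)"
    using image_compactin[OF K(1) Cc_continuous[OF assms]] by simp
  then obtain C where C: "\<forall>y\<in>f ` K. norm y \<le> C" by (meson compact_imp_bounded bounded_iff)
  have "cmod (f x) \<le> max C 0" for x
    using C K(2) by (cases "f x = 0") (auto simp: le_max_iff_disj)
  then show ?thesis by (rule that)
qed

lemma disjoint_neighbourhoods:
  assumes "finite D" "D \<subseteq> topspace X" "Hausdorff_space X"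
  obtains U where "\<And>\<alpha>. \<alpha> \<in> D \<Longrightarrow> openin X (U \<alpha>) \<and> \<alpha> \<in> U \<alpha>"
    "\<And>\<alpha> \<beta>. \<alpha> \<in> D \<Longrightarrow> \<beta> \<in> D \<Longrightarrow> \<alpha> \<noteq> \<beta> \<Longrightarrow> U \<alpha> \<inter> U \<beta> = {}"
proof -
  have "\<forall>p\<in>D \<times> D. \<exists>V W. fst p \<noteq> snd p \<longrightarrow> openin X V \<and> openin X W \<and> fst p \<in> V \<and> snd p \<in> W \<and> V \<inter> W = {}"
    using assms(2,3) unfolding Hausdorff_space_def disjnt_def by (auto simp: subset_iff)
  from bchoice[OF this] obtain V where "\<forall>p\<in>D \<times> D. \<exists>W. fst p \<noteq> snd p \<longrightarrow>
      openin X (V p) \<and> openin X W \<and> fst p \<in> V p \<and> snd p \<in> W \<and> V p \<inter> W = {}" ..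
  from bchoice[OF this] obtain W where VW: "\<forall>p\<in>D \<times> D. fst p \<noteq> snd p \<longrightarrow>
      openin X (V p) \<and> openin X (W p) \<and> fst p \<in> V p \<and> snd p \<in> W p \<and> V p \<inter> W p = {}" ..
  define U where "U \<alpha> = (\<Inter>\<beta>\<in>D - {\<alpha>}. V (\<alpha>, \<beta>) \<inter> W (\<beta>, \<alpha>)) \<inter> topspace X" for \<alpha>
  show ?thesis
  proof (rule that[of U])
    fix \<alpha> assume a: "\<alpha> \<in> D"
    show "openin X (U \<alpha>) \<and> \<alpha> \<in> U \<alpha>"
    proof
      show "openin X (U \<alpha>)"
        unfolding U_def using VW a assms(1) by (intro openin_INT openin_Int) force+
      show "\<alpha> \<in> U \<alpha>" unfolding U_def using VW a assms(2) by force
    qed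
    fix \<beta> assume b: "\<beta> \<in> D" "\<alpha> \<noteq> \<beta>"
    then have "U \<alpha> \<subseteq> V (\<alpha>, \<beta>)" "U \<beta> \<subseteq> W (\<alpha>, \<beta>)" using a by (auto simp: U_def)
    moreover have "V (\<alpha>, \<beta>) \<inter> W (\<alpha>, \<beta>) = {}" using VW a b by force
    ultimately show "U \<alpha> \<inter> U \<beta> = {}" by blast
  qed
qed

text \<open>A locally compact Hausdorff space is completely regular; shrinking the given neighbourhood to
  one inside a compact set makes the separating function compactly supported.\<close>

lemma bump_function:
  assumes lc: "locally_compact_space X" and hd: "Hausdorff_space X" and U: "openin X U" "x \<in> U"
  shows "\<exists>(b :: 'a \<Rightarrow> real) K. continuous_map X euclideanreal b \<and>
    (\<forall>y\<in>topspace X. 0 \<le> b y \<and> b y \<le> 1) \<and> b x = 1 \<and> compactin X K \<and> K \<subseteq> U \<and>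
    (\<forall>y\<in>topspace X. y \<notin> K \<longrightarrow> b y = 0)"
proof -
  have "neighbourhood_base_of (compactin X) X"
    using lc hd by (simp add: locally_compact_space_neighbourhood_base)
  then obtain V K where VK: "openin X V" "compactin X K" "x \<in> V" "V \<subseteq> K" "K \<subseteq> U"
    using U unfolding neighbourhood_base_of by meson
  have "completely_regular_space X"
    using lc hd by (simp add: locally_compact_regular_imp_completely_regular_space)
  moreover have "closedin X (topspace X - V)" "x \<in> topspace X - (topspace X - V)"
    using VK openin_subset[OF VK(1)] by auto
  ultimately obtain f :: "'a \<Rightarrow> real" where f: "continuous_map X (top_of_set {0..1}) f" "f x = 0"
      "f ` (topspace X - V) \<subseteq> {1}"
    unfolding completely_regular_space_def by blast
  have fc: "continuous_map X euclideanreal f" and f01: "\<And>y. y \<in> topspace X \<Longrightarrow> f y \<in> {0..1}"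
    using f(1) by (auto simp: continuous_map_in_subtopology)
  have "continuous_map X euclideanreal (\<lambda>y. 1 - f y)"
    using fc by (intro continuous_intros) auto
  moreover have "1 - f y = 0" if "y \<in> topspace X" "y \<notin> K" for y
    using that f(3) VK(4) by auto
  ultimately show ?thesis
    using f01 f(2) VK by (intro exI[of _ "\<lambda>y. 1 - f y"] exI[of _ K]) auto
qed

lemma Cc_bump:
  assumes lc: "locally_compact_space X" and hd: "Hausdorff_space X" and U: "openin X U" "x \<in> U"
  obtains b where "b \<in> Cc X" "b x = 1" "\<And>y. cmod (b y) \<le> 1" "{y. b y \<noteq> 0} \<subseteq> U"
proof -
  obtain b :: "'a \<Rightarrow> real" and K where b: "continuous_map X euclideanreal b"
    "\<forall>y\<in>topspace X. 0 \<le> b y \<and> b y \<le> 1" "b x = 1" "compactin X K" "K \<subseteq> U"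
    "\<forall>y\<in>topspace X. y \<notin> K \<longrightarrow> b y = 0"
    using bump_function[OF assms] by blast
  let ?b = "\<lambda>y. if y \<in> topspace X then complex_of_real (b y) else 0"
  have sup: "{y. ?b y \<noteq> 0} \<subseteq> K" using b(6) by auto
  show ?thesis
  proof (rule that[of ?b])
    have "continuous_map X euclidean ?b"
      by (rule continuous_map_eq[OF continuous_map_complex_of_real[OF b(1)]]) simp
    then show "?b \<in> Cc X" using CcI hd b(4) sup by blast
    show "?b x = 1" using U b(3) openin_subset by auto
    show "cmod (?b y) \<le> 1" for y using b(2) by auto
    show "{y. ?b y \<noteq> 0} \<subseteq> U" using sup b(5) by blast
  qed
qed

text \<open>A partition of unity on the support reduces statements about \<open>Cc\<close> to functions
  supported inside a single member of an open cover.\<close>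

lemma Cc_induct_cover [consumes 3, case_names cover zero add supported]:
  assumes lc: "locally_compact_space X" and hd: "Hausdorff_space X" and f: "f \<in> Cc X"
    and cover: "\<And>x. x \<in> topspace X \<Longrightarrow> \<exists>U. openin X U \<and> x \<in> U \<and> Q U"
    and zero: "P (\<lambda>x. 0)"
    and add: "\<And>f g. f \<in> Cc X \<Longrightarrow> g \<in> Cc X \<Longrightarrow> P f \<Longrightarrow> P g \<Longrightarrow> P (\<lambda>x. f x + g x)"
    and loc: "\<And>f U K. f \<in> Cc X \<Longrightarrow> openin X U \<Longrightarrow> Q U \<Longrightarrow> compactin X K \<Longrightarrow> K \<subseteq> U \<Longrightarrow>
        {x. f x \<noteq> 0} \<subseteq> K \<Longrightarrow> P f"
  shows "P f"
proof -
  obtain S where S: "compactin X S" "{x. f x \<noteq> 0} \<subseteq> S" using f by (rule Cc_support)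
  have ST: "S \<subseteq> topspace X" using S(1) by (rule compactin_subset_topspace)
  have "\<exists>b K U. continuous_map X euclideanreal b \<and> (\<forall>y\<in>topspace X. 0 \<le> b y) \<and> b x = 1 \<and>
      compactin X K \<and> K \<subseteq> U \<and> openin X U \<and> Q U \<and> (\<forall>y\<in>topspace X. y \<notin> K \<longrightarrow> b y = 0)"
    if "x \<in> S" for x
  proof -
    have "x \<in> topspace X" using that ST by auto
    from cover[OF this] obtain U where U: "openin X U" "x \<in> U" "Q U" by auto
    then show ?thesis using bump_function[OF lc hd U(1,2)] by blast
  qed
  then have "\<forall>x\<in>S. \<exists>b K U. continuous_map X euclideanreal b \<and> (\<forall>y\<in>topspace X. 0 \<le> b y) \<and> b x = 1 \<and>
      compactin X K \<and> K \<subseteq> U \<and> openin X U \<and> Q U \<and> (\<forall>y\<in>topspace X. y \<notin> K \<longrightarrow> b y = 0)"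
    by blast
  from bchoice[OF this] obtain b where "\<forall>x\<in>S. \<exists>K U. continuous_map X euclideanreal (b x) \<and>
      (\<forall>y\<in>topspace X. 0 \<le> b x y) \<and> b x x = 1 \<and> compactin X K \<and> K \<subseteq> U \<and> openin X U \<and> Q U \<and>
      (\<forall>y\<in>topspace X. y \<notin> K \<longrightarrow> b x y = 0)" ..
  from bchoice[OF this] obtain K where "\<forall>x\<in>S. \<exists>U. continuous_map X euclideanreal (b x) \<and>
      (\<forall>y\<in>topspace X. 0 \<le> b x y) \<and> b x x = 1 \<and> compactin X (K x) \<and> K x \<subseteq> U \<and> openin X U \<and> Q U \<and>
      (\<forall>y\<in>topspace X. y \<notin> K x \<longrightarrow> b x y = 0)" ..
  from bchoice[OF this] obtain U where bKU: "\<forall>x\<in>S. continuous_map X euclideanreal (b x) \<and>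
      (\<forall>y\<in>topspace X. 0 \<le> b x y) \<and> b x x = 1 \<and> compactin X (K x) \<and> K x \<subseteq> U x \<and> openin X (U x) \<and>
      Q (U x) \<and> (\<forall>y\<in>topspace X. y \<notin> K x \<longrightarrow> b x y = 0)" ..
  have b: "\<And>x. x \<in> S \<Longrightarrow> continuous_map X euclideanreal (b x)"
      "\<And>x y. x \<in> S \<Longrightarrow> y \<in> topspace X \<Longrightarrow> 0 \<le> b x y" "\<And>x. x \<in> S \<Longrightarrow> b x x = 1"
      "\<And>x. x \<in> S \<Longrightarrow> compactin X (K x)" "\<And>x. x \<in> S \<Longrightarrow> K x \<subseteq> U x"
      "\<And>x. x \<in> S \<Longrightarrow> openin X (U x)" "\<And>x. x \<in> S \<Longrightarrow> Q (U x)"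
      "\<And>x y. x \<in> S \<Longrightarrow> y \<in> topspace X \<Longrightarrow> y \<notin> K x \<Longrightarrow> b x y = 0"
    using bKU by blast+
  define W where "W x = {y \<in> topspace X. b x y \<in> {1/2<..}}" for x
  have "openin X (W x)" if "x \<in> S" for x
    unfolding W_def by (rule openin_continuous_map_preimage[OF b(1)[OF that]]) auto
  moreover have "S \<subseteq> \<Union>(W ` S)" using b(3) ST by (fastforce simp: W_def)
  ultimately obtain \<F> where \<F>: "finite \<F>" "\<F> \<subseteq> W ` S" "S \<subseteq> \<Union>\<F>"
    using S(1) unfolding compactin_def by (metis (no_types, lifting) imageE)
  then obtain I where I: "finite I" "I \<subseteq> S" "\<F> = W ` I" by (meson finite_subset_image)
  \<comment> \<open>The cut-off at \<open>1/2\<close> keeps the denominator positive everywhere; on the support the sum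
    itself exceeds \<open>1/2\<close>.\<close>
  define H where "H y = max (\<Sum>i\<in>I. b i y) (1/2)" for y
  have Hpos: "0 < H y" for y unfolding H_def by auto
  have Hc: "continuous_map X euclideanreal H"
    unfolding H_def using b(1) I(1,2)
    by (intro continuous_map_real_max continuous_map_sum) auto
  define g where "g i y = complex_of_real (b i y / H y) * f y" for i y
  have gCc: "g i \<in> Cc X" if "i \<in> I" for i
  proof -
    have "continuous_map X euclideanreal (\<lambda>y. b i y / H y)"
      using b(1) Hc that I(2) Hpos by (intro continuous_map_real_divide) (auto simp: less_imp_neq[symmetric])
    then show ?thesis unfolding g_def
      by (intro Cc_mult[OF hd f] continuous_map_complex_of_real)
  qed
  have fg: "f y = (\<Sum>i\<in>I. g i y)" for y
  proof (cases "f y = 0")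
    case True then show ?thesis by (simp add: g_def)
  next
    case False
    then have y: "y \<in> S" using S(2) by auto
    then obtain j where j: "j \<in> I" "y \<in> W j" using \<F>(3) I(3) by auto
    have "b j y \<le> (\<Sum>i\<in>I. b i y)"
      using b(2) y ST I j by (intro member_le_sum) auto
    moreover have "1/2 < b j y" using j by (auto simp: W_def)
    ultimately have H: "H y = (\<Sum>i\<in>I. b i y)" by (auto simp: H_def)
    have "(\<Sum>i\<in>I. g i y) = complex_of_real ((\<Sum>i\<in>I. b i y) / H y) * f y"
      by (simp add: g_def sum_distrib_right sum_divide_distrib)
    then show ?thesis using Hpos[of y] H by simp
  qed
  have "P (\<lambda>y. \<Sum>i\<in>J. g i y)" if "finite J" "J \<subseteq> I" for J
    using that
  proof induction
    case empty then show ?case using zero by simp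
  next
    case (insert i J)
    have i: "i \<in> I" "i \<in> S" using insert I by auto
    have "{y. g i y \<noteq> 0} \<subseteq> K i"
      using b(8)[OF i(2)] Cc_outside[OF f] by (auto simp: g_def)
    then have "P (g i)" using loc[of "g i" "U i" "K i"] gCc i b by blast
    moreover have "(\<lambda>y. \<Sum>i\<in>J. g i y) \<in> Cc X" using gCc insert by (intro Cc_sum[OF hd]) auto
    ultimately show ?case
      using add[of "g i" "\<lambda>y. \<Sum>i\<in>J. g i y"] gCc i insert by simp
  qed
  from this[OF I(1) order_refl] show ?thesis by (simp add: fg[symmetric])
qed


section \<open>Etale groupoids\<close>

context groupoid
begin

lemma units_arrows: "u \<in> units G \<Longrightarrow> u \<in> arrows G"
  by (auto simp: units_def rng_closed)

lemma rng_unit: "u \<in> units G \<Longrightarrow> rng G u = u"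
  by (auto simp: units_def rng_rng)

lemma ginv_ginv:
  assumes a: "\<alpha> \<in> arrows G"
  shows "ginv G (ginv G \<alpha>) = \<alpha>"
proof -
  let ?b = "ginv G \<alpha>" and ?c = "ginv G (ginv G \<alpha>)"
  have c: "?b \<in> arrows G" "?c \<in> arrows G" using a by (simp_all add: ginv_closed)
  then have comp: "(?c, ?b) \<in> composable G" "(?b, \<alpha>) \<in> composable G"
    using a by (simp_all add: composable_def src_ginv)
  have "?c = gmul G ?c (src G \<alpha>)"
    using gmul_src_id[OF c(2)] a c by (simp add: src_ginv rng_ginv)
  also have "\<dots> = gmul G (gmul G ?c ?b) \<alpha>"
    using gmul_assoc[OF comp] a by (simp add: ginv_gmul)
  also have "\<dots> = \<alpha>"
    using a c by (simp add: ginv_gmul src_ginv rng_gmul_id)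
  finally show ?thesis .
qed

text \<open>All sums below run over \<open>\<beta>\<close> with the range of \<open>\<alpha>\<close> and involve the left quotient
  \<open>\<beta>\<^sup>-\<^sup>1 \<alpha>\<close>.\<close>

lemma ldiv:
  assumes "\<alpha> \<in> arrows G" "\<beta> \<in> rfibre G (rng G \<alpha>)"
  shows "(ginv G \<beta>, \<alpha>) \<in> composable G" "gmul G (ginv G \<beta>) \<alpha> \<in> arrows G"
    "rng G (gmul G (ginv G \<beta>) \<alpha>) = src G \<beta>" "src G (gmul G (ginv G \<beta>) \<alpha>) = src G \<alpha>"
    "(\<beta>, gmul G (ginv G \<beta>) \<alpha>) \<in> composable G" "gmul G \<beta> (gmul G (ginv G \<beta>) \<alpha>) = \<alpha>"
proof -
  have b: "\<beta> \<in> arrows G" "rng G \<beta> = rng G \<alpha>" "ginv G \<beta> \<in> arrows G"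
    using assms by (auto simp: rfibre_def ginv_closed)
  show c: "(ginv G \<beta>, \<alpha>) \<in> composable G"
    using b assms by (simp add: composable_def src_ginv)
  show 1: "gmul G (ginv G \<beta>) \<alpha> \<in> arrows G" using c by (rule gmul_closed)
  show 2: "rng G (gmul G (ginv G \<beta>) \<alpha>) = src G \<beta>" using c b by (simp add: rng_gmul rng_ginv)
  show "src G (gmul G (ginv G \<beta>) \<alpha>) = src G \<alpha>" using c by (rule src_gmul)
  show "(\<beta>, gmul G (ginv G \<beta>) \<alpha>) \<in> composable G" using 1 2 b by (simp add: composable_def)
  have "(\<beta>, ginv G \<beta>) \<in> composable G" using b by (simp add: composable_def rng_ginv)
  from gmul_assoc[OF this c] show "gmul G \<beta> (gmul G (ginv G \<beta>) \<alpha>) = \<alpha>"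
    using b assms by (simp add: gmul_ginv rng_gmul_id)
qed

lemma ldiv_sfibre:
  "\<alpha> \<in> sfibre G u \<Longrightarrow> \<beta> \<in> rfibre G (rng G \<alpha>) \<Longrightarrow> gmul G (ginv G \<beta>) \<alpha> \<in> sfibre G u"
  using ldiv(2,4)[of \<alpha> \<beta>] by (auto simp: sfibre_def)

lemma bij_betw_ginv_fibre: "u \<in> units G \<Longrightarrow> bij_betw (ginv G) (rfibre G u) (sfibre G u)"
  by (rule bij_betwI[where g = "ginv G"])
     (auto simp: rfibre_def sfibre_def ginv_closed src_ginv rng_ginv ginv_ginv)

lemma twisted_conv_eq_sum:
  assumes "\<alpha> \<in> arrows G" "finite F" "F \<subseteq> rfibre G (rng G \<alpha>)"
    "\<And>\<beta>. \<beta> \<in> rfibre G (rng G \<alpha>) \<Longrightarrow> \<beta> \<notin> F \<Longrightarrow> f \<beta> = 0"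
  shows "twisted_conv G \<tau> f g \<alpha>
    = (\<Sum>\<beta>\<in>F. f \<beta> * g (gmul G (ginv G \<beta>) \<alpha>) * \<tau> \<beta> (gmul G (ginv G \<beta>) \<alpha>))"
proof -
  have "infsum (\<lambda>\<beta>. f \<beta> * g (gmul G (ginv G \<beta>) \<alpha>) * \<tau> \<beta> (gmul G (ginv G \<beta>) \<alpha>)) (rfibre G (rng G \<alpha>))
      = infsum (\<lambda>\<beta>. f \<beta> * g (gmul G (ginv G \<beta>) \<alpha>) * \<tau> \<beta> (gmul G (ginv G \<beta>) \<alpha>)) F"
    using assms by (intro infsum_cong_neutral) auto
  then show ?thesis using assms by (simp add: twisted_conv_def)
qed

end

text \<open>The inverse \<open>q\<close> of the range map makes the arrow of \<open>U\<close> with a given range depend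
  continuously on that range.\<close>

definition bisection :: "'g tgroupoid \<Rightarrow> 'g set \<Rightarrow> bool" where
  "bisection G U \<longleftrightarrow> inj_on (rng G) U \<and> inj_on (src G) U \<and> openin (unit_top G) (rng G ` U) \<and>
     (\<exists>q. continuous_map (subtopology (unit_top G) (rng G ` U)) (gtop G) q \<and> (\<forall>x\<in>U. q (rng G x) = x))"

locale lch_etale_groupoid = etale_groupoid +
  assumes hausdorff: "Hausdorff_space (gtop G)"
    and loc_compact: "locally_compact_space (gtop G)"
begin

lemma units_topspace: "topspace (unit_top G) = units G"
  using units_arrows by (auto simp: unit_top_def arrows_def)

lemma continuous_rng_unit: "continuous_map (gtop G) (unit_top G) (rng G)"
proof -
  have "\<exists>W. openin (gtop G) W \<and> x \<in> W \<and> W \<subseteq> {x \<in> topspace (gtop G). rng G x \<in> V}"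
    if V: "openin (unit_top G) V" and x: "x \<in> topspace (gtop G)" "rng G x \<in> V" for V x
  proof -
    obtain U where U: "openin (gtop G) U" "x \<in> U"
        "homeomorphic_map (subtopology (gtop G) U) (subtopology (unit_top G) (rng G ` U)) (rng G)"
      using rng_local_homeomorphism x unfolding local_homeomorphism_def by blast
    have "continuous_map (subtopology (gtop G) U) (unit_top G) (rng G)"
      using U(3) by (simp add: homeomorphic_eq_everything_map continuous_map_in_subtopology)
    from openin_continuous_map_preimage[OF this V]
    have "openin (gtop G) {y \<in> topspace (subtopology (gtop G) U). rng G y \<in> V}"
      using U(1) by (rule openin_trans_full)
    then show ?thesis using U(2) x by (intro exI[of _ "{y \<in> topspace (subtopology (gtop G) U). rng G y \<in> V}"]) auto
  qed
  then have "openin (gtop G) {x \<in> topspace (gtop G). rng G x \<in> V}" if "openin (unit_top G) V" for V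
    using that by (subst openin_subopen) simp
  moreover have "rng G \<in> topspace (gtop G) \<rightarrow> topspace (unit_top G)"
    using rng_local_homeomorphism by (simp add: local_homeomorphism_def)
  ultimately show ?thesis by (auto simp: continuous_map_def)
qed

lemma continuous_rng: "continuous_map (gtop G) (gtop G) (rng G)"
  using continuous_rng_unit by (simp add: unit_top_def continuous_map_in_subtopology)

lemma continuous_src: "continuous_map (gtop G) (gtop G) (src G)"
  by (rule continuous_map_eq[OF continuous_map_compose[OF continuous_ginv continuous_rng]])
     (simp add: rng_ginv arrows_def)

text \<open>Near any arrow \<open>\<alpha>\<close> both the range map and, by inversion, the source map are
  homeomorphisms onto open sets of units.\<close>

lemma bisection_exists:
  assumes "\<alpha> \<in> arrows G"
  shows "\<exists>U. openin (gtop G) U \<and> \<alpha> \<in> U \<and> bisection G U"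
proof -
  obtain U where U: "openin (gtop G) U" "\<alpha> \<in> U" "openin (unit_top G) (rng G ` U)"
      "homeomorphic_map (subtopology (gtop G) U) (subtopology (unit_top G) (rng G ` U)) (rng G)"
    using rng_local_homeomorphism assms unfolding local_homeomorphism_def arrows_def by blast
  have "ginv G \<alpha> \<in> topspace (gtop G)" using assms ginv_closed by (simp add: arrows_def)
  then obtain V where V: "openin (gtop G) V" "ginv G \<alpha> \<in> V"
      "homeomorphic_map (subtopology (gtop G) V) (subtopology (unit_top G) (rng G ` V)) (rng G)"
    using rng_local_homeomorphism unfolding local_homeomorphism_def by blast
  have US: "U \<subseteq> arrows G" "V \<subseteq> arrows G"
    using U(1) V(1) openin_subset by (auto simp: arrows_def)
  define W where "W = U \<inter> {x \<in> topspace (gtop G). ginv G x \<in> V}"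
  have W: "openin (gtop G) W"
    unfolding W_def using U(1) V(1) continuous_ginv by (intro openin_Int openin_continuous_map_preimage) auto
  have aW: "\<alpha> \<in> W" using assms U(2) V(2) by (simp add: W_def arrows_def)
  have WU: "W \<subseteq> U" by (simp add: W_def)
  have injU: "inj_on (rng G) U" and injV: "inj_on (rng G) V"
    using U(4) V(3) US by (auto simp: homeomorphic_eq_everything_map arrows_def Int_absorb1)
  have inj_src: "inj_on (src G) W"
  proof (rule inj_onI)
    fix x y assume xy: "x \<in> W" "y \<in> W" "src G x = src G y"
    then have a: "x \<in> arrows G" "y \<in> arrows G" using WU US by auto
    then have "rng G (ginv G x) = rng G (ginv G y)" using xy by (simp add: rng_ginv)
    then have "ginv G x = ginv G y" using injV xy by (auto simp: W_def inj_on_def)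
    then show "x = y" using a ginv_ginv by metis
  qed
  obtain q where q: "homeomorphic_maps (subtopology (gtop G) U) (subtopology (unit_top G) (rng G ` U)) (rng G) q"
    using U(4) homeomorphic_map_maps by blast
  then have "continuous_map (subtopology (unit_top G) (rng G ` U)) (gtop G) q"
    by (simp add: homeomorphic_maps_def continuous_map_in_subtopology)
  then have qc: "continuous_map (subtopology (unit_top G) (rng G ` W)) (gtop G) q"
    using WU by (elim continuous_map_from_subtopology_mono) auto
  have qi: "q (rng G x) = x" if "x \<in> W" for x
    using q that WU US by (auto simp: homeomorphic_maps_def arrows_def)
  have "openin (subtopology (gtop G) U) W"
    using W WU U(1) by (simp add: openin_open_subtopology)
  then have "openin (subtopology (unit_top G) (rng G ` U)) (rng G ` W)"
    using homeomorphic_imp_open_map[OF U(4)] by (simp add: open_map_def)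
  then have "openin (unit_top G) (rng G ` W)" using U(3) by (rule openin_trans_full)
  then have "bisection G W"
    unfolding bisection_def using inj_src qc qi injU WU inj_on_subset by blast
  then show ?thesis using W aW by blast
qed

lemma Cc_induct [consumes 1, case_names zero add bisection]:
  assumes "f \<in> Cc (gtop G)"
    and "P (\<lambda>x. 0)"
    and "\<And>f g. f \<in> Cc (gtop G) \<Longrightarrow> g \<in> Cc (gtop G) \<Longrightarrow> P f \<Longrightarrow> P g \<Longrightarrow> P (\<lambda>x. f x + g x)"
    and "\<And>f U K. f \<in> Cc (gtop G) \<Longrightarrow> openin (gtop G) U \<Longrightarrow> bisection G U \<Longrightarrow> compactin (gtop G) K \<Longrightarrow>
        K \<subseteq> U \<Longrightarrow> {x. f x \<noteq> 0} \<subseteq> K \<Longrightarrow> P f"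
  shows "P f"
  using loc_compact hausdorff assms(1)
  by (rule Cc_induct_cover[where Q = "bisection G"])
     (use assms bisection_exists in \<open>auto simp: arrows_def\<close>)

text \<open>A function supported in a bisection has at most one nonzero value on each fibre. The uniform
  bound is the \<open>I\<close>-norm, which controls all regular representations.\<close>

lemma Cc_fibre_bound:
  assumes "f \<in> Cc (gtop G)"
  shows "\<exists>C. \<forall>u. finite {\<beta> \<in> rfibre G u. f \<beta> \<noteq> 0} \<and> finite {\<beta> \<in> sfibre G u. f \<beta> \<noteq> 0} \<and>
    (\<forall>S. finite S \<and> (S \<subseteq> rfibre G u \<or> S \<subseteq> sfibre G u) \<longrightarrow> (\<Sum>\<beta>\<in>S. cmod (f \<beta>)) \<le> C)"
  using assms
proof (induction rule: Cc_induct)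
  case zero
  show ?case by auto
next
  case (add f g)
  obtain C where C: "\<forall>u. finite {\<beta> \<in> rfibre G u. f \<beta> \<noteq> 0} \<and> finite {\<beta> \<in> sfibre G u. f \<beta> \<noteq> 0} \<and>
      (\<forall>S. finite S \<and> (S \<subseteq> rfibre G u \<or> S \<subseteq> sfibre G u) \<longrightarrow> (\<Sum>\<beta>\<in>S. cmod (f \<beta>)) \<le> C)" using add.IH(1) by (rule exE)
  obtain D where D: "\<forall>u. finite {\<beta> \<in> rfibre G u. g \<beta> \<noteq> 0} \<and> finite {\<beta> \<in> sfibre G u. g \<beta> \<noteq> 0} \<and>
      (\<forall>S. finite S \<and> (S \<subseteq> rfibre G u \<or> S \<subseteq> sfibre G u) \<longrightarrow> (\<Sum>\<beta>\<in>S. cmod (g \<beta>)) \<le> D)" using add.IH(2) by (rule exE)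
  have "finite {\<beta> \<in> F. f \<beta> + g \<beta> \<noteq> 0}"
    if "finite {\<beta> \<in> F. f \<beta> \<noteq> 0}" "finite {\<beta> \<in> F. g \<beta> \<noteq> 0}" for F
    by (rule finite_subset[OF _ finite_UnI[OF that]]) auto
  moreover have "(\<Sum>\<beta>\<in>S. cmod (f \<beta> + g \<beta>)) \<le> C + D"
    if "finite S" "S \<subseteq> rfibre G u \<or> S \<subseteq> sfibre G u" for S u
  proof -
    have "(\<Sum>\<beta>\<in>S. cmod (f \<beta> + g \<beta>)) \<le> (\<Sum>\<beta>\<in>S. cmod (f \<beta>) + cmod (g \<beta>))"
      by (intro sum_mono norm_triangle_ineq)
    also have "\<dots> = (\<Sum>\<beta>\<in>S. cmod (f \<beta>)) + (\<Sum>\<beta>\<in>S. cmod (g \<beta>))" by (rule sum.distrib)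
    also have "\<dots> \<le> C + D"
    proof (rule add_mono)
      show "(\<Sum>\<beta>\<in>S. cmod (f \<beta>)) \<le> C" using spec[OF C, of u] that by simp
      show "(\<Sum>\<beta>\<in>S. cmod (g \<beta>)) \<le> D" using spec[OF D, of u] that by simp
    qed
    finally show ?thesis .
  qed
  ultimately show ?case using C D by (intro exI[of _ "C + D"]) auto
next
  case (bisection f U K)
  obtain C where C: "\<And>x. cmod (f x) \<le> C" using Cc_bounded[OF bisection(1)] by blast
  then have C0: "0 \<le> C" using norm_ge_zero order_trans by blast
  have one: "\<exists>b. {\<beta> \<in> S. f \<beta> \<noteq> 0} \<subseteq> {b}" if "S \<subseteq> rfibre G u \<or> S \<subseteq> sfibre G u" for S u
  proof -
    have inj: "inj_on (rng G) U" "inj_on (src G) U" using bisection(3) by (auto simp: bisection_def)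
    have "x = y" if "x \<in> {\<beta> \<in> S. f \<beta> \<noteq> 0}" "y \<in> {\<beta> \<in> S. f \<beta> \<noteq> 0}" for x y
    proof -
      have "x \<in> U" "y \<in> U" using that bisection(5,6) by auto
      moreover have "rng G x = rng G y \<or> src G x = src G y"
        using that \<open>S \<subseteq> _ \<or> _\<close> by (auto simp: rfibre_def sfibre_def)
      ultimately show ?thesis using inj by (auto dest: inj_onD)
    qed
    then show ?thesis by blast
  qed
  have "(\<Sum>\<beta>\<in>S. cmod (f \<beta>)) \<le> C" if S: "finite S" "S \<subseteq> rfibre G u \<or> S \<subseteq> sfibre G u" for S u
  proof -
    obtain b where b: "{\<beta> \<in> S. f \<beta> \<noteq> 0} \<subseteq> {b}" using one[OF S(2)] by blast
    have "(\<Sum>\<beta>\<in>S. cmod (f \<beta>)) = (\<Sum>\<beta>\<in>S \<inter> {b}. cmod (f \<beta>))"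
      using b S(1) by (intro sum.mono_neutral_right) auto
    also have "\<dots> \<le> C" using C[of b] C0 by (cases "b \<in> S") auto
    finally show ?thesis .
  qed
  moreover have "finite {\<beta> \<in> rfibre G u. f \<beta> \<noteq> 0}" "finite {\<beta> \<in> sfibre G u. f \<beta> \<noteq> 0}" for u
    using one[of "rfibre G u"] one[of "sfibre G u"] finite_subset by blast+
  ultimately show ?case by blast
qed

lemma Cc_finite_rfibre: "f \<in> Cc (gtop G) \<Longrightarrow> finite {\<beta> \<in> rfibre G u. f \<beta> \<noteq> 0}"
  using Cc_fibre_bound by blast

lemma Cc_finite_sfibre: "f \<in> Cc (gtop G) \<Longrightarrow> finite {\<beta> \<in> sfibre G u. f \<beta> \<noteq> 0}"
  using Cc_fibre_bound by blast

end


section \<open>The convolution algebra\<close>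

locale twisted_groupoid = lch_etale_groupoid +
  fixes \<tau> :: "'a \<Rightarrow> 'a \<Rightarrow> complex"
  assumes cocycle: "continuous_normalised_cocycle G \<tau>"
begin

lemma continuous_cocycle: "continuous_map (composable_top G) euclidean (\<lambda>(\<alpha>, \<beta>). \<tau> \<alpha> \<beta>)"
  using cocycle by (simp add: continuous_normalised_cocycle_def continuous_map_in_subtopology)

lemma norm_cocycle:
  assumes "(\<alpha>, \<beta>) \<in> composable G"
  shows "cmod (\<tau> \<alpha> \<beta>) = 1"
proof -
  have "(\<alpha>, \<beta>) \<in> topspace (composable_top G)"
    using assms by (auto simp: composable_top_def composable_def arrows_def)
  moreover have "(\<lambda>(\<alpha>, \<beta>). \<tau> \<alpha> \<beta>) \<in> topspace (composable_top G) \<rightarrow> circle"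
    using cocycle by (auto simp: continuous_normalised_cocycle_def continuous_map_in_subtopology)
  ultimately show ?thesis by force
qed

lemma twisted_conv_nonzero:
  assumes "twisted_conv G \<tau> f g \<alpha> \<noteq> 0"
  obtains \<beta> where "\<alpha> \<in> arrows G" "\<beta> \<in> rfibre G (rng G \<alpha>)" "f \<beta> \<noteq> 0" "g (gmul G (ginv G \<beta>) \<alpha>) \<noteq> 0"
proof -
  have a: "\<alpha> \<in> arrows G" using assms by (auto simp: twisted_conv_def split: if_splits)
  have "\<exists>\<beta>\<in>rfibre G (rng G \<alpha>). f \<beta> \<noteq> 0 \<and> g (gmul G (ginv G \<beta>) \<alpha>) \<noteq> 0"
  proof (rule ccontr)
    assume "\<not> ?thesis"
    then have "f \<beta> * g (gmul G (ginv G \<beta>) \<alpha>) * \<tau> \<beta> (gmul G (ginv G \<beta>) \<alpha>) = 0"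
      if "\<beta> \<in> rfibre G (rng G \<alpha>)" for \<beta>
      using that by auto
    then have "twisted_conv G \<tau> f g \<alpha> = 0"
      using a by (simp add: twisted_conv_def infsum_0)
    then show False using assms by simp
  qed
  then show ?thesis using a that by blast
qed

lemma twisted_conv_add_left:
  assumes "f \<in> Cc (gtop G)" "f' \<in> Cc (gtop G)"
  shows "twisted_conv G \<tau> (\<lambda>x. f x + f' x) g \<alpha> = twisted_conv G \<tau> f g \<alpha> + twisted_conv G \<tau> f' g \<alpha>"
proof (cases "\<alpha> \<in> arrows G")
  case True
  let ?F = "{\<beta> \<in> rfibre G (rng G \<alpha>). f \<beta> \<noteq> 0} \<union> {\<beta> \<in> rfibre G (rng G \<alpha>). f' \<beta> \<noteq> 0}"
  have F: "finite ?F" "?F \<subseteq> rfibre G (rng G \<alpha>)" using assms Cc_finite_rfibre by auto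
  have "twisted_conv G \<tau> h g \<alpha>
      = (\<Sum>\<beta>\<in>?F. h \<beta> * g (gmul G (ginv G \<beta>) \<alpha>) * \<tau> \<beta> (gmul G (ginv G \<beta>) \<alpha>))"
    if "\<And>\<beta>. \<beta> \<in> rfibre G (rng G \<alpha>) \<Longrightarrow> \<beta> \<notin> ?F \<Longrightarrow> h \<beta> = 0" for h
    using twisted_conv_eq_sum[OF True F] that by blast
  then show ?thesis by (simp add: sum.distrib ring_distribs)
qed (simp add: twisted_conv_def)

lemma twisted_conv_diff_right:
  assumes "f \<in> Cc (gtop G)"
  shows "twisted_conv G \<tau> f (\<lambda>x. g x - h x) \<alpha> = twisted_conv G \<tau> f g \<alpha> - twisted_conv G \<tau> f h \<alpha>"
proof (cases "\<alpha> \<in> arrows G")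
  case True
  let ?F = "{\<beta> \<in> rfibre G (rng G \<alpha>). f \<beta> \<noteq> 0}"
  have "twisted_conv G \<tau> f k \<alpha>
      = (\<Sum>\<beta>\<in>?F. f \<beta> * k (gmul G (ginv G \<beta>) \<alpha>) * \<tau> \<beta> (gmul G (ginv G \<beta>) \<alpha>))" for k
    using Cc_finite_rfibre[OF assms] by (intro twisted_conv_eq_sum[OF True]) auto
  then show ?thesis by (simp add: sum_subtractf ring_distribs)
qed (simp add: twisted_conv_def)

text \<open>For \<open>f\<close> supported in a bisection the convolution sum has a single term, at the arrow
  \<open>\<beta> = q (r \<alpha>)\<close> of the bisection; that term is a composite of continuous maps where it is defined,
  and away from the support of \<open>f\<close> the sum vanishes.\<close>

lemma continuous_twisted_conv_bisection:
  assumes f: "f \<in> Cc (gtop G)" and g: "g \<in> Cc (gtop G)" and U: "bisection G U"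
    and K: "compactin (gtop G) K" "K \<subseteq> U" "{x. f x \<noteq> 0} \<subseteq> K" and UA: "openin (gtop G) U"
  shows "continuous_map (gtop G) euclidean (twisted_conv G \<tau> f g)"
proof -
  have UA: "U \<subseteq> arrows G" using UA openin_subset by (auto simp: arrows_def)
  obtain q where q: "continuous_map (subtopology (unit_top G) (rng G ` U)) (gtop G) q"
      "\<And>x. x \<in> U \<Longrightarrow> q (rng G x) = x" and inj: "inj_on (rng G) U" and openU: "openin (unit_top G) (rng G ` U)"
    using U unfolding bisection_def by blast
  define A where "A = {x \<in> topspace (gtop G). rng G x \<in> rng G ` U}"
  define Z where "Z = topspace (gtop G) - {x \<in> topspace (gtop G). rng G x \<in> rng G ` K}"
  define p where "p x = q (rng G x)" for x
  define F where "F x = f (p x) * g (gmul G (ginv G (p x)) x) * \<tau> (p x) (gmul G (ginv G (p x)) x)" for x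
  have p: "p x \<in> U" "rng G (p x) = rng G x" "p x \<in> rfibre G (rng G x)" "x \<in> arrows G" if "x \<in> A" for x
    using that q(2) UA by (auto simp: A_def p_def rfibre_def arrows_def)
  have FA: "twisted_conv G \<tau> f g x = F x" if x: "x \<in> A" for x
  proof -
    have "f \<beta> = 0" if b: "\<beta> \<in> rfibre G (rng G x)" "\<beta> \<notin> {p x}" for \<beta>
    proof (rule ccontr)
      assume "f \<beta> \<noteq> 0"
      then have "\<beta> \<in> U" using K by auto
      then show False using b p[OF x] inj_onD[OF inj, of \<beta> "p x"] by (auto simp: rfibre_def)
    qed
    then show ?thesis
      using twisted_conv_eq_sum[of x "{p x}" f \<tau> g] p[OF x] by (simp add: F_def)
  qed
  have FZ: "twisted_conv G \<tau> f g x = 0" if "x \<in> Z" for x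
  proof (rule ccontr)
    assume "twisted_conv G \<tau> f g x \<noteq> 0"
    then obtain \<beta> where "\<beta> \<in> rfibre G (rng G x)" "f \<beta> \<noteq> 0" "x \<in> arrows G" by (rule twisted_conv_nonzero)
    then have "rng G x \<in> rng G ` K" using K(3) by (auto simp: rfibre_def intro!: image_eqI[of _ _ \<beta>])
    then show False using that by (auto simp: Z_def)
  qed
  have openA: "openin (gtop G) A"
    unfolding A_def using continuous_rng_unit openU by (rule openin_continuous_map_preimage)
  have "closedin (gtop G) (rng G ` K)"
    using hausdorff image_compactin[OF K(1) continuous_rng] by (rule compactin_imp_closedin)
  then have openZ: "openin (gtop G) Z"
    unfolding Z_def using continuous_rng by (intro openin_diff closedin_continuous_map_preimage) auto
  let ?A = "subtopology (gtop G) A"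
  have idA: "continuous_map ?A (gtop G) (\<lambda>x. x)"
    by (rule continuous_map_from_subtopology) simp
  have rA: "continuous_map ?A (subtopology (unit_top G) (rng G ` U)) (rng G)"
    using continuous_map_from_subtopology[OF continuous_rng_unit]
    by (auto simp: continuous_map_in_subtopology A_def)
  have pc: "continuous_map ?A (gtop G) p"
    using continuous_map_compose[OF rA q(1)] by (simp add: p_def[abs_def] comp_def)
  have pinv: "continuous_map ?A (gtop G) (\<lambda>x. ginv G (p x))"
    using continuous_map_compose[OF pc continuous_ginv] by (simp add: comp_def)
  have AX: "topspace ?A = A" using openA openin_subset by auto
  have dc: "continuous_map ?A (gtop G) (\<lambda>x. gmul G (ginv G (p x)) x)"
  proof -
    have "continuous_map ?A (composable_top G) (\<lambda>x. (ginv G (p x), x))"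
      unfolding composable_top_def continuous_map_in_subtopology
      using pinv idA AX ldiv(1) p by (auto simp: continuous_map_pairwise comp_def)
    from continuous_map_compose[OF this continuous_gmul] show ?thesis by (simp add: comp_def)
  qed
  have tc: "continuous_map ?A euclidean (\<lambda>x. \<tau> (p x) (gmul G (ginv G (p x)) x))"
  proof -
    have "continuous_map ?A (composable_top G) (\<lambda>x. (p x, gmul G (ginv G (p x)) x))"
      unfolding composable_top_def continuous_map_in_subtopology
      using pc dc AX ldiv(5) p by (auto simp: continuous_map_pairwise comp_def)
    from continuous_map_compose[OF this continuous_cocycle] show ?thesis by (simp add: comp_def)
  qed
  have Fc: "continuous_map ?A euclidean F"
    unfolding F_def[abs_def]
    using continuous_map_compose[OF pc Cc_continuous[OF f]] continuous_map_compose[OF dc Cc_continuous[OF g]] tc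
    by (intro continuous_map_cmult) (simp_all add: comp_def)
  have FAZ: "F x = 0" if "x \<in> A" "x \<in> Z" for x using FA[OF that(1)] FZ[OF that(2)] by simp
  show ?thesis
  proof (rule pasting_lemma[where I = "{True, False}" and T = "\<lambda>b. if b then A else Z"
        and f = "\<lambda>b. if b then F else (\<lambda>_. 0)"])
    fix x assume "x \<in> topspace (gtop G)"
    then have "x \<in> A \<or> x \<in> Z" using K(2) by (auto simp: A_def Z_def)
    then show "\<exists>j. j \<in> {True, False} \<and> x \<in> (if j then A else Z) \<and>
        twisted_conv G \<tau> f g x = (if j then F else (\<lambda>_. 0)) x"
      using FA FZ by auto
  next
    fix i j x assume "x \<in> topspace (gtop G) \<inter> (if i then A else Z) \<inter> (if j then A else Z)"
    then show "(if i then F else (\<lambda>_. 0)) x = (if j then F else (\<lambda>_. 0)) x"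
      using FAZ by (auto split: if_splits)
  qed (use openA openZ Fc in auto)
qed

text \<open>The support of \<open>f * g\<close> lies in the product of the supports, the image of a compact
  set of composable pairs.\<close>

lemma twisted_conv_Cc:
  assumes f: "f \<in> Cc (gtop G)" and g: "g \<in> Cc (gtop G)"
  shows "twisted_conv G \<tau> f g \<in> Cc (gtop G)"
proof -
  have cont: "continuous_map (gtop G) euclidean (twisted_conv G \<tau> f g)"
    using f
  proof (induction rule: Cc_induct)
    case zero
    have "twisted_conv G \<tau> (\<lambda>x. 0) g = (\<lambda>_. 0)" by (auto simp: twisted_conv_def)
    then show ?case by simp
  next
    case (add f f')
    then show ?case
      by (simp add: twisted_conv_add_left[OF add(1,2), abs_def] continuous_map_add)
  next
    case (bisection f U K)
    then show ?case using continuous_twisted_conv_bisection g by blast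
  qed
  obtain K where K: "compactin (gtop G) K" "{x. f x \<noteq> 0} \<subseteq> K" using f by (rule Cc_support)
  obtain L where L: "compactin (gtop G) L" "{x. g x \<noteq> 0} \<subseteq> L" using g by (rule Cc_support)
  let ?P = "prod_topology (gtop G) (gtop G)"
  have "continuous_map ?P (gtop G) (\<lambda>x. src G (fst x))" "continuous_map ?P (gtop G) (\<lambda>x. rng G (snd x))"
    using continuous_map_compose[OF continuous_map_fst continuous_src]
      continuous_map_compose[OF continuous_map_snd continuous_rng] by (simp_all add: comp_def)
  from closedin_continuous_maps_eq[OF hausdorff this] have "closedin ?P (composable G)"
    by (rule back_subst[where P = "closedin ?P"]) (auto simp: composable_def arrows_def)
  moreover have "compactin ?P (K \<times> L)" using K L by (simp add: compactin_Times)
  ultimately have "compactin ?P (composable G \<inter> (K \<times> L))" by (rule closed_Int_compactin)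
  then have "compactin (composable_top G) (composable G \<inter> (K \<times> L))"
    by (simp add: composable_top_def compactin_subtopology)
  from image_compactin[OF this continuous_gmul]
  have "compactin (gtop G) ((\<lambda>(\<alpha>, \<beta>). gmul G \<alpha> \<beta>) ` (composable G \<inter> (K \<times> L)))" .
  moreover have "{x. twisted_conv G \<tau> f g x \<noteq> 0} \<subseteq> (\<lambda>(\<alpha>, \<beta>). gmul G \<alpha> \<beta>) ` (composable G \<inter> (K \<times> L))"
  proof
    fix \<alpha> assume "\<alpha> \<in> {x. twisted_conv G \<tau> f g x \<noteq> 0}"
    then obtain \<beta> where "\<alpha> \<in> arrows G" "\<beta> \<in> rfibre G (rng G \<alpha>)" "f \<beta> \<noteq> 0" "g (gmul G (ginv G \<beta>) \<alpha>) \<noteq> 0"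
      using twisted_conv_nonzero by blast
    then show "\<alpha> \<in> (\<lambda>(\<alpha>, \<beta>). gmul G \<alpha> \<beta>) ` (composable G \<inter> (K \<times> L))"
      using K(2) L(2) ldiv(5,6)[of \<alpha> \<beta>] by (intro image_eqI[of _ _ "(\<beta>, gmul G (ginv G \<beta>) \<alpha>)"]) auto
  qed
  ultimately show ?thesis by (rule CcI[OF hausdorff cont])
qed

lemma twisted_star_Cc:
  assumes f: "f \<in> Cc (gtop G)"
  shows "twisted_star G \<tau> f \<in> Cc (gtop G)"
proof -
  obtain K where K: "compactin (gtop G) K" "{x. f x \<noteq> 0} \<subseteq> K" using f by (rule Cc_support)
  have "continuous_map (gtop G) (composable_top G) (\<lambda>x. (x, ginv G x))"
    unfolding composable_top_def continuous_map_in_subtopology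
    using continuous_ginv by (auto simp: continuous_map_pairwise comp_def composable_def arrows_def[symmetric]
        ginv_closed rng_ginv)
  from continuous_map_compose[OF this continuous_cocycle]
  have tc: "continuous_map (gtop G) euclidean (\<lambda>x. \<tau> x (ginv G x))" by (simp add: comp_def)
  have fc: "continuous_map (gtop G) euclidean (\<lambda>x. f (ginv G x))"
    using continuous_map_compose[OF continuous_ginv Cc_continuous[OF f]] by (simp add: comp_def)
  have "continuous_map (gtop G) euclidean (twisted_star G \<tau> f)"
    by (rule continuous_map_eq[OF continuous_map_cnj[OF continuous_map_cmult[OF fc tc]]])
       (simp add: twisted_star_def arrows_def)
  moreover have "compactin (gtop G) (ginv G ` K)" using K(1) continuous_ginv by (rule image_compactin)
  moreover have "{x. twisted_star G \<tau> f x \<noteq> 0} \<subseteq> ginv G ` K"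
  proof
    fix x assume "x \<in> {x. twisted_star G \<tau> f x \<noteq> 0}"
    then have "x \<in> arrows G" "f (ginv G x) \<noteq> 0" by (auto simp: twisted_star_def split: if_splits)
    then show "x \<in> ginv G ` K" using K(2) ginv_ginv by (intro image_eqI[of _ _ "ginv G x"]) auto
  qed
  ultimately show ?thesis using CcI[OF hausdorff] by blast
qed

end


section \<open>Regular representations\<close>

text \<open>The real supremum of an unbounded set is unspecified, so every use of an operator norm
  below needs a bound first.\<close>

lemma sup0_upper: "bdd_above A \<Longrightarrow> x \<in> A \<Longrightarrow> x \<le> sup0 A"
  unfolding sup0_def by (intro cSup_upper) auto

lemma sup0_least: "0 \<le> c \<Longrightarrow> (\<And>x. x \<in> A \<Longrightarrow> x \<le> c) \<Longrightarrow> sup0 A \<le> c"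
  unfolding sup0_def by (intro cSup_least) auto

lemma sup0_nonneg: "bdd_above A \<Longrightarrow> 0 \<le> sup0 A"
  unfolding sup0_def by (intro cSup_upper) auto

lemma l2_norm_nonneg [simp]: "0 \<le> l2_norm F \<xi>"
  by (simp add: l2_norm_def infsum_nonneg)

lemma l2_norm_cong: "(\<And>\<alpha>. \<alpha> \<in> F \<Longrightarrow> \<xi> \<alpha> = \<eta> \<alpha>) \<Longrightarrow> l2_norm F \<xi> = l2_norm F \<eta>"
  unfolding l2_norm_def by (metis (mono_tags, lifting) infsum_cong)

lemma l2_norm_finite:
  assumes "finite D" "D \<subseteq> F" "\<And>\<alpha>. \<alpha> \<in> F \<Longrightarrow> \<alpha> \<notin> D \<Longrightarrow> \<xi> \<alpha> = 0"
  shows "l2_norm F \<xi> = L2_set (\<lambda>\<alpha>. cmod (\<xi> \<alpha>)) D"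
proof -
  have "infsum (\<lambda>\<alpha>. (cmod (\<xi> \<alpha>))\<^sup>2) F = infsum (\<lambda>\<alpha>. (cmod (\<xi> \<alpha>))\<^sup>2) D"
    using assms by (intro infsum_cong_neutral) auto
  then show ?thesis using assms(1) by (simp add: l2_norm_def L2_set_def)
qed

lemma finite_sum_le_l2_norm:
  assumes "(\<lambda>\<alpha>. (cmod (\<xi> \<alpha>))\<^sup>2) summable_on F" "finite D" "D \<subseteq> F"
  shows "(\<Sum>\<alpha>\<in>D. (cmod (\<xi> \<alpha>))\<^sup>2) \<le> (l2_norm F \<xi>)\<^sup>2"
  using finite_sum_le_infsum[OF assms] by (simp add: l2_norm_def infsum_nonneg)

lemma l2_norm_leI:
  assumes "0 \<le> c" "\<And>A. finite A \<Longrightarrow> A \<subseteq> F \<Longrightarrow> (\<Sum>\<alpha>\<in>A. (cmod (\<xi> \<alpha>))\<^sup>2) \<le> c\<^sup>2"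
  shows "(\<lambda>\<alpha>. (cmod (\<xi> \<alpha>))\<^sup>2) summable_on F" "l2_norm F \<xi> \<le> c"
proof -
  show s: "(\<lambda>\<alpha>. (cmod (\<xi> \<alpha>))\<^sup>2) summable_on F"
    using assms(2) by (intro nonneg_bdd_above_summable_on) (auto simp: bdd_above_def)
  have "infsum (\<lambda>\<alpha>. (cmod (\<xi> \<alpha>))\<^sup>2) F \<le> c\<^sup>2"
    using s assms(2) by (rule infsum_le_finite_sums)
  then show "l2_norm F \<xi> \<le> c"
    unfolding l2_norm_def by (rule real_le_lsqrt[OF assms(1)])
qed

lemma l2_norm_scale: "l2_norm F (\<lambda>\<alpha>. c * \<xi> \<alpha>) = cmod c * l2_norm F \<xi>"
proof -
  have "infsum (\<lambda>\<alpha>. (cmod (c * \<xi> \<alpha>))\<^sup>2) F = (cmod c)\<^sup>2 * infsum (\<lambda>\<alpha>. (cmod (\<xi> \<alpha>))\<^sup>2) F"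
    by (simp add: norm_mult power_mult_distrib infsum_cmult_right')
  then show ?thesis by (simp add: l2_norm_def real_sqrt_mult)
qed

lemma l2_finite_support:
  assumes "finite D" "D \<subseteq> F" "\<And>\<alpha>. \<alpha> \<notin> D \<Longrightarrow> \<xi> \<alpha> = 0"
  shows "\<xi> \<in> l2 F"
proof -
  have "(\<lambda>\<alpha>. (cmod (\<xi> \<alpha>))\<^sup>2) summable_on F \<longleftrightarrow> (\<lambda>\<alpha>. (cmod (\<xi> \<alpha>))\<^sup>2) summable_on D"
    using assms by (intro summable_on_cong_neutral) auto
  then show ?thesis using assms by (auto simp: l2_def)
qed

context lch_etale_groupoid
begin

lemma Cc_l2_norm_finite:
  assumes "f \<in> Cc (gtop G)"
  shows "l2_norm (sfibre G u) f = L2_set (\<lambda>\<alpha>. cmod (f \<alpha>)) {\<alpha> \<in> sfibre G u. f \<alpha> \<noteq> 0}"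
  using Cc_finite_sfibre[OF assms] by (intro l2_norm_finite) auto

lemma Cc_l2_norm_add:
  assumes "f \<in> Cc (gtop G)" "g \<in> Cc (gtop G)"
  shows "l2_norm (sfibre G u) (\<lambda>x. f x + g x) \<le> l2_norm (sfibre G u) f + l2_norm (sfibre G u) g"
proof -
  let ?D = "{\<alpha> \<in> sfibre G u. f \<alpha> \<noteq> 0} \<union> {\<alpha> \<in> sfibre G u. g \<alpha> \<noteq> 0}"
  have D: "finite ?D" "?D \<subseteq> sfibre G u" using assms Cc_finite_sfibre by auto
  have "L2_set (\<lambda>\<alpha>. cmod (f \<alpha> + g \<alpha>)) ?D \<le> L2_set (\<lambda>\<alpha>. cmod (f \<alpha>) + cmod (g \<alpha>)) ?D"
    by (intro L2_set_mono norm_triangle_ineq) auto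
  also have "\<dots> \<le> L2_set (\<lambda>\<alpha>. cmod (f \<alpha>)) ?D + L2_set (\<lambda>\<alpha>. cmod (g \<alpha>)) ?D"
    by (rule L2_set_triangle_ineq)
  finally show ?thesis
    using l2_norm_finite[OF D, of "\<lambda>x. f x + g x"] l2_norm_finite[OF D, of f] l2_norm_finite[OF D, of g]
    by simp
qed

lemma Cc_l2_norm_bounded:
  assumes "f \<in> Cc (gtop G)"
  shows "\<exists>C\<ge>0. \<forall>u. l2_norm (sfibre G u) f \<le> C"
proof -
  obtain C where C: "\<forall>u. finite {\<beta> \<in> rfibre G u. f \<beta> \<noteq> 0} \<and> finite {\<beta> \<in> sfibre G u. f \<beta> \<noteq> 0} \<and>
    (\<forall>S. finite S \<and> (S \<subseteq> rfibre G u \<or> S \<subseteq> sfibre G u) \<longrightarrow> (\<Sum>\<beta>\<in>S. cmod (f \<beta>)) \<le> C)"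
    using Cc_fibre_bound[OF assms] by (rule exE)
  have "l2_norm (sfibre G u) f \<le> C" for u
  proof -
    let ?S = "{\<beta> \<in> sfibre G u. f \<beta> \<noteq> 0}"
    have "l2_norm (sfibre G u) f \<le> (\<Sum>\<beta>\<in>?S. \<bar>cmod (f \<beta>)\<bar>)"
      unfolding Cc_l2_norm_finite[OF assms] by (rule L2_set_le_sum_abs)
    also have "\<dots> \<le> C" using spec[OF C, of u] by auto
    finally show ?thesis .
  qed
  moreover from this have "0 \<le> C" using l2_norm_nonneg order_trans by blast
  ultimately show ?thesis by blast
qed

text \<open>The inner product of \<open>\<ell>\<^sup>2(s\<^sup>-\<^sup>1(u))\<close>; it turns out to be the module inner product at \<open>u\<close>.\<close>

definition fibre_inn :: "('a \<Rightarrow> complex) \<Rightarrow> ('a \<Rightarrow> complex) \<Rightarrow> 'a \<Rightarrow> complex" where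
  "fibre_inn f g u = (\<Sum>\<^sub>\<infinity>\<alpha>\<in>sfibre G u. cnj (f \<alpha>) * g \<alpha>)"

lemma fibre_inn_finite:
  assumes "finite D" "D \<subseteq> sfibre G u" "\<And>\<alpha>. \<alpha> \<in> sfibre G u \<Longrightarrow> \<alpha> \<notin> D \<Longrightarrow> f \<alpha> = 0 \<or> g \<alpha> = 0"
  shows "fibre_inn f g u = (\<Sum>\<alpha>\<in>D. cnj (f \<alpha>) * g \<alpha>)"
proof -
  have "fibre_inn f g u = infsum (\<lambda>\<alpha>. cnj (f \<alpha>) * g \<alpha>) D"
    unfolding fibre_inn_def using assms by (intro infsum_cong_neutral) auto
  then show ?thesis using assms by simp
qed

lemma fibre_inn_self:
  assumes "f \<in> Cc (gtop G)"
  shows "fibre_inn f f u = complex_of_real ((l2_norm (sfibre G u) f)\<^sup>2)"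
proof -
  let ?D = "{\<alpha> \<in> sfibre G u. f \<alpha> \<noteq> 0}"
  have "fibre_inn f f u = (\<Sum>\<alpha>\<in>?D. cnj (f \<alpha>) * f \<alpha>)"
    using Cc_finite_sfibre[OF assms] by (intro fibre_inn_finite) auto
  also have "\<dots> = complex_of_real (\<Sum>\<alpha>\<in>?D. (cmod (f \<alpha>))\<^sup>2)"
    unfolding of_real_sum by (intro sum.cong) (simp_all add: complex_norm_square mult.commute flip: of_real_power)
  finally show ?thesis
    by (simp add: Cc_l2_norm_finite[OF assms] L2_set_def sum_nonneg)
qed

lemma fibre_inn_Cauchy_Schwarz:
  assumes "f \<in> Cc (gtop G)" "g \<in> Cc (gtop G)"
  shows "cmod (fibre_inn f g u) \<le> l2_norm (sfibre G u) f * l2_norm (sfibre G u) g"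
proof -
  let ?D = "{\<alpha> \<in> sfibre G u. f \<alpha> \<noteq> 0} \<union> {\<alpha> \<in> sfibre G u. g \<alpha> \<noteq> 0}"
  have D: "finite ?D" "?D \<subseteq> sfibre G u" using assms Cc_finite_sfibre by auto
  have "fibre_inn f g u = (\<Sum>\<alpha>\<in>?D. cnj (f \<alpha>) * g \<alpha>)" using D by (intro fibre_inn_finite) auto
  then have "cmod (fibre_inn f g u) \<le> (\<Sum>\<alpha>\<in>?D. \<bar>cmod (f \<alpha>)\<bar> * \<bar>cmod (g \<alpha>)\<bar>)"
    by (metis (no_types, lifting) abs_norm_cancel complex_mod_cnj norm_mult sum.cong sum_norm_le order_refl)
  also have "\<dots> \<le> L2_set (\<lambda>\<alpha>. cmod (f \<alpha>)) ?D * L2_set (\<lambda>\<alpha>. cmod (g \<alpha>)) ?D"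
    by (rule L2_set_mult_ineq)
  finally show ?thesis
    using l2_norm_finite[OF D, of f] l2_norm_finite[OF D, of g] by simp
qed

lemma fibre_inn_diff_right:
  assumes "f \<in> Cc (gtop G)"
  shows "fibre_inn f g u - fibre_inn f h u = fibre_inn f (\<lambda>x. g x - h x) u"
proof -
  let ?D = "{\<alpha> \<in> sfibre G u. f \<alpha> \<noteq> 0}"
  have "fibre_inn f k u = (\<Sum>\<alpha>\<in>?D. cnj (f \<alpha>) * k \<alpha>)" for k
    using Cc_finite_sfibre[OF assms] by (intro fibre_inn_finite) auto
  then show ?thesis by (simp add: sum_subtractf right_diff_distrib)
qed

text \<open>Placing bump functions on disjoint bisections around the support extends a vector of
  \<open>\<ell>\<^sup>2(s\<^sup>-\<^sup>1(u))\<close> without increasing the norm on any other fibre, since each bisection meets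
  each fibre at most once.\<close>

lemma extend_finite_support:
  assumes D: "finite D" "D \<subseteq> sfibre G u" and \<xi>: "\<And>\<alpha>. \<alpha> \<notin> D \<Longrightarrow> \<xi> \<alpha> = 0"
  obtains g where "g \<in> Cc (gtop G)" "\<And>\<alpha>. \<alpha> \<in> sfibre G u \<Longrightarrow> g \<alpha> = \<xi> \<alpha>"
    "\<And>v. l2_norm (sfibre G v) g \<le> l2_norm (sfibre G u) \<xi>"
proof -
  have DA: "D \<subseteq> topspace (gtop G)" using D(2) by (auto simp: sfibre_def arrows_def)
  obtain U where U: "\<And>\<alpha>. \<alpha> \<in> D \<Longrightarrow> openin (gtop G) (U \<alpha>) \<and> \<alpha> \<in> U \<alpha>"
    "\<And>\<alpha> \<beta>. \<alpha> \<in> D \<Longrightarrow> \<beta> \<in> D \<Longrightarrow> \<alpha> \<noteq> \<beta> \<Longrightarrow> U \<alpha> \<inter> U \<beta> = {}"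
    using disjoint_neighbourhoods[OF D(1) DA hausdorff] by blast
  have "\<forall>\<alpha>\<in>D. \<exists>b. b \<in> Cc (gtop G) \<and> b \<alpha> = 1 \<and> (\<forall>y. cmod (b y) \<le> 1) \<and> {y. b y \<noteq> 0} \<subseteq> U \<alpha> \<and>
      inj_on (src G) {y. b y \<noteq> 0}"
  proof
    fix \<alpha> assume a: "\<alpha> \<in> D"
    then obtain W where W: "openin (gtop G) W" "\<alpha> \<in> W" "bisection G W"
      using bisection_exists DA by (auto simp: arrows_def)
    have "openin (gtop G) (U \<alpha> \<inter> W)" "\<alpha> \<in> U \<alpha> \<inter> W" using U(1)[OF a] W by auto
    from Cc_bump[OF loc_compact hausdorff this] obtain b where
      b: "b \<in> Cc (gtop G)" "b \<alpha> = 1" "\<And>y. cmod (b y) \<le> 1" "{y. b y \<noteq> 0} \<subseteq> U \<alpha> \<inter> W" by metis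
    have "inj_on (src G) {y. b y \<noteq> 0}"
      using W(3) b(4) unfolding bisection_def by (meson inj_on_subset le_infE)
    then show "\<exists>b. b \<in> Cc (gtop G) \<and> b \<alpha> = 1 \<and> (\<forall>y. cmod (b y) \<le> 1) \<and> {y. b y \<noteq> 0} \<subseteq> U \<alpha> \<and>
      inj_on (src G) {y. b y \<noteq> 0}" using b by auto
  qed
  from bchoice[OF this] obtain b where b: "\<forall>\<alpha>\<in>D. b \<alpha> \<in> Cc (gtop G) \<and> b \<alpha> \<alpha> = 1 \<and>
    (\<forall>y. cmod (b \<alpha> y) \<le> 1) \<and> {y. b \<alpha> y \<noteq> 0} \<subseteq> U \<alpha> \<and> inj_on (src G) {y. b \<alpha> y \<noteq> 0}" ..
  define g where "g y = (\<Sum>\<alpha>\<in>D. \<xi> \<alpha> * b \<alpha> y)" for y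
  have single: "g y = \<xi> \<alpha> * b \<alpha> y" if "\<alpha> \<in> D" "y \<in> U \<alpha>" for y \<alpha>
  proof -
    have "b \<beta> y = 0" if "\<beta> \<in> D - {\<alpha>}" for \<beta>
    proof (rule ccontr)
      assume "b \<beta> y \<noteq> 0"
      then have "y \<in> U \<beta>" using b that by auto
      then show False using U(2)[of \<alpha> \<beta>] that \<open>\<alpha> \<in> D\<close> \<open>y \<in> U \<alpha>\<close> by auto
    qed
    then have "g y = (\<Sum>\<beta>\<in>{\<alpha>}. \<xi> \<beta> * b \<beta> y)"
      unfolding g_def using D(1) that by (intro sum.mono_neutral_right) auto
    then show ?thesis by simp
  qed
  have supp: "\<exists>\<alpha>\<in>D. b \<alpha> y \<noteq> 0 \<and> y \<in> U \<alpha>" if "g y \<noteq> 0" for y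
  proof -
    have "\<exists>\<alpha>\<in>D. \<xi> \<alpha> * b \<alpha> y \<noteq> 0" using that unfolding g_def by (meson sum.neutral)
    then show ?thesis using b by auto
  qed
  have gCc: "g \<in> Cc (gtop G)"
    unfolding g_def[abs_def] using b by (intro Cc_sum Cc_scale hausdorff) auto
  have gu: "g \<gamma> = \<xi> \<gamma>" if \<gamma>: "\<gamma> \<in> sfibre G u" for \<gamma>
  proof (cases "\<gamma> \<in> D")
    case True
    then show ?thesis using single[of \<gamma> \<gamma>] U(1) b by simp
  next
    case False
    have "g \<gamma> = 0"
    proof (rule ccontr)
      assume "g \<gamma> \<noteq> 0"
      then obtain \<alpha> where a: "\<alpha> \<in> D" "b \<alpha> \<gamma> \<noteq> 0" using supp by blast
      then have "src G \<gamma> = src G \<alpha>" "b \<alpha> \<alpha> \<noteq> 0" using \<gamma> D(2) b by (auto simp: sfibre_def)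
      moreover have "inj_on (src G) {y. b \<alpha> y \<noteq> 0}" using b a by simp
      ultimately have "\<gamma> = \<alpha>" using a by (simp add: inj_on_eq_iff)
      then show False using False a by simp
    qed
    then show ?thesis using \<xi> False by simp
  qed
  have bound: "l2_norm (sfibre G v) g \<le> l2_norm (sfibre G u) \<xi>" for v
  proof (rule l2_norm_leI)
    fix S assume S: "finite S" "S \<subseteq> sfibre G v"
    have "(cmod (g y))\<^sup>2 \<le> (\<Sum>\<alpha>\<in>D. (cmod (\<xi> \<alpha>))\<^sup>2 * (if b \<alpha> y \<noteq> 0 then 1 else 0))" for y
    proof (cases "g y = 0")
      case True
      then show ?thesis by (simp add: sum_nonneg)
    next
      case False
      then obtain \<alpha> where a: "\<alpha> \<in> D" "b \<alpha> y \<noteq> 0" "y \<in> U \<alpha>" using supp by blast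
      have "(cmod (g y))\<^sup>2 \<le> (cmod (\<xi> \<alpha>))\<^sup>2 * (if b \<alpha> y \<noteq> 0 then 1 else 0)"
        using single[OF a(1,3)] a b by (simp add: norm_mult mult_left_le power_mono)
      also have "\<dots> \<le> (\<Sum>\<alpha>\<in>D. (cmod (\<xi> \<alpha>))\<^sup>2 * (if b \<alpha> y \<noteq> 0 then 1 else 0))"
        using a(1) D(1) by (intro member_le_sum) auto
      finally show ?thesis .
    qed
    then have "(\<Sum>y\<in>S. (cmod (g y))\<^sup>2) \<le> (\<Sum>y\<in>S. \<Sum>\<alpha>\<in>D. (cmod (\<xi> \<alpha>))\<^sup>2 * (if b \<alpha> y \<noteq> 0 then 1 else 0))"
      by (intro sum_mono)
    also have "\<dots> = (\<Sum>\<alpha>\<in>D. (cmod (\<xi> \<alpha>))\<^sup>2 * real (card {y \<in> S. b \<alpha> y \<noteq> 0}))"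
      by (subst sum.swap) (simp add: sum_distrib_left[symmetric] sum.If_cases[OF S(1)] Int_def)
    also have "\<dots> \<le> (\<Sum>\<alpha>\<in>D. (cmod (\<xi> \<alpha>))\<^sup>2)"
    proof (rule sum_mono)
      fix \<alpha> assume a: "\<alpha> \<in> D"
      have "card {y \<in> S. b \<alpha> y \<noteq> 0} \<le> Suc 0"
        using S b a unfolding card_le_Suc0_iff_eq[OF finite_subset[OF _ S(1), of "{y \<in> S. b \<alpha> y \<noteq> 0}"], OF Collect_restrict]
        by (auto simp: sfibre_def inj_on_def subset_iff)
      then show "(cmod (\<xi> \<alpha>))\<^sup>2 * real (card {y \<in> S. b \<alpha> y \<noteq> 0}) \<le> (cmod (\<xi> \<alpha>))\<^sup>2"
        by (simp add: mult_left_le)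
    qed
    also have "\<dots> = (l2_norm (sfibre G u) \<xi>)\<^sup>2"
      using l2_norm_finite[OF D, of \<xi>] \<xi> by (simp add: L2_set_def sum_nonneg)
    finally show "(\<Sum>y\<in>S. (cmod (g y))\<^sup>2) \<le> (l2_norm (sfibre G u) \<xi>)\<^sup>2" .
  qed simp
  show ?thesis using that[OF gCc gu bound] .
qed

end

context twisted_groupoid
begin

text \<open>The representation over \<open>u\<close> is left convolution on functions on the source fibre of \<open>u\<close>.
  This identity links it to left multiplication on the module.\<close>

lemma Ind_eq_twisted_conv:
  "Ind G \<tau> u f \<xi> \<alpha> = (if \<alpha> \<in> sfibre G u then twisted_conv G \<tau> f \<xi> \<alpha> else 0)"
  by (auto simp: Ind_def twisted_conv_def sfibre_def)

lemma Ind_eq_sum: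
  assumes "f \<in> Cc (gtop G)" "\<alpha> \<in> sfibre G u"
  shows "Ind G \<tau> u f \<xi> \<alpha> = (\<Sum>\<beta>\<in>{\<beta> \<in> rfibre G (rng G \<alpha>). f \<beta> \<noteq> 0}.
    f \<beta> * \<xi> (gmul G (ginv G \<beta>) \<alpha>) * \<tau> \<beta> (gmul G (ginv G \<beta>) \<alpha>))"
  unfolding Ind_eq_twisted_conv using assms
  by (auto simp: sfibre_def intro!: twisted_conv_eq_sum Cc_finite_rfibre)

text \<open>The Schur test: Cauchy-Schwarz with weights \<open>|f|\<close> bounds each value of \<open>Ind f \<xi>\<close>, and the
  substitution \<open>\<gamma> = \<beta>\<^sup>-\<^sup>1 \<alpha>\<close> turns the double sum over \<open>(\<alpha>, \<beta>)\<close> into sums of \<open>|f|\<close> over source fibres.\<close>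

lemma Ind_finite_bound:
  assumes f: "f \<in> Cc (gtop G)"
  shows "\<exists>C\<ge>0. \<forall>u \<xi> A. finite A \<longrightarrow> A \<subseteq> sfibre G u \<longrightarrow> (\<exists>D. finite D \<and> D \<subseteq> sfibre G u \<and>
    (\<Sum>\<alpha>\<in>A. (cmod (Ind G \<tau> u f \<xi> \<alpha>))\<^sup>2) \<le> C\<^sup>2 * (\<Sum>\<gamma>\<in>D. (cmod (\<xi> \<gamma>))\<^sup>2))"
proof -
  obtain C where "\<forall>u. finite {\<beta> \<in> rfibre G u. f \<beta> \<noteq> 0} \<and> finite {\<beta> \<in> sfibre G u. f \<beta> \<noteq> 0} \<and>
    (\<forall>S. finite S \<and> (S \<subseteq> rfibre G u \<or> S \<subseteq> sfibre G u) \<longrightarrow> (\<Sum>\<beta>\<in>S. cmod (f \<beta>)) \<le> C)"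
    using Cc_fibre_bound[OF f] by (rule exE)
  then have C: "(\<Sum>\<beta>\<in>S. cmod (f \<beta>)) \<le> C" if "finite S" "S \<subseteq> rfibre G u \<or> S \<subseteq> sfibre G u" for S u
    using that by blast
  have C0: "0 \<le> C" using C[of "{}"] by simp
  define R where "R \<alpha> = {\<beta> \<in> rfibre G (rng G \<alpha>). f \<beta> \<noteq> 0}" for \<alpha>
  have finR: "finite (R \<alpha>)" for \<alpha> unfolding R_def using f by (rule Cc_finite_rfibre)
  have "\<exists>D. finite D \<and> D \<subseteq> sfibre G u \<and>
      (\<Sum>\<alpha>\<in>A. (cmod (Ind G \<tau> u f \<xi> \<alpha>))\<^sup>2) \<le> C\<^sup>2 * (\<Sum>\<gamma>\<in>D. (cmod (\<xi> \<gamma>))\<^sup>2)"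
    if A: "finite A" "A \<subseteq> sfibre G u" for u \<xi> A
  proof -
    let ?d = "\<lambda>\<alpha> \<beta>. gmul G (ginv G \<beta>) \<alpha>"
    \<comment> \<open>The change of variables \<open>(\<alpha>, \<beta>) \<mapsto> (\<beta>\<^sup>-\<^sup>1 \<alpha>, \<beta>)\<close>, inverted by \<open>\<alpha> = \<beta> \<gamma>\<close>.\<close>
    define e where "e = (\<lambda>(\<alpha>, \<beta>). (?d \<alpha> \<beta>, \<beta>))"
    define D where "D = fst ` e ` Sigma A R"
    define S where "S \<gamma> = {\<beta> \<in> sfibre G (rng G \<gamma>). f \<beta> \<noteq> 0}" for \<gamma>
    have finS: "finite (S \<gamma>)" for \<gamma> unfolding S_def using f by (rule Cc_finite_sfibre)
    have finAR: "finite (Sigma A R)" using A(1) finR by simp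
    have AR: "\<alpha> \<in> arrows G" "\<beta> \<in> rfibre G (rng G \<alpha>)" "\<alpha> \<in> sfibre G u" "f \<beta> \<noteq> 0" "\<beta> \<in> arrows G"
      if "(\<alpha>, \<beta>) \<in> Sigma A R" for \<alpha> \<beta>
      using that A(2) by (auto simp: R_def sfibre_def rfibre_def)
    have D: "finite D" "D \<subseteq> sfibre G u"
      using finAR AR ldiv_sfibre by (auto simp: D_def e_def)
    have inj: "inj_on e (Sigma A R)"
    proof (rule inj_onI)
      fix p p' assume p: "p \<in> Sigma A R" "p' \<in> Sigma A R" "e p = e p'"
      obtain \<alpha> \<beta> \<alpha>' where "p = (\<alpha>, \<beta>)" "p' = (\<alpha>', \<beta>)" "?d \<alpha> \<beta> = ?d \<alpha>' \<beta>"
        using p(3) by (cases p; cases p') (auto simp: e_def)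
      then show "p = p'" using p ldiv(6)[of \<alpha> \<beta>] ldiv(6)[of \<alpha>' \<beta>] AR by metis
    qed
    have pointwise: "(cmod (Ind G \<tau> u f \<xi> \<alpha>))\<^sup>2 \<le> C * (\<Sum>\<beta>\<in>R \<alpha>. cmod (f \<beta>) * (cmod (\<xi> (?d \<alpha> \<beta>)))\<^sup>2)"
      if a: "\<alpha> \<in> A" for \<alpha>
    proof -
      have "\<alpha> \<in> sfibre G u" using a A(2) by auto
      then have "cmod (Ind G \<tau> u f \<xi> \<alpha>) \<le> (\<Sum>\<beta>\<in>R \<alpha>. cmod (f \<beta> * \<xi> (?d \<alpha> \<beta>) * \<tau> \<beta> (?d \<alpha> \<beta>)))"
        unfolding R_def by (simp only: Ind_eq_sum[OF f] norm_sum)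
      also have "\<dots> = (\<Sum>\<beta>\<in>R \<alpha>. sqrt (cmod (f \<beta>)) * (sqrt (cmod (f \<beta>)) * cmod (\<xi> (?d \<alpha> \<beta>))))"
      proof (rule sum.cong)
        fix \<beta> assume "\<beta> \<in> R \<alpha>"
        then have "cmod (\<tau> \<beta> (?d \<alpha> \<beta>)) = 1" using AR[of \<alpha> \<beta>] a ldiv(5) norm_cocycle by auto
        then show "cmod (f \<beta> * \<xi> (?d \<alpha> \<beta>) * \<tau> \<beta> (?d \<alpha> \<beta>))
            = sqrt (cmod (f \<beta>)) * (sqrt (cmod (f \<beta>)) * cmod (\<xi> (?d \<alpha> \<beta>)))"
          by (simp add: norm_mult flip: mult.assoc)
      qed simp
      finally have "(cmod (Ind G \<tau> u f \<xi> \<alpha>))\<^sup>2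
          \<le> (\<Sum>\<beta>\<in>R \<alpha>. sqrt (cmod (f \<beta>)) * (sqrt (cmod (f \<beta>)) * cmod (\<xi> (?d \<alpha> \<beta>))))\<^sup>2"
        by (intro power_mono) auto
      also have "\<dots> \<le> (\<Sum>\<beta>\<in>R \<alpha>. (sqrt (cmod (f \<beta>)))\<^sup>2) * (\<Sum>\<beta>\<in>R \<alpha>. (sqrt (cmod (f \<beta>)) * cmod (\<xi> (?d \<alpha> \<beta>)))\<^sup>2)"
        by (rule Cauchy_Schwarz_ineq_sum)
      also have "\<dots> = (\<Sum>\<beta>\<in>R \<alpha>. cmod (f \<beta>)) * (\<Sum>\<beta>\<in>R \<alpha>. cmod (f \<beta>) * (cmod (\<xi> (?d \<alpha> \<beta>)))\<^sup>2)"
        by (simp add: power_mult_distrib)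
      also have "\<dots> \<le> C * (\<Sum>\<beta>\<in>R \<alpha>. cmod (f \<beta>) * (cmod (\<xi> (?d \<alpha> \<beta>)))\<^sup>2)"
        using C[OF finR, of \<alpha> "rng G \<alpha>"] by (intro mult_right_mono sum_nonneg) (auto simp: R_def)
      finally show ?thesis .
    qed
    let ?w = "\<lambda>(\<gamma>, \<beta>). cmod (f \<beta>) * (cmod (\<xi> \<gamma>))\<^sup>2"
    have "(\<Sum>\<alpha>\<in>A. \<Sum>\<beta>\<in>R \<alpha>. cmod (f \<beta>) * (cmod (\<xi> (?d \<alpha> \<beta>)))\<^sup>2) = (\<Sum>p\<in>Sigma A R. ?w (e p))"
      using A(1) finR by (subst sum.Sigma) (auto simp: e_def split_def)
    also have "\<dots> = (\<Sum>p\<in>e ` Sigma A R. ?w p)"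
      using inj by (simp add: sum.reindex comp_def)
    also have "\<dots> \<le> (\<Sum>p\<in>Sigma D S. ?w p)"
    proof (rule sum_mono2)
      show "finite (Sigma D S)" using D finS by simp
      show "e ` Sigma A R \<subseteq> Sigma D S"
      proof
        fix p assume p: "p \<in> e ` Sigma A R"
        then obtain \<alpha> \<beta> where ab: "(\<alpha>, \<beta>) \<in> Sigma A R" "p = (?d \<alpha> \<beta>, \<beta>)" by (auto simp: e_def)
        have "?d \<alpha> \<beta> \<in> D" unfolding D_def using p ab(2) by (metis fst_conv image_eqI)
        moreover have "\<beta> \<in> S (?d \<alpha> \<beta>)" using AR[OF ab(1)] ldiv(3) by (simp add: S_def sfibre_def)
        ultimately show "p \<in> Sigma D S" using ab(2) by simp
      qed
    qed auto
    also have "\<dots> = (\<Sum>\<gamma>\<in>D. (cmod (\<xi> \<gamma>))\<^sup>2 * (\<Sum>\<beta>\<in>S \<gamma>. cmod (f \<beta>)))"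
      using D finS by (subst sum.Sigma[symmetric]) (auto simp: sum_distrib_right mult.commute)
    also have "\<dots> \<le> (\<Sum>\<gamma>\<in>D. (cmod (\<xi> \<gamma>))\<^sup>2 * C)"
    proof (intro sum_mono mult_left_mono)
      fix \<gamma>
      show "(\<Sum>\<beta>\<in>S \<gamma>. cmod (f \<beta>)) \<le> C" using C[OF finS, of \<gamma> "rng G \<gamma>"] by (auto simp: S_def)
    qed auto
    also have "\<dots> = C * (\<Sum>\<gamma>\<in>D. (cmod (\<xi> \<gamma>))\<^sup>2)" by (simp add: mult.commute sum_distrib_left)
    finally have double: "(\<Sum>\<alpha>\<in>A. \<Sum>\<beta>\<in>R \<alpha>. cmod (f \<beta>) * (cmod (\<xi> (?d \<alpha> \<beta>)))\<^sup>2)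
        \<le> C * (\<Sum>\<gamma>\<in>D. (cmod (\<xi> \<gamma>))\<^sup>2)" .
    have "(\<Sum>\<alpha>\<in>A. (cmod (Ind G \<tau> u f \<xi> \<alpha>))\<^sup>2)
        \<le> (\<Sum>\<alpha>\<in>A. C * (\<Sum>\<beta>\<in>R \<alpha>. cmod (f \<beta>) * (cmod (\<xi> (?d \<alpha> \<beta>)))\<^sup>2))"
      using pointwise by (rule sum_mono)
    also have "\<dots> \<le> C * (C * (\<Sum>\<gamma>\<in>D. (cmod (\<xi> \<gamma>))\<^sup>2))"
      using mult_left_mono[OF double C0] by (simp add: sum_distrib_left[symmetric])
    finally show ?thesis using D by (auto simp: power2_eq_square mult.assoc)
  qed
  then show ?thesis using C0 by blast
qed

lemma Ind_bounded:
  assumes f: "f \<in> Cc (gtop G)"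
  shows "\<exists>C\<ge>0. \<forall>u. \<forall>\<xi>\<in>l2 (sfibre G u).
    (\<lambda>\<alpha>. (cmod (Ind G \<tau> u f \<xi> \<alpha>))\<^sup>2) summable_on sfibre G u \<and>
    l2_norm (sfibre G u) (Ind G \<tau> u f \<xi>) \<le> C * l2_norm (sfibre G u) \<xi>"
proof -
  obtain C where C: "0 \<le> C" "\<forall>u \<xi> A. finite A \<longrightarrow> A \<subseteq> sfibre G u \<longrightarrow> (\<exists>D. finite D \<and> D \<subseteq> sfibre G u \<and>
    (\<Sum>\<alpha>\<in>A. (cmod (Ind G \<tau> u f \<xi> \<alpha>))\<^sup>2) \<le> C\<^sup>2 * (\<Sum>\<gamma>\<in>D. (cmod (\<xi> \<gamma>))\<^sup>2))"
    using Ind_finite_bound[OF f] by auto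
  have "(\<Sum>\<alpha>\<in>A. (cmod (Ind G \<tau> u f \<xi> \<alpha>))\<^sup>2) \<le> (C * l2_norm (sfibre G u) \<xi>)\<^sup>2"
    if \<xi>: "\<xi> \<in> l2 (sfibre G u)" and A: "finite A" "A \<subseteq> sfibre G u" for u \<xi> A
  proof -
    obtain D where D: "finite D" "D \<subseteq> sfibre G u"
      "(\<Sum>\<alpha>\<in>A. (cmod (Ind G \<tau> u f \<xi> \<alpha>))\<^sup>2) \<le> C\<^sup>2 * (\<Sum>\<gamma>\<in>D. (cmod (\<xi> \<gamma>))\<^sup>2)"
      using C(2) A by meson
    have "(\<Sum>\<gamma>\<in>D. (cmod (\<xi> \<gamma>))\<^sup>2) \<le> (l2_norm (sfibre G u) \<xi>)\<^sup>2"
      using \<xi> D by (intro finite_sum_le_l2_norm) (auto simp: l2_def)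
    then have "C\<^sup>2 * (\<Sum>\<gamma>\<in>D. (cmod (\<xi> \<gamma>))\<^sup>2) \<le> C\<^sup>2 * (l2_norm (sfibre G u) \<xi>)\<^sup>2"
      by (intro mult_left_mono) auto
    then show ?thesis using D(3) by (simp add: power_mult_distrib)
  qed
  then have "(\<lambda>\<alpha>. (cmod (Ind G \<tau> u f \<xi> \<alpha>))\<^sup>2) summable_on sfibre G u \<and>
    l2_norm (sfibre G u) (Ind G \<tau> u f \<xi>) \<le> C * l2_norm (sfibre G u) \<xi>"
    if "\<xi> \<in> l2 (sfibre G u)" for u \<xi>
    using that C(1) l2_norm_leI[of "C * l2_norm (sfibre G u) \<xi>" "sfibre G u" "Ind G \<tau> u f \<xi>"] by simp
  then show ?thesis using C(1) by blast
qed

lemma Ind_scale: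
  assumes "f \<in> Cc (gtop G)"
  shows "Ind G \<tau> u f (\<lambda>x. c * \<xi> x) = (\<lambda>x. c * Ind G \<tau> u f \<xi> x)"
proof
  fix \<alpha>
  show "Ind G \<tau> u f (\<lambda>x. c * \<xi> x) \<alpha> = c * Ind G \<tau> u f \<xi> \<alpha>"
  proof (cases "\<alpha> \<in> sfibre G u")
    case True
    then show ?thesis
      unfolding Ind_eq_sum[OF assms True] by (simp add: sum_distrib_left ac_simps)
  qed (simp add: Ind_def)
qed

lemma
  assumes f: "f \<in> Cc (gtop G)"
  shows bdd_above_Ind: "bdd_above {l2_norm (sfibre G u) (Ind G \<tau> u f \<xi>) | \<xi>.
        \<xi> \<in> l2 (sfibre G u) \<and> l2_norm (sfibre G u) \<xi> \<le> 1}" (is "bdd_above (?A u)")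
    and bdd_above_operator_norm_Ind: "bdd_above {operator_norm (l2 (sfibre G u))
        (l2_norm (sfibre G u)) (Ind G \<tau> u f) | u. u \<in> units G}"
proof -
  obtain C where C: "0 \<le> C" "\<And>u \<xi>. \<xi> \<in> l2 (sfibre G u) \<Longrightarrow>
      l2_norm (sfibre G u) (Ind G \<tau> u f \<xi>) \<le> C * l2_norm (sfibre G u) \<xi>"
    using Ind_bounded[OF f] by meson
  have le: "x \<le> C" if "x \<in> ?A u" for x u
  proof -
    obtain \<xi> where \<xi>: "\<xi> \<in> l2 (sfibre G u)" "l2_norm (sfibre G u) \<xi> \<le> 1"
        "x = l2_norm (sfibre G u) (Ind G \<tau> u f \<xi>)"
      using \<open>x \<in> ?A u\<close> by blast
    have "C * l2_norm (sfibre G u) \<xi> \<le> C" using C(1) \<xi>(2) by (simp add: mult_left_le)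
    then show ?thesis using C(2)[OF \<xi>(1)] \<xi>(3) by simp
  qed
  then show "bdd_above (?A u)" by (rule bdd_aboveI)
  show "bdd_above {operator_norm (l2 (sfibre G u)) (l2_norm (sfibre G u)) (Ind G \<tau> u f) | u. u \<in> units G}"
    by (rule bdd_aboveI[of _ C]) (auto simp: operator_norm_def intro!: sup0_least C(1) intro: le)
qed

lemma reduced_norm_nonneg: "f \<in> Cc (gtop G) \<Longrightarrow> 0 \<le> reduced_norm G \<tau> f"
  unfolding reduced_norm_def by (intro sup0_nonneg bdd_above_operator_norm_Ind)

lemma Ind_le_reduced_norm:
  assumes f: "f \<in> Cc (gtop G)" and u: "u \<in> units G" and \<xi>: "\<xi> \<in> l2 (sfibre G u)"
  shows "l2_norm (sfibre G u) (Ind G \<tau> u f \<xi>) \<le> reduced_norm G \<tau> f * l2_norm (sfibre G u) \<xi>"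
proof -
  let ?N = "l2_norm (sfibre G u)"
  obtain C where C: "?N (Ind G \<tau> u f \<xi>) \<le> C * ?N \<xi>"
    using Ind_bounded[OF f] \<xi> by meson
  show ?thesis
  proof (cases "?N \<xi> = 0")
    case True
    then show ?thesis using C by simp
  next
    case False
    define c where "c = complex_of_real (1 / ?N \<xi>)"
    have c: "cmod c = 1 / ?N \<xi>" by (simp add: c_def norm_divide)
    let ?\<eta> = "\<lambda>x. c * \<xi> x"
    have "?\<eta> \<in> l2 (sfibre G u)"
      using \<xi> by (auto simp: l2_def norm_mult power_mult_distrib intro: summable_on_cmult_right)
    moreover have "?N ?\<eta> = 1" using False by (simp add: l2_norm_scale c)
    ultimately have "?N (Ind G \<tau> u f ?\<eta>) \<le> operator_norm (l2 (sfibre G u)) ?N (Ind G \<tau> u f)"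
      unfolding operator_norm_def by (intro sup0_upper bdd_above_Ind[OF f]) auto
    also have "\<dots> \<le> reduced_norm G \<tau> f"
      unfolding reduced_norm_def using u by (intro sup0_upper bdd_above_operator_norm_Ind[OF f]) auto
    finally have "?N (Ind G \<tau> u f \<xi>) / ?N \<xi> \<le> reduced_norm G \<tau> f"
      by (simp add: Ind_scale[OF f] l2_norm_scale c)
    then show ?thesis using False l2_norm_nonneg[of "sfibre G u" \<xi>] by (simp add: divide_le_eq)
  qed
qed

lemma Ind_cong:
  assumes "\<And>\<gamma>. \<gamma> \<in> sfibre G u \<Longrightarrow> \<xi> \<gamma> = \<eta> \<gamma>"
  shows "Ind G \<tau> u f \<xi> = Ind G \<tau> u f \<eta>"
proof
  fix \<alpha>
  show "Ind G \<tau> u f \<xi> \<alpha> = Ind G \<tau> u f \<eta> \<alpha>"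
    using assms ldiv_sfibre by (auto simp: Ind_def intro!: infsum_cong)
qed

lemma twisted_conv_le_reduced_norm:
  assumes f: "f \<in> Cc (gtop G)" and g: "g \<in> Cc (gtop G)" and u: "u \<in> units G"
  shows "l2_norm (sfibre G u) (twisted_conv G \<tau> f g) \<le> reduced_norm G \<tau> f * l2_norm (sfibre G u) g"
proof -
  define \<xi> where "\<xi> \<alpha> = (if \<alpha> \<in> sfibre G u then g \<alpha> else 0)" for \<alpha>
  have "\<xi> \<in> l2 (sfibre G u)"
    by (rule l2_finite_support[OF Cc_finite_sfibre[OF g]]) (auto simp: \<xi>_def)
  moreover have "l2_norm (sfibre G u) (twisted_conv G \<tau> f g) = l2_norm (sfibre G u) (Ind G \<tau> u f g)"
    by (rule l2_norm_cong) (simp add: Ind_eq_twisted_conv)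
  moreover have "Ind G \<tau> u f g = Ind G \<tau> u f \<xi>" by (rule Ind_cong) (simp add: \<xi>_def)
  moreover have "l2_norm (sfibre G u) \<xi> = l2_norm (sfibre G u) g"
    by (rule l2_norm_cong) (simp add: \<xi>_def)
  ultimately show ?thesis using Ind_le_reduced_norm[OF f u, of \<xi>] by simp
qed

text \<open>Each value of \<open>Ind f \<xi>\<close> involves only finitely many values of \<open>\<xi>\<close>, so finitely many
  of its values are also those for a finitely supported vector.\<close>

lemma reduced_norm_leI:
  assumes f: "f \<in> Cc (gtop G)" and c: "0 \<le> c"
    and le: "\<And>u D \<xi>. u \<in> units G \<Longrightarrow> finite D \<Longrightarrow> D \<subseteq> sfibre G u \<Longrightarrow> (\<And>\<alpha>. \<alpha> \<notin> D \<Longrightarrow> \<xi> \<alpha> = 0) \<Longrightarrow>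
      l2_norm (sfibre G u) \<xi> \<le> 1 \<Longrightarrow> l2_norm (sfibre G u) (Ind G \<tau> u f \<xi>) \<le> c"
  shows "reduced_norm G \<tau> f \<le> c"
proof -
  have "l2_norm (sfibre G u) (Ind G \<tau> u f \<xi>) \<le> c"
    if u: "u \<in> units G" and \<xi>: "\<xi> \<in> l2 (sfibre G u)" "l2_norm (sfibre G u) \<xi> \<le> 1" for u \<xi>
  proof (rule l2_norm_leI[OF c])
    fix A assume A: "finite A" "A \<subseteq> sfibre G u"
    let ?R = "\<lambda>\<alpha>. {\<beta> \<in> rfibre G (rng G \<alpha>). f \<beta> \<noteq> 0}"
    define D where "D = (\<Union>\<alpha>\<in>A. (\<lambda>\<beta>. gmul G (ginv G \<beta>) \<alpha>) ` ?R \<alpha>)"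
    define \<eta> where "\<eta> \<gamma> = (if \<gamma> \<in> D then \<xi> \<gamma> else 0)" for \<gamma>
    have D: "finite D" "D \<subseteq> sfibre G u"
      unfolding D_def using A Cc_finite_rfibre[OF f] ldiv_sfibre by auto
    have "l2_norm (sfibre G u) \<eta> \<le> 1"
    proof (rule l2_norm_leI)
      fix B assume B: "finite B" "B \<subseteq> sfibre G u"
      have "(\<Sum>\<alpha>\<in>B. (cmod (\<eta> \<alpha>))\<^sup>2) \<le> (\<Sum>\<alpha>\<in>B. (cmod (\<xi> \<alpha>))\<^sup>2)"
        by (intro sum_mono) (simp add: \<eta>_def)
      also have "\<dots> \<le> (l2_norm (sfibre G u) \<xi>)\<^sup>2"
        using \<xi>(1) B by (intro finite_sum_le_l2_norm) (auto simp: l2_def)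
      also have "\<dots> \<le> 1\<^sup>2" using \<xi>(2) by (intro power_mono) auto
      finally show "(\<Sum>\<alpha>\<in>B. (cmod (\<eta> \<alpha>))\<^sup>2) \<le> 1\<^sup>2" .
    qed simp
    then have le_c: "l2_norm (sfibre G u) (Ind G \<tau> u f \<eta>) \<le> c"
      using le[OF u D, of \<eta>] by (simp add: \<eta>_def)
    have "\<eta> \<in> l2 (sfibre G u)" by (rule l2_finite_support[OF D]) (simp add: \<eta>_def)
    then have summable: "(\<lambda>\<alpha>. (cmod (Ind G \<tau> u f \<eta> \<alpha>))\<^sup>2) summable_on sfibre G u"
      using Ind_bounded[OF f] by meson
    have "Ind G \<tau> u f \<xi> \<alpha> = Ind G \<tau> u f \<eta> \<alpha>" if a: "\<alpha> \<in> A" for \<alpha>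
    proof -
      have "\<alpha> \<in> sfibre G u" using a A by auto
      note Ind_eq_sum[OF f this]
      moreover have "\<eta> (gmul G (ginv G \<beta>) \<alpha>) = \<xi> (gmul G (ginv G \<beta>) \<alpha>)" if "\<beta> \<in> ?R \<alpha>" for \<beta>
        using that a by (auto simp: \<eta>_def D_def)
      ultimately show ?thesis by (auto intro!: sum.cong)
    qed
    then have "(\<Sum>\<alpha>\<in>A. (cmod (Ind G \<tau> u f \<xi> \<alpha>))\<^sup>2) = (\<Sum>\<alpha>\<in>A. (cmod (Ind G \<tau> u f \<eta> \<alpha>))\<^sup>2)" by simp
    also have "\<dots> \<le> (l2_norm (sfibre G u) (Ind G \<tau> u f \<eta>))\<^sup>2"
      by (rule finite_sum_le_l2_norm[OF summable A])
    also have "\<dots> \<le> c\<^sup>2" using le_c by (intro power_mono) auto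
    finally show "(\<Sum>\<alpha>\<in>A. (cmod (Ind G \<tau> u f \<xi> \<alpha>))\<^sup>2) \<le> c\<^sup>2" .
  qed
  then show ?thesis
    unfolding reduced_norm_def operator_norm_def by (auto intro!: sup0_least c)
qed

end


section \<open>The circle extension\<close>

lemma inverse_eq_cnj: "cmod x = 1 \<Longrightarrow> inverse x = cnj x"
  using complex_div_cnj[of 1 x] by (simp add: inverse_eq_divide)

lemma space_circle_haar: "space circle_haar = circle"
  by (simp add: circle_haar_def space_restrict_space)

lemma emeasure_circle_haar: "emeasure circle_haar circle = 1"
proof -
  have "(\<lambda>t. cis (2 * pi * t)) \<in> borel_measurable borel"
    by (intro borel_measurable_continuous_onI continuous_intros)
  then have "(\<lambda>t. cis (2 * pi * t)) \<in> measurable (uniform_measure lborel {0..1}) (restrict_space borel circle)"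
    by (intro measurable_restrict_space2) auto
  moreover have "circle \<in> sets (restrict_space borel circle)"
    using sets.top[of "restrict_space borel circle"] by (simp add: space_restrict_space)
  ultimately have "emeasure circle_haar circle = emeasure (uniform_measure lborel {0..1::real})
      ((\<lambda>t. cis (2 * pi * t)) -` circle \<inter> space (uniform_measure lborel {0..1}))"
    unfolding circle_haar_def by (rule emeasure_distr)
  also have "(\<lambda>t. cis (2 * pi * t)) -` circle \<inter> space (uniform_measure lborel {0..1}) = UNIV" by auto
  finally show ?thesis by simp
qed

text \<open>Countability of \<open>R\<close> makes the counting measure \<open>\<sigma>\<close>-finite, so that the slice over each point
  of \<open>R\<close> has the total mass \<open>1\<close> of the circle.\<close>

lemma integral_circle_haar_count_space:
  fixes k :: "'g \<Rightarrow> complex"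
  assumes R: "countable R" and F: "finite F" "F \<subseteq> R" "\<And>\<beta>. \<beta> \<in> R \<Longrightarrow> \<beta> \<notin> F \<Longrightarrow> k \<beta> = 0"
  shows "(LINT \<eta>|(circle_haar \<Otimes>\<^sub>M count_space R). k (snd \<eta>)) = (\<Sum>\<beta>\<in>F. k \<beta>)"
proof -
  let ?M = "circle_haar \<Otimes>\<^sub>M count_space R"
  interpret sigma_finite_measure "count_space R" using R by (rule sigma_finite_measure_count_space_countable)
  have circ: "circle \<in> sets circle_haar"
    using sets.top[of circle_haar] by (simp add: space_circle_haar)
  have em: "emeasure ?M (circle \<times> {\<beta>}) = 1" if "\<beta> \<in> F" for \<beta>
    using emeasure_pair_measure_Times[OF circ, of "{\<beta>}"] that F(2) emeasure_circle_haar by auto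
  have se: "circle \<times> {\<beta>} \<in> sets ?M" if "\<beta> \<in> F" for \<beta>
    using that F(2) circ by (intro pair_measureI) auto
  have "k (snd \<eta>) = (\<Sum>\<beta>\<in>F. indicator (circle \<times> {\<beta>}) \<eta> *\<^sub>R k \<beta>)" if \<eta>M: "\<eta> \<in> space ?M" for \<eta>
  proof -
    obtain z \<beta> where \<eta>: "\<eta> = (z, \<beta>)" "z \<in> circle" "\<beta> \<in> R"
      using \<eta>M by (cases \<eta>) (auto simp: space_pair_measure space_circle_haar)
    have "(\<Sum>\<gamma>\<in>F. indicator (circle \<times> {\<gamma>}) \<eta> *\<^sub>R k \<gamma>) = (\<Sum>\<gamma>\<in>F. if \<beta> = \<gamma> then k \<gamma> else 0)"
      using \<eta> by (intro sum.cong) (auto simp: indicator_def)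
    then show ?thesis using \<eta> F by auto
  qed
  then have "(LINT \<eta>|?M. k (snd \<eta>)) = (LINT \<eta>|?M. (\<Sum>\<beta>\<in>F. indicator (circle \<times> {\<beta>}) \<eta> *\<^sub>R k \<beta>))"
    by (intro Bochner_Integration.integral_cong) auto
  also have "\<dots> = (\<Sum>\<beta>\<in>F. (LINT \<eta>|?M. indicator (circle \<times> {\<beta>}) \<eta> *\<^sub>R k \<beta>))"
    using em se by (intro Bochner_Integration.integral_sum integrable_scaleR_left integrable_real_indicator) auto
  also have "\<dots> = (\<Sum>\<beta>\<in>F. k \<beta>)"
  proof (rule sum.cong)
    fix \<beta> assume b: "\<beta> \<in> F"
    have "(LINT \<eta>|?M. indicator (circle \<times> {\<beta>}) \<eta> *\<^sub>R k \<beta>) = measure ?M (circle \<times> {\<beta>}) *\<^sub>R k \<beta>"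
      using em[OF b] se[OF b] by simp
    then show "(LINT \<eta>|?M. indicator (circle \<times> {\<beta>}) \<eta> *\<^sub>R k \<beta>) = k \<beta>"
      using em[OF b] by (simp add: measure_def)
  qed simp
  finally show ?thesis .
qed

text \<open>A range fibre is discrete, being met at most once by each bisection; a basic open set inside a
  bisection therefore identifies its point of the fibre.\<close>

lemma (in lch_etale_groupoid) countable_rfibre:
  assumes "second_countable (gtop G)"
  shows "countable (rfibre G u)"
proof -
  obtain \<B> where B: "countable \<B>"
    "\<forall>U x. openin (gtop G) U \<and> x \<in> U \<longrightarrow> (\<exists>V\<in>\<B>. x \<in> V \<and> V \<subseteq> U)"
    using assms unfolding second_countable_def by auto
  have "\<exists>V\<in>\<B>. \<beta> \<in> V \<and> inj_on (rng G) V" if \<beta>: "\<beta> \<in> rfibre G u" for \<beta>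
  proof -
    obtain U where "openin (gtop G) U" "\<beta> \<in> U" "bisection G U"
      using bisection_exists[of \<beta>] \<beta> by (auto simp: rfibre_def)
    moreover from this have "\<exists>V\<in>\<B>. \<beta> \<in> V \<and> V \<subseteq> U" using B(2) by simp
    ultimately show ?thesis unfolding bisection_def by (meson inj_on_subset)
  qed
  then have "\<forall>\<beta>\<in>rfibre G u. \<exists>V. V \<in> \<B> \<and> \<beta> \<in> V \<and> inj_on (rng G) V" by blast
  from bchoice[OF this] obtain V where
    V: "\<forall>\<beta>\<in>rfibre G u. V \<beta> \<in> \<B> \<and> \<beta> \<in> V \<beta> \<and> inj_on (rng G) (V \<beta>)" ..
  have "inj_on V (rfibre G u)"
  proof (rule inj_onI)
    fix x y assume xy: "x \<in> rfibre G u" "y \<in> rfibre G u" "V x = V y"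
    then have "inj_on (rng G) (V x)" "x \<in> V x" "y \<in> V x" "rng G x = rng G y"
      using V by (auto simp: rfibre_def)
    then show "x = y" by (simp add: inj_on_eq_iff)
  qed
  moreover have "countable (V ` rfibre G u)" using V by (intro countable_subset[OF _ B(1)]) auto
  ultimately show ?thesis by (rule countable_image_inj_on[rotated])
qed

lemma continuous_normalised_cocycle_cnj:
  assumes "continuous_normalised_cocycle G \<sigma>"
  shows "continuous_normalised_cocycle G (conj_cocycle \<sigma>)"
  unfolding continuous_normalised_cocycle_def
proof (intro conjI allI impI ballI)
  have "continuous_map (composable_top G) euclidean (\<lambda>p. cnj ((\<lambda>(\<alpha>, \<beta>). \<sigma> \<alpha> \<beta>) p))"
    using assms by (intro continuous_map_cnj)
      (simp add: continuous_normalised_cocycle_def continuous_map_in_subtopology)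
  then show "continuous_map (composable_top G) (top_of_set circle) (\<lambda>(\<alpha>, \<beta>). cnj (\<sigma> \<alpha> \<beta>))"
    using assms by (auto simp: continuous_normalised_cocycle_def continuous_map_in_subtopology split_def Pi_iff)
qed (use assms in \<open>auto simp: continuous_normalised_cocycle_def simp flip: complex_cnj_mult\<close>)

locale twisted_extension = lch_etale_groupoid +
  fixes \<sigma> :: "'a \<Rightarrow> 'a \<Rightarrow> complex"
  assumes extension_cocycle: "continuous_normalised_cocycle G \<sigma>"
    and second_countable_arrows: "second_countable (gtop G)"
begin

sublocale twisted_groupoid G "conj_cocycle \<sigma>"
  by unfold_locales (rule continuous_normalised_cocycle_cnj[OF extension_cocycle])

abbreviation E where "E \<equiv> extension G \<sigma>"

lemma arrows_extension: "arrows E = circle \<times> arrows G"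
  by (simp add: arrows_def extension_def)

lemma norm_\<sigma>: "(\<alpha>, \<beta>) \<in> composable G \<Longrightarrow> cmod (\<sigma> \<alpha> \<beta>) = 1"
  using norm_cocycle by simp

text \<open>The inverse of \<open>rho\<close>.\<close>

definition equivariant_extension :: "('a \<Rightarrow> complex) \<Rightarrow> complex \<times> 'a \<Rightarrow> complex" where
  "equivariant_extension h = (\<lambda>(z, \<alpha>). if z \<in> circle then z * h \<alpha> else 0)"

lemma Cc_equivariant_apply:
  assumes "f \<in> Cc_equivariant G \<sigma>" "z \<in> circle" "\<alpha> \<in> arrows G"
  shows "f (z, \<alpha>) = z * rho f \<alpha>"
proof -
  have "(1, \<alpha>) \<in> arrows E" using assms(3) by (simp add: arrows_extension)
  then have "f (circle_act z (1, \<alpha>)) = z * f (1, \<alpha>)"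
    using assms by (simp add: Cc_equivariant_def del: mem_sphere)
  then show ?thesis by (simp add: circle_act_def rho_def)
qed

lemma Cc_equivariant_outside: "f \<in> Cc_equivariant G \<sigma> \<Longrightarrow> \<gamma> \<notin> arrows E \<Longrightarrow> f \<gamma> = 0"
  using Cc_outside by (auto simp: Cc_equivariant_def arrows_def)

lemma equivariant_extension_rho:
  assumes "f \<in> Cc_equivariant G \<sigma>"
  shows "equivariant_extension (rho f) = f"
proof
  fix \<gamma> :: "complex \<times> 'a"
  obtain z \<alpha> where \<gamma>: "\<gamma> = (z, \<alpha>)" by force
  have "rho f \<alpha> = 0" if "\<alpha> \<notin> arrows G"
    unfolding rho_def using that by (intro Cc_equivariant_outside[OF assms]) (simp add: arrows_extension)
  moreover have "f \<gamma> = 0" if "\<not> (z \<in> circle \<and> \<alpha> \<in> arrows G)"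
    using that by (intro Cc_equivariant_outside[OF assms]) (auto simp: arrows_extension \<gamma>)
  moreover have "f \<gamma> = z * rho f \<alpha>" if "z \<in> circle" "\<alpha> \<in> arrows G"
    unfolding \<gamma> using assms that by (rule Cc_equivariant_apply)
  ultimately show "equivariant_extension (rho f) \<gamma> = f \<gamma>"
    by (cases "z \<in> circle"; cases "\<alpha> \<in> arrows G") (auto simp: equivariant_extension_def \<gamma>)
qed

lemma rho_equivariant_extension: "rho (equivariant_extension h) = h"
  by (auto simp: rho_def equivariant_extension_def)

lemma hausdorff_extension: "Hausdorff_space (gtop E)"
  using hausdorff by (simp add: extension_def Hausdorff_space_prod_topology Hausdorff_space_subtopology)

lemma equivariant_extension_Cc:
  assumes h: "h \<in> Cc (gtop G)"
  shows "equivariant_extension h \<in> Cc_equivariant G \<sigma>"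
proof -
  have top: "gtop E = prod_topology (top_of_set circle) (gtop G)" by (simp add: extension_def)
  obtain K where K: "compactin (gtop G) K" "{x. h x \<noteq> 0} \<subseteq> K" using h by (rule Cc_support)
  have "continuous_map (gtop E) euclidean (\<lambda>x. h (snd x))"
    using continuous_map_compose[OF continuous_map_snd Cc_continuous[OF h]] by (simp add: top comp_def)
  moreover have "continuous_map (gtop E) euclidean fst"
    using continuous_map_fst[of "top_of_set circle" "gtop G"] by (simp add: top continuous_map_in_subtopology)
  ultimately have "continuous_map (gtop E) euclidean (\<lambda>x. fst x * h (snd x))"
    by (intro continuous_map_cmult)
  then have "continuous_map (gtop E) euclidean (equivariant_extension h)"
    by (rule continuous_map_eq) (auto simp: top equivariant_extension_def)
  moreover have "compactin (gtop E) (circle \<times> K)"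
    using K(1) by (simp add: top compactin_Times compactin_subtopology)
  moreover have "{x. equivariant_extension h x \<noteq> 0} \<subseteq> circle \<times> K"
    using K(2) by (auto simp: equivariant_extension_def split: if_splits)
  ultimately have "equivariant_extension h \<in> Cc (gtop E)" by (rule CcI[OF hausdorff_extension])
  then show ?thesis
    by (auto simp: Cc_equivariant_def equivariant_extension_def circle_act_def norm_mult arrows_extension)
qed

lemma rho_Cc:
  assumes "f \<in> Cc_equivariant G \<sigma>"
  shows "rho f \<in> Cc (gtop G)"
proof -
  have top: "gtop E = prod_topology (top_of_set circle) (gtop G)" by (simp add: extension_def)
  have f: "f \<in> Cc (gtop E)" using assms by (simp add: Cc_equivariant_def)
  obtain K where K: "compactin (gtop E) K" "{x. f x \<noteq> 0} \<subseteq> K" using f by (rule Cc_support)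
  have "continuous_map (gtop G) (gtop E) (\<lambda>\<alpha>. (1, \<alpha>))"
    by (simp add: top continuous_map_pairwise comp_def)
  from continuous_map_compose[OF this Cc_continuous[OF f]]
  have "continuous_map (gtop G) euclidean (rho f)" by (simp add: rho_def[abs_def] comp_def)
  moreover have "compactin (gtop G) (snd ` K)"
    using image_compactin[OF K(1)[unfolded top] continuous_map_snd] .
  moreover have "{\<alpha>. rho f \<alpha> \<noteq> 0} \<subseteq> snd ` K"
    using K(2) by (force simp: rho_def)
  ultimately show ?thesis by (rule CcI[OF hausdorff])
qed

lemma bij_betw_rho: "bij_betw rho (Cc_equivariant G \<sigma>) (Cc (gtop G))"
  by (rule bij_betwI[where g = equivariant_extension])
     (auto simp: rho_Cc equivariant_extension_Cc equivariant_extension_rho rho_equivariant_extension)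

text \<open>On the extension the integrand of the convolution at \<open>(w, \<alpha>)\<close> does not depend on the circle
  coordinate: the factors \<open>z\<close> and \<open>z\<^sup>-\<^sup>1\<close> cancel. The remaining cocycle values combine, by the cocycle
  identity for \<open>\<beta>, \<beta>\<^sup>-\<^sup>1, \<alpha>\<close>, to the conjugate of \<open>\<sigma>(\<beta>, \<beta>\<^sup>-\<^sup>1\<alpha>)\<close>.\<close>

lemma ext_conv_eq:
  assumes f: "f \<in> Cc_equivariant G \<sigma>" and g: "g \<in> Cc_equivariant G \<sigma>"
  shows "ext_conv G \<sigma> f g = equivariant_extension (twisted_conv G (conj_cocycle \<sigma>) (rho f) (rho g))"
proof
  fix \<gamma> :: "complex \<times> 'a"
  obtain w \<alpha> where \<gamma>: "\<gamma> = (w, \<alpha>)" by force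
  show "ext_conv G \<sigma> f g \<gamma> = equivariant_extension (twisted_conv G (conj_cocycle \<sigma>) (rho f) (rho g)) \<gamma>"
  proof (cases "w \<in> circle \<and> \<alpha> \<in> arrows G")
    case False
    then show ?thesis
      by (auto simp: \<gamma> conv_def equivariant_extension_def arrows_extension twisted_conv_def)
  next
    case True
    then have w: "w \<in> circle" and a: "\<alpha> \<in> arrows G" by auto
    let ?d = "\<lambda>\<beta>. gmul G (ginv G \<beta>) \<alpha>"
    define k where "k \<beta> = w * (rho f \<beta> * rho g (?d \<beta>) * cnj (\<sigma> \<beta> (?d \<beta>)))" for \<beta>
    let ?M = "circle_haar \<Otimes>\<^sub>M count_space (rfibre G (rng G \<alpha>))"
    let ?F = "{\<beta> \<in> rfibre G (rng G \<alpha>). rho f \<beta> \<noteq> 0}"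
    have F: "finite ?F" using Cc_finite_rfibre rho_Cc f by blast
    have integrand: "f \<eta> * g (gmul E (ginv E \<eta>) (w, \<alpha>)) = k (snd \<eta>)" if \<eta>M: "\<eta> \<in> space ?M" for \<eta>
    proof -
      obtain z \<beta> where \<eta>: "\<eta> = (z, \<beta>)" "z \<in> circle" "\<beta> \<in> rfibre G (rng G \<alpha>)"
        using \<eta>M by (cases \<eta>) (auto simp: space_pair_measure space_circle_haar)
      have b: "\<beta> \<in> arrows G" "rng G \<beta> = rng G \<alpha>" using \<eta>(3) by (auto simp: rfibre_def)
      note d = ldiv[OF a \<eta>(3)]
      have bb: "(\<beta>, ginv G \<beta>) \<in> composable G" using b by (simp add: composable_def ginv_closed rng_ginv)
      have n: "cmod (\<sigma> \<beta> (ginv G \<beta>)) = 1" "cmod (\<sigma> (ginv G \<beta>) \<alpha>) = 1" "cmod (\<sigma> \<beta> (?d \<beta>)) = 1" "cmod z = 1" "cmod w = 1"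
        using norm_\<sigma> bb d(1,5) \<eta>(2) w by auto
      have "\<sigma> \<beta> (ginv G \<beta>) * \<sigma> (gmul G \<beta> (ginv G \<beta>)) \<alpha> = \<sigma> (ginv G \<beta>) \<alpha> * \<sigma> \<beta> (?d \<beta>)"
        using extension_cocycle bb d(1) unfolding continuous_normalised_cocycle_def by blast
      moreover have "\<sigma> (rng G \<alpha>) \<alpha> = 1"
        using extension_cocycle a unfolding continuous_normalised_cocycle_def by blast
      ultimately have coc: "\<sigma> \<beta> (ginv G \<beta>) = \<sigma> (ginv G \<beta>) \<alpha> * \<sigma> \<beta> (?d \<beta>)"
        using b by (simp add: gmul_ginv)
      let ?v = "inverse z * inverse (\<sigma> \<beta> (ginv G \<beta>)) * w * \<sigma> (ginv G \<beta>) \<alpha>"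
      have "gmul E (ginv E \<eta>) (w, \<alpha>) = (?v, ?d \<beta>)" by (simp add: extension_def \<eta>)
      moreover have "?v \<in> circle" using n by (simp add: norm_mult norm_inverse)
      ultimately have "f \<eta> * g (gmul E (ginv E \<eta>) (w, \<alpha>)) = z * rho f \<beta> * (?v * rho g (?d \<beta>))"
        using Cc_equivariant_apply[OF f \<eta>(2) b(1)] Cc_equivariant_apply[OF g _ d(2)] \<eta>(1) by simp
      also have "\<dots> = k \<beta>"
      proof -
        have nz: "z \<noteq> 0" "\<sigma> (ginv G \<beta>) \<alpha> \<noteq> 0" "\<sigma> \<beta> (?d \<beta>) \<noteq> 0" using n by auto
        show ?thesis unfolding k_def coc inverse_eq_cnj[OF n(3), symmetric] using nz by (simp add: field_simps)
      qed
      finally show ?thesis using \<eta>(1) by simp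
    qed
    have "ext_conv G \<sigma> f g \<gamma> = (LINT \<eta>|?M. f \<eta> * g (gmul E (ginv E \<eta>) (w, \<alpha>)))"
      using w a by (simp add: \<gamma> conv_def arrows_extension extension_haar_def) (simp add: extension_def)
    also have "\<dots> = (LINT \<eta>|?M. k (snd \<eta>))"
      by (intro Bochner_Integration.integral_cong refl integrand)
    also have "\<dots> = (\<Sum>\<beta>\<in>?F. k \<beta>)"
      using F by (intro integral_circle_haar_count_space countable_rfibre second_countable_arrows)
        (auto simp: k_def)
    also have "\<dots> = w * twisted_conv G (conj_cocycle \<sigma>) (rho f) (rho g) \<alpha>"
      using twisted_conv_eq_sum[OF a F, of "rho f"] by (simp add: k_def sum_distrib_left)
    finally show ?thesis using w by (simp add: \<gamma> equivariant_extension_def)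
  qed
qed

lemma involution_eq:
  assumes f: "f \<in> Cc_equivariant G \<sigma>"
  shows "involution E f = equivariant_extension (twisted_star G (conj_cocycle \<sigma>) (rho f))"
proof
  fix \<gamma> :: "complex \<times> 'a"
  obtain w \<alpha> where \<gamma>: "\<gamma> = (w, \<alpha>)" by force
  show "involution E f \<gamma> = equivariant_extension (twisted_star G (conj_cocycle \<sigma>) (rho f)) \<gamma>"
  proof (cases "w \<in> circle \<and> \<alpha> \<in> arrows G")
    case False
    then show ?thesis
      by (auto simp: \<gamma> involution_def equivariant_extension_def arrows_extension twisted_star_def)
  next
    case True
    then have w: "cmod w = 1" and a: "\<alpha> \<in> arrows G" by auto
    have s: "cmod (\<sigma> \<alpha> (ginv G \<alpha>)) = 1"
      using a by (intro norm_\<sigma>) (simp add: composable_def ginv_closed rng_ginv)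
    let ?v = "inverse w * inverse (\<sigma> \<alpha> (ginv G \<alpha>))"
    have "ginv E \<gamma> = (?v, ginv G \<alpha>)" by (simp add: \<gamma> extension_def)
    moreover have "?v \<in> circle" using w s by (simp add: norm_mult norm_inverse)
    ultimately have "f (ginv E \<gamma>) = ?v * rho f (ginv G \<alpha>)"
      using Cc_equivariant_apply[OF f] ginv_closed[OF a] by simp
    then show ?thesis
      using w a by (simp add: \<gamma> involution_def arrows_extension equivariant_extension_def twisted_star_def
          inverse_eq_cnj[OF w] inverse_eq_cnj[OF s])
  qed
qed

text \<open>At a unit the cocycle values in the convolution and in the involution cancel; inversion turns
  the sum over the range fibre into one over the source fibre.\<close>

lemma equivariant_inn_eq:
  assumes f: "f \<in> Cc_equivariant G \<sigma>" and g: "g \<in> Cc_equivariant G \<sigma>" and u: "u \<in> units G"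
  shows "equivariant_inn G \<sigma> f g u = fibre_inn (rho f) (rho g) u"
proof -
  let ?fs = "twisted_star G (conj_cocycle \<sigma>) (rho f)"
  have "equivariant_extension ?fs \<in> Cc_equivariant G \<sigma>"
    by (intro equivariant_extension_Cc twisted_star_Cc rho_Cc f)
  from ext_conv_eq[OF this g]
  have "ext_conv G \<sigma> (involution E f) g (1, u) = twisted_conv G (conj_cocycle \<sigma>) ?fs (rho g) u"
    unfolding involution_eq[OF f] rho_equivariant_extension by (simp add: equivariant_extension_def)
  then have "equivariant_inn G \<sigma> f g u = twisted_conv G (conj_cocycle \<sigma>) ?fs (rho g) u"
    using u by (simp add: equivariant_inn_def)
  also have "\<dots> = (\<Sum>\<^sub>\<infinity>\<beta>\<in>rfibre G u. cnj (rho f (ginv G \<beta>)) * rho g (ginv G \<beta>))"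
    unfolding twisted_conv_def using units_arrows[OF u] rng_unit[OF u]
  proof (simp, intro infsum_cong)
    fix \<beta> assume "\<beta> \<in> rfibre G u"
    then have b: "\<beta> \<in> arrows G" "rng G \<beta> = u" by (auto simp: rfibre_def)
    then have d: "gmul G (ginv G \<beta>) u = ginv G \<beta>" using gmul_src_id ginv_closed src_ginv by metis
    have "cmod (\<sigma> \<beta> (ginv G \<beta>)) = 1"
      using b by (intro norm_\<sigma>) (simp add: composable_def ginv_closed rng_ginv)
    then have "\<sigma> \<beta> (ginv G \<beta>) * cnj (\<sigma> \<beta> (ginv G \<beta>)) = 1"
      by (metis complex_norm_square of_real_1 power_one)
    then show "?fs \<beta> * rho g (gmul G (ginv G \<beta>) u) * cnj (\<sigma> \<beta> (gmul G (ginv G \<beta>) u))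
        = cnj (rho f (ginv G \<beta>)) * rho g (ginv G \<beta>)"
      using b by (simp add: d twisted_star_def mult.assoc mult.left_commute[of "\<sigma> \<beta> (ginv G \<beta>)"])
  qed
  also have "\<dots> = fibre_inn (rho f) (rho g) u"
    unfolding fibre_inn_def by (rule infsum_reindex_bij_betw[OF bij_betw_ginv_fibre[OF u]])
  finally show ?thesis .
qed

end


section \<open>The Hilbert module of the extension\<close>

context twisted_extension
begin

abbreviation V where "V \<equiv> equivariant_module G \<sigma>"

abbreviation fibre_norm :: "'a \<Rightarrow> (complex \<times> 'a \<Rightarrow> complex) \<Rightarrow> real" where
  "fibre_norm u f \<equiv> l2_norm (sfibre G u) (rho f)"

lemma carr_V: "carr V = Cc_equivariant G \<sigma>"
  by (simp add: equivariant_module_def)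

lemma sub_V: "sub V f g = (\<lambda>\<gamma>. f \<gamma> + (- 1) * g \<gamma>)"
  by (simp add: sub_def equivariant_module_def)

lemma equivariant_add:
  assumes "f \<in> Cc_equivariant G \<sigma>" "g \<in> Cc_equivariant G \<sigma>"
  shows "(\<lambda>\<gamma>. f \<gamma> + g \<gamma>) \<in> Cc_equivariant G \<sigma>"
  using assms Cc_add[OF hausdorff_extension] by (simp add: Cc_equivariant_def distrib_left)

lemma equivariant_scale:
  assumes "f \<in> Cc_equivariant G \<sigma>"
  shows "(\<lambda>\<gamma>. c * f \<gamma>) \<in> Cc_equivariant G \<sigma>"
  using assms Cc_scale[OF hausdorff_extension] by (simp add: Cc_equivariant_def mult.left_commute)

lemma sub_equivariant:
  assumes "f \<in> Cc_equivariant G \<sigma>" "g \<in> Cc_equivariant G \<sigma>"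
  shows "sub V f g \<in> Cc_equivariant G \<sigma>"
  unfolding sub_V by (intro equivariant_add equivariant_scale assms)

lemma rho_sub: "rho (sub V f g) = (\<lambda>\<alpha>. rho f \<alpha> - rho g \<alpha>)"
  by (auto simp: sub_V rho_def)

lemma ext_conv_equivariant:
  assumes "f \<in> Cc_equivariant G \<sigma>" "g \<in> Cc_equivariant G \<sigma>"
  shows "ext_conv G \<sigma> f g \<in> Cc_equivariant G \<sigma>"
  unfolding ext_conv_eq[OF assms] by (intro equivariant_extension_Cc twisted_conv_Cc rho_Cc assms)

lemma rho_ext_conv:
  assumes "f \<in> Cc_equivariant G \<sigma>" "g \<in> Cc_equivariant G \<sigma>"
  shows "rho (ext_conv G \<sigma> f g) = twisted_conv G (conj_cocycle \<sigma>) (rho f) (rho g)"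
  by (simp add: ext_conv_eq[OF assms] rho_equivariant_extension)

lemma equivariant_inn_self:
  assumes "f \<in> Cc_equivariant G \<sigma>" "u \<in> units G"
  shows "equivariant_inn G \<sigma> f f u = complex_of_real ((fibre_norm u f)\<^sup>2)"
  using assms equivariant_inn_eq fibre_inn_self rho_Cc by simp

text \<open>The module norm is the supremum over the units of the norms of the restrictions to
  source fibres, so estimates can be made one fibre at a time.\<close>

lemma nrm_V: "f \<in> Cc_equivariant G \<sigma> \<Longrightarrow> nrm V f = sqrt (sup0 {(fibre_norm u f)\<^sup>2 | u. u \<in> units G})"
proof -
  assume f: "f \<in> Cc_equivariant G \<sigma>"
  have "{cmod (equivariant_inn G \<sigma> f f u) | u. u \<in> topspace (unit_top G)} = {(fibre_norm u f)\<^sup>2 | u. u \<in> units G}"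
    unfolding units_topspace using equivariant_inn_self[OF f] by (force simp: norm_power)
  then show ?thesis by (simp add: equivariant_module_def inn_norm_def)
qed

lemma fibre_norm_le_nrm:
  assumes f: "f \<in> Cc_equivariant G \<sigma>" and u: "u \<in> units G"
  shows "fibre_norm u f \<le> nrm V f"
proof -
  obtain C where C: "\<And>u. fibre_norm u f \<le> C" using Cc_l2_norm_bounded[OF rho_Cc[OF f]] by auto
  have "bdd_above {(fibre_norm u f)\<^sup>2 | u. u \<in> units G}"
    by (rule bdd_aboveI[of _ "C\<^sup>2"]) (auto intro!: power_mono C)
  then have "(fibre_norm u f)\<^sup>2 \<le> sup0 {(fibre_norm u f)\<^sup>2 | u. u \<in> units G}"
    using u by (intro sup0_upper) auto
  then show ?thesis unfolding nrm_V[OF f] by (rule real_le_rsqrt)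
qed

lemma nrm_leI:
  assumes "f \<in> Cc_equivariant G \<sigma>" "0 \<le> c" "\<And>u. u \<in> units G \<Longrightarrow> fibre_norm u f \<le> c"
  shows "nrm V f \<le> c"
proof -
  have "sup0 {(fibre_norm u f)\<^sup>2 | u. u \<in> units G} \<le> c\<^sup>2"
    using assms(2,3) by (intro sup0_least) (auto intro!: power_mono)
  then show ?thesis unfolding nrm_V[OF assms(1)] using assms(2) by (intro real_le_lsqrt)
qed

lemma nrm_V_nonneg:
  assumes f: "f \<in> Cc_equivariant G \<sigma>"
  shows "0 \<le> nrm V f"
proof (cases "units G = {}")
  case True
  then show ?thesis unfolding nrm_V[OF f] by (simp add: sup0_def)
next
  case False
  then show ?thesis using fibre_norm_le_nrm[OF f] l2_norm_nonneg order_trans by blast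
qed

lemma fibre_norm_sub_commute: "fibre_norm u (sub V f g) = fibre_norm u (sub V g f)"
  unfolding rho_sub using l2_norm_scale[of "sfibre G u" "-1" "\<lambda>\<alpha>. rho g \<alpha> - rho f \<alpha>"] by simp

lemma fibre_norm_triangle:
  assumes "f \<in> Cc_equivariant G \<sigma>" "g \<in> Cc_equivariant G \<sigma>"
  shows "\<bar>fibre_norm u f - fibre_norm u g\<bar> \<le> fibre_norm u (sub V f g)"
proof -
  have le: "fibre_norm u f \<le> fibre_norm u (sub V f g) + fibre_norm u g"
    if "f \<in> Cc_equivariant G \<sigma>" "g \<in> Cc_equivariant G \<sigma>" for f g
    using Cc_l2_norm_add[OF rho_Cc[OF sub_equivariant[OF that]] rho_Cc[OF that(2)], of u]
    by (simp add: rho_sub)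
  show ?thesis using le[OF assms] le[OF assms(2,1)] fibre_norm_sub_commute[of u f g] by linarith
qed

lemma nrm_sub_commute:
  assumes "f \<in> Cc_equivariant G \<sigma>" "g \<in> Cc_equivariant G \<sigma>"
  shows "nrm V (sub V f g) = nrm V (sub V g f)"
  using assms by (simp add: nrm_V sub_equivariant fibre_norm_sub_commute[of _ f g])

lemma nrm_sub_triangle:
  assumes f: "f \<in> Cc_equivariant G \<sigma>" and g: "g \<in> Cc_equivariant G \<sigma>" and h: "h \<in> Cc_equivariant G \<sigma>"
  shows "nrm V (sub V f h) \<le> nrm V (sub V f g) + nrm V (sub V g h)"
proof (rule nrm_leI)
  fix u assume u: "u \<in> units G"
  have "fibre_norm u (sub V f h) \<le> fibre_norm u (sub V f g) + fibre_norm u (sub V g h)"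
    using Cc_l2_norm_add[OF rho_Cc[OF sub_equivariant[OF f g]] rho_Cc[OF sub_equivariant[OF g h]], of u]
    by (simp add: rho_sub)
  also have "\<dots> \<le> nrm V (sub V f g) + nrm V (sub V g h)"
    using f g h u by (intro add_mono fibre_norm_le_nrm sub_equivariant)
  finally show "fibre_norm u (sub V f h) \<le> nrm V (sub V f g) + nrm V (sub V g h)" .
qed (use f g h in \<open>auto simp: sub_equivariant nrm_V_nonneg\<close>)

lemma nrm_sub_self: "f \<in> Cc_equivariant G \<sigma> \<Longrightarrow> nrm V (sub V f f) = 0"
proof -
  assume f: "f \<in> Cc_equivariant G \<sigma>"
  have "nrm V (sub V f f) \<le> 0"
    using f by (intro nrm_leI sub_equivariant) (auto simp: rho_sub l2_norm_def)
  then show ?thesis using nrm_V_nonneg[OF sub_equivariant[OF f f]] by simp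
qed

lemma cauchy_V: "x \<in> cauchy_seqs V \<Longrightarrow> x n \<in> Cc_equivariant G \<sigma>"
  by (auto simp: cauchy_seqs_def carr_V)

lemma null_rel_refl: "x \<in> cauchy_seqs V \<Longrightarrow> (x, x) \<in> null_rel V"
  by (simp add: null_rel_def nrm_sub_self cauchy_V)

lemma null_rel_sym: "(x, y) \<in> null_rel V \<Longrightarrow> (y, x) \<in> null_rel V"
  by (simp add: null_rel_def nrm_sub_commute cauchy_V)

lemma null_rel_trans:
  assumes "(x, y) \<in> null_rel V" "(y, z) \<in> null_rel V"
  shows "(x, z) \<in> null_rel V"
proof -
  have c: "x \<in> cauchy_seqs V" "y \<in> cauchy_seqs V" "z \<in> cauchy_seqs V"
    and l: "(\<lambda>n. nrm V (sub V (x n) (y n))) \<longlonglongrightarrow> 0" "(\<lambda>n. nrm V (sub V (y n) (z n))) \<longlonglongrightarrow> 0"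
    using assms by (auto simp: null_rel_def)
  have cE: "x n \<in> Cc_equivariant G \<sigma>" "y n \<in> Cc_equivariant G \<sigma>" "z n \<in> Cc_equivariant G \<sigma>" for n
    using c by (auto intro: cauchy_V)
  have "(\<lambda>n. nrm V (sub V (x n) (z n))) \<longlonglongrightarrow> 0"
  proof (rule tendsto_sandwich[OF _ _ tendsto_const])
    show "(\<lambda>n. nrm V (sub V (x n) (y n)) + nrm V (sub V (y n) (z n))) \<longlonglongrightarrow> 0"
      using tendsto_add[OF l] by simp
  qed (auto intro!: always_eventually nrm_V_nonneg nrm_sub_triangle sub_equivariant cE)
  then show ?thesis using c by (simp add: null_rel_def)
qed

lemma cls_eq: "(x, y) \<in> null_rel V \<Longrightarrow> cls V x = cls V y"
  unfolding cls_def using null_rel_sym null_rel_trans by blast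

lemma carr_Hmod: "carr (Hmod G \<sigma>) = cls V ` cauchy_seqs V"
  by (auto simp: Hmod_def module_completion_def quotient_def cls_def)

lemma fibre_norm_diff_limit:
  assumes "(x, y) \<in> null_rel V" "u \<in> units G"
  shows "(\<lambda>n. fibre_norm u (sub V (x n) (y n))) \<longlonglongrightarrow> 0"
proof (rule tendsto_sandwich[OF _ _ tendsto_const])
  show "(\<lambda>n. nrm V (sub V (x n) (y n))) \<longlonglongrightarrow> 0" using assms by (simp add: null_rel_def)
  have "x n \<in> Cc_equivariant G \<sigma>" "y n \<in> Cc_equivariant G \<sigma>" for n
    using assms cauchy_V by (auto simp: null_rel_def)
  then show "\<forall>\<^sub>F n in sequentially. fibre_norm u (sub V (x n) (y n)) \<le> nrm V (sub V (x n) (y n))"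
    using assms by (intro always_eventually allI fibre_norm_le_nrm sub_equivariant)
qed auto

lemma fibre_norm_limit_cong:
  assumes "(x, y) \<in> null_rel V" "u \<in> units G" "(\<lambda>n. fibre_norm u (x n)) \<longlonglongrightarrow> l"
  shows "(\<lambda>n. fibre_norm u (y n)) \<longlonglongrightarrow> l"
proof -
  have "x n \<in> Cc_equivariant G \<sigma>" "y n \<in> Cc_equivariant G \<sigma>" for n
    using assms cauchy_V by (auto simp: null_rel_def)
  then have "\<bar>fibre_norm u (x n) - fibre_norm u (y n)\<bar> \<le> fibre_norm u (sub V (x n) (y n))" for n
    by (rule fibre_norm_triangle)
  then have "(\<lambda>n. fibre_norm u (x n) - fibre_norm u (y n)) \<longlonglongrightarrow> 0"
    by (intro Lim_null_comparison[OF _ fibre_norm_diff_limit[OF assms(1,2)]]) auto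
  from tendsto_diff[OF assms(3) this] show ?thesis by simp
qed

lemma fibre_norm_convergent:
  assumes x: "x \<in> cauchy_seqs V" and u: "u \<in> units G"
  obtains l where "(\<lambda>n. fibre_norm u (x n)) \<longlonglongrightarrow> l"
proof -
  have "Cauchy (\<lambda>n. fibre_norm u (x n))"
  proof (rule metric_CauchyI)
    fix e :: real assume "0 < e"
    then obtain M where M: "\<forall>m\<ge>M. \<forall>n\<ge>M. nrm V (sub V (x m) (x n)) < e"
      using x by (auto simp: cauchy_seqs_def)
    have "dist (fibre_norm u (x m)) (fibre_norm u (x n)) < e" if "m \<ge> M" "n \<ge> M" for m n
    proof -
      have "dist (fibre_norm u (x m)) (fibre_norm u (x n)) \<le> fibre_norm u (sub V (x m) (x n))"
        unfolding dist_real_def using x by (intro fibre_norm_triangle cauchy_V)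
      also have "\<dots> \<le> nrm V (sub V (x m) (x n))"
        using x u by (intro fibre_norm_le_nrm sub_equivariant cauchy_V)
      also have "\<dots> < e" using M that by blast
      finally show ?thesis .
    qed
    then show "\<exists>M. \<forall>m\<ge>M. \<forall>n\<ge>M. dist (fibre_norm u (x m)) (fibre_norm u (x n)) < e" by blast
  qed
  then show ?thesis using that real_Cauchy_convergent convergent_def by blast
qed

text \<open>By Cauchy-Schwarz on the fibre, exchanging representatives changes the inner products by a null
  sequence, so the limit is the same for all pairs of representatives.\<close>

lemma lift_inn_self:
  assumes x: "x \<in> cauchy_seqs V" and u: "u \<in> units G" and l: "(\<lambda>n. fibre_norm u (x n)) \<longlonglongrightarrow> l"
  shows "lift_inn V (cls V x) (cls V x) u = complex_of_real (l\<^sup>2)"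
proof -
  have lim: "(\<lambda>n. inn V (y n) (z n) u) \<longlonglongrightarrow> complex_of_real (l\<^sup>2)"
    if y: "y \<in> cls V x" and z: "z \<in> cls V x" for y z
  proof -
    have xy: "(x, y) \<in> null_rel V" and xz: "(x, z) \<in> null_rel V" using y z by (auto simp: cls_def)
    then have zy: "(z, y) \<in> null_rel V" using null_rel_sym null_rel_trans by blast
    have c: "y n \<in> Cc_equivariant G \<sigma>" "z n \<in> Cc_equivariant G \<sigma>" for n
      using zy cauchy_V by (auto simp: null_rel_def)
    have ly: "(\<lambda>n. fibre_norm u (y n)) \<longlonglongrightarrow> l" using xy u l by (rule fibre_norm_limit_cong)
    have diff: "(\<lambda>n. inn V (y n) (z n) u - inn V (y n) (y n) u) \<longlonglongrightarrow> 0"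
    proof (rule Lim_null_comparison)
      show "(\<lambda>n. fibre_norm u (y n) * fibre_norm u (sub V (z n) (y n))) \<longlonglongrightarrow> 0"
        using tendsto_mult[OF ly fibre_norm_diff_limit[OF zy u]] by simp
      have "cmod (inn V (y n) (z n) u - inn V (y n) (y n) u) \<le> fibre_norm u (y n) * fibre_norm u (sub V (z n) (y n))" for n
      proof -
        have "inn V (y n) (z n) u - inn V (y n) (y n) u = fibre_inn (rho (y n)) (rho (sub V (z n) (y n))) u"
          using c u by (simp add: equivariant_module_def equivariant_inn_eq fibre_inn_diff_right rho_Cc)
            (simp add: rho_sub flip: equivariant_module_def)
        then show ?thesis using c by (simp add: fibre_inn_Cauchy_Schwarz rho_Cc sub_equivariant)
      qed
      then show "\<forall>\<^sub>F n in sequentially. norm (inn V (y n) (z n) u - inn V (y n) (y n) u)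
          \<le> fibre_norm u (y n) * fibre_norm u (sub V (z n) (y n))" by simp
    qed
    have "inn V (y n) (y n) u = complex_of_real ((fibre_norm u (y n))\<^sup>2)" for n
      using c u equivariant_inn_self by (simp add: equivariant_module_def)
    then have "(\<lambda>n. inn V (y n) (y n) u) \<longlonglongrightarrow> complex_of_real (l\<^sup>2)"
      using ly by (auto intro!: tendsto_intros)
    from tendsto_add[OF diff this] show ?thesis by simp
  qed
  have x': "x \<in> cls V x" using null_rel_refl[OF x] by (simp add: cls_def)
  show ?thesis
    unfolding lift_inn_def
  proof (rule the_equality)
    fix l' assume "\<forall>y\<in>cls V x. \<forall>z\<in>cls V x. (\<lambda>n. inn V (y n) (z n) u) \<longlonglongrightarrow> l'"
    then show "l' = complex_of_real (l\<^sup>2)" using lim[OF x' x'] x' LIMSEQ_unique by blast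
  qed (use lim in blast)
qed

lemma nrm_Hmod:
  "nrm (Hmod G \<sigma>) X = sqrt (sup0 {cmod (lift_inn V X X u) | u. u \<in> units G})"
proof -
  have "topspace (base V) = units G" by (simp add: equivariant_module_def units_topspace)
  then show ?thesis by (simp add: Hmod_def module_completion_def inn_norm_def)
qed

lemma nrm_Hmod_leI:
  assumes x: "x \<in> cauchy_seqs V" and c: "0 \<le> c"
    and le: "\<And>u l. u \<in> units G \<Longrightarrow> (\<lambda>n. fibre_norm u (x n)) \<longlonglongrightarrow> l \<Longrightarrow> l \<le> c"
  shows "nrm (Hmod G \<sigma>) (cls V x) \<le> c"
proof -
  have "cmod (lift_inn V (cls V x) (cls V x) u) \<le> c\<^sup>2" if u: "u \<in> units G" for u
  proof -
    obtain l where l: "(\<lambda>n. fibre_norm u (x n)) \<longlonglongrightarrow> l" using x u by (rule fibre_norm_convergent)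
    then have "0 \<le> l" using LIMSEQ_le_const by (metis l2_norm_nonneg)
    then show ?thesis using le[OF u l] by (simp add: lift_inn_self[OF x u l] norm_power power_mono)
  qed
  then have "sup0 {cmod (lift_inn V (cls V x) (cls V x) u) | u. u \<in> units G} \<le> c\<^sup>2"
    by (intro sup0_least) auto
  then show ?thesis unfolding nrm_Hmod using c by (intro real_le_lsqrt)
qed

text \<open>A Cauchy sequence is bounded in the module norm, hence its fibre norms are bounded
  uniformly in the unit; so the supremum defining the norm is an upper bound.\<close>

lemma limit_le_nrm_Hmod:
  assumes x: "x \<in> cauchy_seqs V" and u: "u \<in> units G" and l: "(\<lambda>n. fibre_norm u (x n)) \<longlonglongrightarrow> l"
  shows "l \<le> nrm (Hmod G \<sigma>) (cls V x)"
proof -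
  have "\<exists>M. \<forall>m\<ge>M. \<forall>n\<ge>M. nrm V (sub V (x m) (x n)) < 1" using x by (simp add: cauchy_seqs_def)
  then obtain M where M: "\<forall>m\<ge>M. \<forall>n\<ge>M. nrm V (sub V (x m) (x n)) < 1" by blast
  let ?C = "nrm V (x M) + 1"
  have "cmod (lift_inn V (cls V x) (cls V x) v) \<le> ?C\<^sup>2" if v: "v \<in> units G" for v
  proof -
    obtain k where k: "(\<lambda>n. fibre_norm v (x n)) \<longlonglongrightarrow> k" using x v by (rule fibre_norm_convergent)
    then have k0: "0 \<le> k" using LIMSEQ_le_const by (metis l2_norm_nonneg)
    have "fibre_norm v (x n) \<le> ?C" if "n \<ge> M" for n
    proof -
      have "fibre_norm v (x n) - fibre_norm v (x M) \<le> fibre_norm v (sub V (x n) (x M))"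
        using fibre_norm_triangle[of "x n" "x M" v] x by (simp add: cauchy_V)
      also have "\<dots> \<le> nrm V (sub V (x n) (x M))"
        using x v by (intro fibre_norm_le_nrm sub_equivariant cauchy_V)
      also have "\<dots> \<le> 1" using M that by (simp add: less_imp_le)
      finally show ?thesis using fibre_norm_le_nrm[OF cauchy_V[OF x] v, of M] by simp
    qed
    then have "k \<le> ?C" using LIMSEQ_le_const2[OF k] by blast
    then show ?thesis using k0 by (simp add: lift_inn_self[OF x v k] norm_power power_mono)
  qed
  then have "bdd_above {cmod (lift_inn V (cls V x) (cls V x) v) | v. v \<in> units G}"
    by (intro bdd_aboveI[of _ "?C\<^sup>2"]) auto
  then have "cmod (lift_inn V (cls V x) (cls V x) u)
      \<le> sup0 {cmod (lift_inn V (cls V x) (cls V x) v) | v. v \<in> units G}"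
    using u by (intro sup0_upper) auto
  then show ?thesis
    unfolding nrm_Hmod by (intro real_le_rsqrt) (simp add: lift_inn_self[OF x u l] norm_power)
qed


section \<open>Comparison of the two norms\<close>

lemma fibre_norm_ext_conv:
  assumes "f \<in> Cc_equivariant G \<sigma>" "g \<in> Cc_equivariant G \<sigma>" "u \<in> units G"
  shows "fibre_norm u (ext_conv G \<sigma> f g) \<le> reduced_norm G (conj_cocycle \<sigma>) (rho f) * fibre_norm u g"
  using assms by (simp add: rho_ext_conv twisted_conv_le_reduced_norm rho_Cc)

lemma nrm_sub_ext_conv:
  assumes f: "f \<in> Cc_equivariant G \<sigma>" and g: "g \<in> Cc_equivariant G \<sigma>" and h: "h \<in> Cc_equivariant G \<sigma>"
  shows "nrm V (sub V (ext_conv G \<sigma> f g) (ext_conv G \<sigma> f h))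
    \<le> reduced_norm G (conj_cocycle \<sigma>) (rho f) * nrm V (sub V g h)"
proof (rule nrm_leI)
  let ?R = "reduced_norm G (conj_cocycle \<sigma>) (rho f)"
  have R: "0 \<le> ?R" using reduced_norm_nonneg rho_Cc f by blast
  fix u assume u: "u \<in> units G"
  have "rho (sub V (ext_conv G \<sigma> f g) (ext_conv G \<sigma> f h)) = rho (ext_conv G \<sigma> f (sub V g h))"
    using f g h twisted_conv_diff_right[OF rho_Cc[OF f]] by (auto simp: rho_sub rho_ext_conv sub_equivariant)
  then have "fibre_norm u (sub V (ext_conv G \<sigma> f g) (ext_conv G \<sigma> f h)) \<le> ?R * fibre_norm u (sub V g h)"
    using fibre_norm_ext_conv[OF f sub_equivariant[OF g h] u] by simp
  also have "\<dots> \<le> ?R * nrm V (sub V g h)"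
    using g h u R by (intro mult_left_mono fibre_norm_le_nrm sub_equivariant)
  finally show "fibre_norm u (sub V (ext_conv G \<sigma> f g) (ext_conv G \<sigma> f h)) \<le> ?R * nrm V (sub V g h)" .
qed (use assms reduced_norm_nonneg[OF rho_Cc[OF f]] in
      \<open>auto simp: sub_equivariant ext_conv_equivariant nrm_V_nonneg\<close>)

lemma ext_conv_cauchy:
  assumes f: "f \<in> Cc_equivariant G \<sigma>" and x: "x \<in> cauchy_seqs V"
  shows "(\<lambda>n. ext_conv G \<sigma> f (x n)) \<in> cauchy_seqs V"
proof -
  let ?R = "reduced_norm G (conj_cocycle \<sigma>) (rho f)"
  have R: "0 \<le> ?R" using reduced_norm_nonneg rho_Cc f by blast
  have "\<exists>M. \<forall>m\<ge>M. \<forall>n\<ge>M. nrm V (sub V (ext_conv G \<sigma> f (x m)) (ext_conv G \<sigma> f (x n))) < e" if e: "e > 0" for e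
  proof -
    have "e / (?R + 1) > 0" using R e by simp
    then have "\<exists>M. \<forall>m\<ge>M. \<forall>n\<ge>M. nrm V (sub V (x m) (x n)) < e / (?R + 1)"
      using x unfolding cauchy_seqs_def by blast
    then obtain M where M: "\<And>m n. m \<ge> M \<Longrightarrow> n \<ge> M \<Longrightarrow> nrm V (sub V (x m) (x n)) < e / (?R + 1)" by blast
    have "nrm V (sub V (ext_conv G \<sigma> f (x m)) (ext_conv G \<sigma> f (x n))) < e" if "m \<ge> M" "n \<ge> M" for m n
    proof -
      have "nrm V (sub V (ext_conv G \<sigma> f (x m)) (ext_conv G \<sigma> f (x n))) \<le> ?R * nrm V (sub V (x m) (x n))"
        by (rule nrm_sub_ext_conv[OF f cauchy_V[OF x] cauchy_V[OF x]])
      also have "\<dots> \<le> ?R * (e / (?R + 1))"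
        using M[OF that] R by (intro mult_left_mono) auto
      also have "\<dots> < e" using R e by (simp add: field_simps)
      finally show ?thesis .
    qed
    then show ?thesis by blast
  qed
  moreover have "range (\<lambda>n. ext_conv G \<sigma> f (x n)) \<subseteq> carr V"
    using ext_conv_equivariant[OF f cauchy_V[OF x]] by (auto simp: carr_V)
  ultimately show ?thesis by (simp add: cauchy_seqs_def)
qed

lemma ext_conv_null_rel:
  assumes f: "f \<in> Cc_equivariant G \<sigma>" and xy: "(x, y) \<in> null_rel V"
  shows "((\<lambda>n. ext_conv G \<sigma> f (x n)), (\<lambda>n. ext_conv G \<sigma> f (y n))) \<in> null_rel V"
proof -
  let ?R = "reduced_norm G (conj_cocycle \<sigma>) (rho f)"
  have c: "x \<in> cauchy_seqs V" "y \<in> cauchy_seqs V" and l: "(\<lambda>n. nrm V (sub V (x n) (y n))) \<longlonglongrightarrow> 0"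
    using xy by (auto simp: null_rel_def)
  have cE: "x n \<in> Cc_equivariant G \<sigma>" "y n \<in> Cc_equivariant G \<sigma>" for n
    using c by (auto intro: cauchy_V)
  have "(\<lambda>n. nrm V (sub V (ext_conv G \<sigma> f (x n)) (ext_conv G \<sigma> f (y n)))) \<longlonglongrightarrow> 0"
  proof (rule tendsto_sandwich[OF _ _ tendsto_const])
    show "(\<lambda>n. ?R * nrm V (sub V (x n) (y n))) \<longlonglongrightarrow> 0" using tendsto_mult_right_zero[OF l] .
  qed (use f in \<open>auto intro!: always_eventually nrm_V_nonneg nrm_sub_ext_conv sub_equivariant ext_conv_equivariant cE\<close>)
  then show ?thesis using f c by (simp add: null_rel_def ext_conv_cauchy)
qed

lemma left_mult_cls:
  assumes f: "f \<in> Cc_equivariant G \<sigma>" and x: "x \<in> cauchy_seqs V"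
  shows "left_mult G \<sigma> f (cls V x) = cls V (\<lambda>n. ext_conv G \<sigma> f (x n))"
proof -
  have "left_mult G \<sigma> f (cls V x) = (\<Union>y\<in>cls V x. cls V (\<lambda>n. ext_conv G \<sigma> f (y n)))"
    using x by (simp add: left_mult_def carr_Hmod lift1_def)
  also have "\<dots> = (\<Union>y\<in>cls V x. cls V (\<lambda>n. ext_conv G \<sigma> f (x n)))"
  proof (rule SUP_cong[OF refl])
    fix y assume "y \<in> cls V x"
    then have "(x, y) \<in> null_rel V" by (simp add: cls_def)
    from cls_eq[OF ext_conv_null_rel[OF f this]]
    show "cls V (\<lambda>n. ext_conv G \<sigma> f (y n)) = cls V (\<lambda>n. ext_conv G \<sigma> f (x n))" by (rule sym)
  qed
  also have "\<dots> = cls V (\<lambda>n. ext_conv G \<sigma> f (x n))"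
    using null_rel_refl[OF x] by (auto simp: cls_def[of V x])
  finally show ?thesis .
qed

text \<open>Left multiplication by \<open>f\<close> acts on the fibre over each unit \<open>u\<close> as the regular representation
  of \<open>rho f\<close> over \<open>u\<close>. Hence its norm is at most the reduced norm; conversely every finitely supported
  vector of norm at most \<open>1\<close> over \<open>u\<close> is the restriction of a section of module norm at most \<open>1\<close>.\<close>

proposition nrm_left_mult:
  assumes f: "f \<in> Cc_equivariant G \<sigma>"
  shows "nrm (adjointable_operators (Hmod G \<sigma>)) (left_mult G \<sigma> f) = reduced_norm G (conj_cocycle \<sigma>) (rho f)"
proof -
  let ?R = "reduced_norm G (conj_cocycle \<sigma>) (rho f)"
  let ?H = "Hmod G \<sigma>"
  let ?A = "{nrm ?H (left_mult G \<sigma> f X) | X. X \<in> carr ?H \<and> nrm ?H X \<le> 1}"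
  have R: "0 \<le> ?R" using reduced_norm_nonneg rho_Cc f by blast
  have le: "nrm ?H (left_mult G \<sigma> f X) \<le> ?R" if X: "X \<in> carr ?H" "nrm ?H X \<le> 1" for X
  proof -
    obtain x where x: "x \<in> cauchy_seqs V" "X = cls V x" using X(1) by (auto simp: carr_Hmod)
    show ?thesis
      unfolding x(2) left_mult_cls[OF f x(1)]
    proof (rule nrm_Hmod_leI[OF ext_conv_cauchy[OF f x(1)] R])
      fix u l assume u: "u \<in> units G" and l: "(\<lambda>n. fibre_norm u (ext_conv G \<sigma> f (x n))) \<longlonglongrightarrow> l"
      obtain k where k: "(\<lambda>n. fibre_norm u (x n)) \<longlonglongrightarrow> k" using x(1) u by (rule fibre_norm_convergent)
      have "l \<le> ?R * k"
        using fibre_norm_ext_conv[OF f cauchy_V[OF x(1)] u]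
        by (intro LIMSEQ_le[OF l tendsto_mult_left[OF k]]) auto
      also have "k \<le> 1" using limit_le_nrm_Hmod[OF x(1) u k] X(2) x(2) by simp
      then have "?R * k \<le> ?R" using R by (simp add: mult_left_le)
      finally show "l \<le> ?R" .
    qed
  qed
  then have bdd: "bdd_above ?A" by (intro bdd_aboveI[of _ ?R]) auto
  have op: "nrm (adjointable_operators ?H) (left_mult G \<sigma> f) = sup0 ?A"
    by (simp add: adjointable_operators_def operator_norm_def)
  have "?R \<le> sup0 ?A"
  proof (rule reduced_norm_leI[OF rho_Cc[OF f] sup0_nonneg[OF bdd]])
    fix u D \<xi>
    assume u: "u \<in> units G" and D: "finite D" "D \<subseteq> sfibre G u" "\<And>\<alpha>. \<alpha> \<notin> D \<Longrightarrow> \<xi> \<alpha> = 0"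
      and \<xi>: "l2_norm (sfibre G u) \<xi> \<le> 1"
    obtain g where g: "g \<in> Cc (gtop G)" "\<And>\<alpha>. \<alpha> \<in> sfibre G u \<Longrightarrow> g \<alpha> = \<xi> \<alpha>"
      "\<And>v. l2_norm (sfibre G v) g \<le> l2_norm (sfibre G u) \<xi>"
      using extend_finite_support[of D u \<xi>, OF D] by metis
    let ?g = "equivariant_extension g"
    let ?x = "\<lambda>n :: nat. ?g"
    have gE: "?g \<in> Cc_equivariant G \<sigma>" using g(1) by (rule equivariant_extension_Cc)
    have x: "?x \<in> cauchy_seqs V"
      using gE nrm_sub_self[OF gE] by (auto simp: cauchy_seqs_def carr_V)
    have "nrm ?H (cls V ?x) \<le> 1"
    proof (rule nrm_Hmod_leI[OF x])
      fix v l assume "(\<lambda>n :: nat. fibre_norm v ?g) \<longlonglongrightarrow> l"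
      then have "l = l2_norm (sfibre G v) g"
        by (simp add: rho_equivariant_extension LIMSEQ_const_iff)
      then show "l \<le> 1" using g(3)[of v] \<xi> by simp
    qed simp
    then have "nrm ?H (left_mult G \<sigma> f (cls V ?x)) \<le> sup0 ?A"
      using x by (intro sup0_upper[OF bdd]) (auto simp: carr_Hmod)
    moreover have "fibre_norm u (ext_conv G \<sigma> f ?g) \<le> nrm ?H (left_mult G \<sigma> f (cls V ?x))"
      unfolding left_mult_cls[OF f x] by (rule limit_le_nrm_Hmod[OF ext_conv_cauchy[OF f x] u tendsto_const])
    moreover have "l2_norm (sfibre G u) (Ind G (conj_cocycle \<sigma>) u (rho f) \<xi>) = fibre_norm u (ext_conv G \<sigma> f ?g)"
    proof -
      have "Ind G (conj_cocycle \<sigma>) u (rho f) \<xi> = Ind G (conj_cocycle \<sigma>) u (rho f) g"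
        using g(2) by (intro Ind_cong) simp
      then show ?thesis
        by (simp add: rho_ext_conv[OF f gE] rho_equivariant_extension Ind_eq_twisted_conv cong: l2_norm_cong)
    qed
    ultimately show "l2_norm (sfibre G u) (Ind G (conj_cocycle \<sigma>) u (rho f) \<xi>) \<le> sup0 ?A" by simp
  qed
  moreover have "sup0 ?A \<le> ?R" using le by (intro sup0_least R) auto
  ultimately show ?thesis using op by simp
qed

proposition rho_star_homomorphism:
  "star_homomorphism (Cc_equivariant_algebra G \<sigma>) (Cc_twisted G (conj_cocycle \<sigma>)) rho"
  unfolding star_homomorphism_def Cc_equivariant_algebra_def Cc_twisted_def
  by (auto simp: rho_Cc rho_ext_conv involution_eq rho_equivariant_extension) (auto simp: rho_def)

sublocale rho: isometric_star_isomorphism "Cc_equivariant_algebra G \<sigma>" "Cc_twisted G (conj_cocycle \<sigma>)" rho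
proof
  show "star_homomorphism (Cc_equivariant_algebra G \<sigma>) (Cc_twisted G (conj_cocycle \<sigma>)) rho"
    by (rule rho_star_homomorphism)
  show "bij_betw rho (carr (Cc_equivariant_algebra G \<sigma>)) (carr (Cc_twisted G (conj_cocycle \<sigma>)))"
    using bij_betw_rho by (simp add: Cc_equivariant_algebra_def Cc_twisted_def)
qed (auto simp: Cc_equivariant_algebra_def Cc_twisted_def nrm_left_mult equivariant_add equivariant_scale
       ext_conv_equivariant involution_eq equivariant_extension_Cc twisted_star_Cc rho_Cc)

end

theorem propositionA2:
  fixes G :: "'g tgroupoid" and \<sigma> :: "'g \<Rightarrow> 'g \<Rightarrow> complex"
  assumes "etale_groupoid G"
    and "second_countable (gtop G)"
    and "locally_compact_space (gtop G)"
    and "Hausdorff_space (gtop G)"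
    and "principal_groupoid G"
    and "continuous_normalised_cocycle G \<sigma>"
  shows "star_homomorphism (Cc_equivariant_algebra G \<sigma>) (Cc_twisted G (conj_cocycle \<sigma>)) rho \<and>
    rho ` carr (Cc_equivariant_algebra G \<sigma>) = carr (Cc_twisted G (conj_cocycle \<sigma>)) \<and>
    (\<exists>\<Phi>. cstar_isomorphism (Cstar_Kumjian G \<sigma>) (Cstar_reduced G (conj_cocycle \<sigma>)) \<Phi> \<and>
       (\<forall>f\<in>carr (Cc_equivariant_algebra G \<sigma>).
          \<Phi> (to_completion (Cc_equivariant_algebra G \<sigma>) f) = to_completion (Cc_twisted G (conj_cocycle \<sigma>)) (rho f)))"
proof -
  interpret etale_groupoid G by (rule assms(1))
  interpret twisted_extension G \<sigma> by unfold_locales (use assms in auto)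
  show ?thesis
    using rho.hom rho.bij rho.cstar_isomorphism_map_completion rho.map_completion_to_completion
    unfolding Cstar_Kumjian_def Cstar_reduced_def bij_betw_def by blast
qed

end
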